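(* Let $X$ be the diffusion (Itô) process $X_t=X_0+\int_0^t a_s\,dB(s)+\int_0^t b_s\,ds$, $t\in[0,1]$, where $B$ is a standard Brownian motion adapted to a right-continuous filtration $\mathcal{F}=(\mathcal{F}_t,\ t\in[0,1])$ (with respect to which it is a Brownian motion), $a_s,b_s$, $s\in[0,1]$, are $\mathcal F$-adapted random functions with $\int_0^1|b_s|ds<\infty$ and $\int_0^1a_s^2ds<\infty$ a.s., and $X_0$ is $\mathcal{F}_0$-measurable. Write $\mathrm{E}_t[\cdot]=\mathrm{E}[\cdot|\mathcal{F}_t]$. Assume that there exist random variables $K_1,K_2$ with $0<K_i<\infty$ a.s. such that, for any sufficiently small $h>0$ and any $0\le t<t+h\le1$, the following inequalities hold a.s.: $$|a_t|\ge K_1,\qquad \mathrm{E}_t\,b_{t+h}^2\le K_2,\qquad \mathrm{E}_t(a_{t+h}-a_t)^2\le K_2h.$$ Then, for $p=1,2$, $$R^{p,n}(X)-\Lambda_p(1/2)=O(n^{-1/3})\quad\text{a.s. as } n\to\infty.$$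
   Context: For a process $X$ on $[0,1]$, $p\in\{1,2\}$ and $n>p$, put $\Delta^{p,n}_jX=\sum_{i=0}^p(-1)^{p-i}\binom{p}{i}X_{(j+i)/n}$, $j=0,\dots,n-p$, and $$R^{p,n}(X)=\frac{1}{n-p}\sum_{k=0}^{n-p-1}\frac{|\Delta^{p,n}_kX+\Delta^{p,n}_{k+1}X|}{|\Delta^{p,n}_kX|+|\Delta^{p,n}_{k+1}X|},\qquad \tfrac00:=1.$$ $\Lambda_p(H)=\lambda(\rho_p(H))$ with $$\lambda(r)=\frac1\pi\arccos(-r)+\frac1\pi\sqrt{\frac{1+r}{1-r}}\,\log\Big(\frac{2}{1+r}\Big),\quad |r|<1,$$ $$\rho_1(H)=2^{2H-1}-1,\qquad \rho_2(H)=\frac{-3^{2H}+2^{2H+2}-7}{8-2^{2H+1}};$$ in particular $\rho_1(1/2)=0$ and $\rho_2(1/2)=-1/2$. *)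

theory Defs
  imports "HOL-Probability.Probability" "HOL-Library.Landau_Symbols"
begin

section \<open>The increment ratio statistic\<close>

definition gen_incr :: "nat \<Rightarrow> nat \<Rightarrow> (real \<Rightarrow> real) \<Rightarrow> nat \<Rightarrow> real" where
  "gen_incr p n x j =
     (\<Sum>i=0..p. (-1) ^ (p - i) * real (p choose i) * x (real (j + i) / real n))"

definition abs_ratio :: "real \<Rightarrow> real \<Rightarrow> real" where
  "abs_ratio u v = (if \<bar>u\<bar> + \<bar>v\<bar> = 0 then 1 else \<bar>u + v\<bar> / (\<bar>u\<bar> + \<bar>v\<bar>))"

text \<open>Only meaningful for \<open>n > p\<close>.\<close>

definition IR_stat :: "nat \<Rightarrow> nat \<Rightarrow> (real \<Rightarrow> real) \<Rightarrow> real" where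
  "IR_stat p n x =
     1 / real (n - p) * (\<Sum>k<n - p. abs_ratio (gen_incr p n x k) (gen_incr p n x (k + 1)))"

definition IR_lambda :: "real \<Rightarrow> real" where
  "IR_lambda r = 1 / pi * arccos (- r) + 1 / pi * sqrt ((1 + r) / (1 - r)) * ln (2 / (1 + r))"

text \<open>Only meaningful for \<open>p = 1\<close> and \<open>p = 2\<close>.\<close>

definition IR_rho :: "nat \<Rightarrow> real \<Rightarrow> real" where
  "IR_rho p H =
     (if p = 1 then 2 powr (2 * H - 1) - 1
      else (- (3 powr (2 * H)) + 2 powr (2 * H + 2) - 7) / (8 - 2 powr (2 * H + 1)))"

definition IR_Lambda :: "nat \<Rightarrow> real \<Rightarrow> real" where
  "IR_Lambda p H = IR_lambda (IR_rho p H)"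

lemma IR_rho_half: "IR_rho 1 (1/2) = 0" "IR_rho 2 (1/2) = - 1/2"
  by (simp_all add: IR_rho_def)

section \<open>Processes on the unit interval\<close>

text \<open>
  All processes and filtrations have index set \<open>[0,1]\<close>; they are functions on \<open>real\<close> whose
  values outside \<open>{0..1}\<close> are never used. The library's locale \<open>filtration\<close> would constrain
  every real index, so the conditions are stated relative to \<open>{0..1}\<close> here.
  No completeness is assumed.
\<close>

definition right_cont_filtration :: "'a measure \<Rightarrow> (real \<Rightarrow> 'a measure) \<Rightarrow> bool" where
  "right_cont_filtration M F \<longleftrightarrow>
     (\<forall>t\<in>{0..1}. subalgebra M (F t)) \<and>
     (\<forall>s\<in>{0..1}. \<forall>t\<in>{0..1}. s \<le> t \<longrightarrow> sets (F s) \<subseteq> sets (F t)) \<and>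
     (\<forall>t\<in>{0..<1}. sets (F t) = (\<Inter>s\<in>{t<..1}. sets (F s)))"

definition adapted :: "(real \<Rightarrow> 'a measure) \<Rightarrow> (real \<Rightarrow> 'a \<Rightarrow> real) \<Rightarrow> bool" where
  "adapted F Z \<longleftrightarrow> (\<forall>t\<in>{0..1}. Z t \<in> borel_measurable (F t))"

text \<open>
  Joint measurability, which makes the pathwise time integrals of an adapted random
  function into random variables.
\<close>

definition measurable_process :: "'a measure \<Rightarrow> (real \<Rightarrow> 'a \<Rightarrow> real) \<Rightarrow> bool" where
  "measurable_process M Z \<longleftrightarrow>
     (\<lambda>(t, \<omega>). Z t \<omega>) \<in> borel_measurable (restrict_space borel {0..1} \<Otimes>\<^sub>M M)"

definition brownian_motion ::
    "'a measure \<Rightarrow> (real \<Rightarrow> 'a measure) \<Rightarrow> (real \<Rightarrow> 'a \<Rightarrow> real) \<Rightarrow> bool" where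
  "brownian_motion M F B \<longleftrightarrow>
     adapted F B \<and>
     (AE \<omega> in M. B 0 \<omega> = 0) \<and>
     (AE \<omega> in M. continuous_on {0..1} (\<lambda>t. B t \<omega>)) \<and>
     (\<forall>s t. 0 \<le> s \<longrightarrow> s < t \<longrightarrow> t \<le> 1 \<longrightarrow>
        distributed M lborel (\<lambda>\<omega>. B t \<omega> - B s \<omega>) (normal_density 0 (sqrt (t - s))) \<and>
        prob_space.indep_set M (sets (F s))
          (sets (vimage_algebra (space M) (\<lambda>\<omega>. B t \<omega> - B s \<omega>) borel)))"

section \<open>The It\^o integral\<close>

text \<open>
  Measurability is part of the notion: \<open>measure M\<close> is \<open>0\<close> on non-measurable sets, so the
  limit alone would say nothing for non-measurable functions.
\<close>

definition tendsto_in_prob ::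
    "'a measure \<Rightarrow> (nat \<Rightarrow> 'a \<Rightarrow> real) \<Rightarrow> ('a \<Rightarrow> real) \<Rightarrow> bool" where
  "tendsto_in_prob M Y Z \<longleftrightarrow>
     (\<forall>n. Y n \<in> borel_measurable M) \<and> Z \<in> borel_measurable M \<and>
     (\<forall>\<epsilon>>0. (\<lambda>n. measure M {\<omega> \<in> space M. \<bar>Y n \<omega> - Z \<omega>\<bar> > \<epsilon>}) \<longlonglongrightarrow> 0)"

text \<open>
  A triple \<open>m, \<tau>, \<xi>\<close> represents the simple process
  \<open>\<Sum>i<m. \<xi>\<^sub>i 1\<^bsub>(\<tau>\<^sub>i, \<tau>\<^sub>i\<^sub>+\<^sub>1]\<^esub>\<close> with bounded, \<open>F\<close> \<open>(\<tau>\<^sub>i)\<close>-measurable coefficients.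
\<close>

definition simple_repr ::
    "'a measure \<Rightarrow> (real \<Rightarrow> 'a measure) \<Rightarrow> nat \<Rightarrow> (nat \<Rightarrow> real) \<Rightarrow> (nat \<Rightarrow> 'a \<Rightarrow> real) \<Rightarrow> bool" where
  "simple_repr M F m \<tau> \<xi> \<longleftrightarrow>
     0 \<le> \<tau> 0 \<and> \<tau> m \<le> 1 \<and> (\<forall>i<m. \<tau> i \<le> \<tau> (Suc i)) \<and>
     (\<forall>i<m. \<xi> i \<in> borel_measurable (F (\<tau> i)) \<and> (\<exists>C. \<forall>\<omega>\<in>space M. \<bar>\<xi> i \<omega>\<bar> \<le> C))"

definition simple_process ::
    "nat \<Rightarrow> (nat \<Rightarrow> real) \<Rightarrow> (nat \<Rightarrow> 'a \<Rightarrow> real) \<Rightarrow> real \<Rightarrow> 'a \<Rightarrow> real" where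
  "simple_process m \<tau> \<xi> s \<omega> = (\<Sum>i<m. \<xi> i \<omega> * indicator {\<tau> i<..\<tau> (Suc i)} s)"

definition simple_integral ::
    "(real \<Rightarrow> 'a \<Rightarrow> real) \<Rightarrow> nat \<Rightarrow> (nat \<Rightarrow> real) \<Rightarrow> (nat \<Rightarrow> 'a \<Rightarrow> real) \<Rightarrow> real \<Rightarrow> 'a \<Rightarrow> real" where
  "simple_integral B m \<tau> \<xi> t \<omega> =
     (\<Sum>i<m. \<xi> i \<omega> * (B (min (\<tau> (Suc i)) t) \<omega> - B (min (\<tau> i) t) \<omega>))"

definition ito_integrand ::
    "'a measure \<Rightarrow> (real \<Rightarrow> 'a measure) \<Rightarrow> (real \<Rightarrow> 'a \<Rightarrow> real) \<Rightarrow> bool" where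
  "ito_integrand M F a \<longleftrightarrow>
     adapted F a \<and> measurable_process M a \<and>
     (AE \<omega> in M. set_integrable lborel {0..1} (\<lambda>s. (a s \<omega>)\<^sup>2))"

text \<open>
  \<open>I\<close> is a version with a.s. continuous paths of the process \<open>t \<mapsto> \<integral>\<^sub>0\<^sup>t a\<^sub>s dB\<^sub>s\<close>: the limit in
  probability of the integrals of simple processes \<open>\<phi>\<^sub>n\<close> such that \<open>\<integral>\<^sub>0\<^sup>1 (\<phi>\<^sub>n(s) - a\<^sub>s)\<^sup>2 ds\<close>
  tends to \<open>0\<close> in probability. The limit does not depend on the chosen approximation, so this
  determines \<open>I\<close> up to indistinguishability. It is a predicate rather than a function because
  the integral is only defined up to null sets.
\<close>

definition has_ito_integral ::
    "'a measure \<Rightarrow> (real \<Rightarrow> 'a measure) \<Rightarrow> (real \<Rightarrow> 'a \<Rightarrow> real) \<Rightarrow> (real \<Rightarrow> 'a \<Rightarrow> real) \<Rightarrow>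
     (real \<Rightarrow> 'a \<Rightarrow> real) \<Rightarrow> bool" where
  "has_ito_integral M F B a I \<longleftrightarrow>
     ito_integrand M F a \<and>
     (AE \<omega> in M. continuous_on {0..1} (\<lambda>t. I t \<omega>)) \<and>
     (\<exists>m \<tau> \<xi>. (\<forall>n. simple_repr M F (m n) (\<tau> n) (\<xi> n)) \<and>
        tendsto_in_prob M
          (\<lambda>n \<omega>. LBINT s:{0..1}. (simple_process (m n) (\<tau> n) (\<xi> n) s \<omega> - a s \<omega>)\<^sup>2) (\<lambda>\<omega>. 0) \<and>
        (\<forall>t\<in>{0..1}. tendsto_in_prob M (\<lambda>n. simple_integral B (m n) (\<tau> n) (\<xi> n) t) (I t)))"

definition ito_process ::
    "'a measure \<Rightarrow> (real \<Rightarrow> 'a measure) \<Rightarrow> (real \<Rightarrow> 'a \<Rightarrow> real) \<Rightarrow> (real \<Rightarrow> 'a \<Rightarrow> real) \<Rightarrow>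
     (real \<Rightarrow> 'a \<Rightarrow> real) \<Rightarrow> (real \<Rightarrow> 'a \<Rightarrow> real) \<Rightarrow> bool" where
  "ito_process M F B a b X \<longleftrightarrow>
     ito_integrand M F a \<and>
     adapted F b \<and> measurable_process M b \<and>
     (AE \<omega> in M. set_integrable lborel {0..1} (\<lambda>s. b s \<omega>)) \<and>
     X 0 \<in> borel_measurable (F 0) \<and>
     (\<exists>I. has_ito_integral M F B a I \<and>
        (AE \<omega> in M. \<forall>t\<in>{0..1}. X t \<omega> = X 0 \<omega> + I t \<omega> + (LBINT s:{0..t}. b s \<omega>)))"

text \<open>
  Conditional expectation \<open>E[Z | F\<^sub>t]\<close> of a nonnegative variable, as an extended real: unlike
  \<open>real_cond_exp\<close>, which returns \<open>0\<close> where the conditional expectation is infinite, a bound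
  on it is informative without assuming integrability beforehand.
\<close>

definition cond_exp_at ::
    "'a measure \<Rightarrow> (real \<Rightarrow> 'a measure) \<Rightarrow> real \<Rightarrow> ('a \<Rightarrow> real) \<Rightarrow> 'a \<Rightarrow> ennreal" where
  "cond_exp_at M F t Z = nn_cond_exp M (F t) (\<lambda>\<omega>. ennreal (Z \<omega>))"

end

theory Submission
  imports Defs "HOL-Real_Asymp.Real_Asymp"
begin

text \<open>
  Fix \<open>q\<close> and let \<open>G\<close> be the event \<open>1/q < K\<^sub>1, K\<^sub>2 < q\<close>. For each \<open>t\<close> there is an
  event of \<open>F\<^sub>t\<close> that contains \<open>G\<close> up to a null set and on which the three hypotheses hold at
  time \<open>t\<close> with the constant \<open>q\<close>. There, for \<open>t = k/n\<close>, the increments of \<open>X\<close> near \<open>t\<close>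
  differ from \<open>a\<^sub>t\<close> times those of \<open>B\<close> by \<open>O(n\<^bsup>-1\<^esup>)\<close> in conditional root mean square, whereas the
  latter have size \<open>n\<^bsup>-1/2\<^esup>\<close>. The ratio is homogeneous of degree \<open>0\<close> and Lipschitz away from the
  origin; a threshold \<open>\<eta> = n\<^bsup>-5/6\<^esup>\<close> for the Brownian increment balances the probability of a small
  denominator against the approximation error, both being \<open>O(n\<^bsup>-1/3\<^esup>)\<close>. So the \<open>k\<close>-th summand
  minus its Gaussian mean has conditional mean \<open>O(n\<^bsup>-1/3\<^esup>)\<close> given \<open>F\<^sub>t\<close>, and it is measurable three grid
  points later. Splitting the sum by residues modulo three, an exponential moment bound and
  Borel-Cantelli carry the rate over to the average almost surely on \<open>G\<close>. Finally \<open>q \<rightarrow> \<infinity>\<close>.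
\<close>

section \<open>The ratio function\<close>

text \<open>\<open>K1\<close> and \<open>K2\<close> need not be known at any time t < 1, and
  weighting by \<open>G\<close> itself would break the independence of later Brownian increments.
  Hence the passage to events of \<open>F t\<close>: each hypothesis at time t concerns an
  \<open>F t\<close>-measurable quantity, so a bound valid on \<open>G\<close> extends to the
  smallest event of \<open>F t\<close> around it, and the indicator of that event is a legitimate
  weight given \<open>F t\<close>. No moments of \<open>a\<close> or \<open>b\<close> are assumed,
  so the Ito isometry appears as an inequality for truncated squares in extended reals; the limit in
  probability is taken before the truncation is lifted. As null sets need not belong to
  \<open>F t\<close>, X is replaced at each time by an \<open>F t\<close>-measurable version. The
  approximation error enters squared, by the arithmetic-geometric mean inequality, so second moments
  suffice; equating n^(-2) / \<eta>^2 with \<eta> n^(1/2) gives \<eta> = n^(-5/6). Three is the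
  largest value of p + 1, the last grid offset in a ratio. Conditional means of order \<epsilon> =
  n^(-1/3) leave deviation probabilities of order exp(- n \<epsilon>^2) = exp(- n^(1/3)), which are
  summable.\<close>

lemma abs_ratio_nonneg: "0 \<le> abs_ratio u v"
  by (simp add: abs_ratio_def)

lemma abs_ratio_le_1: "abs_ratio u v \<le> 1"
  by (simp add: abs_ratio_def abs_triangle_ineq divide_le_eq)

lemma abs_ratio_scale: "c \<noteq> 0 \<Longrightarrow> abs_ratio (c * u) (c * v) = abs_ratio u v"
proof -
  assume c: "c \<noteq> 0"
  have "\<bar>c * u + c * v\<bar> = \<bar>c\<bar> * \<bar>u + v\<bar>" "\<bar>c * u\<bar> + \<bar>c * v\<bar> = \<bar>c\<bar> * (\<bar>u\<bar> + \<bar>v\<bar>)"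
    by (simp_all add: abs_mult flip: distrib_left)
  then show ?thesis using c
    by (simp add: abs_ratio_def)
qed

lemma abs_ratio_measurable [measurable (raw)]:
  assumes [measurable]: "f \<in> borel_measurable N" "g \<in> borel_measurable N"
  shows "(\<lambda>x. abs_ratio (f x) (g x)) \<in> borel_measurable N"
  unfolding abs_ratio_def by measurable

text \<open>Writing the ratios as p'/D' and p/D, their difference is (p' - p)/D plus (p'/D') (D -
  D')/D, and p'/D' is at most 1; so only the denominator of the unprimed pair survives. If the
  primed pair vanishes, the displacement is at least D and the right side is at least 2.\<close>

lemma abs_ratio_diff_le:
  assumes "\<bar>u\<bar> + \<bar>v\<bar> \<noteq> 0"
  shows "\<bar>abs_ratio u' v' - abs_ratio u v\<bar> \<le> 2 * (\<bar>u' - u\<bar> + \<bar>v' - v\<bar>) / (\<bar>u\<bar> + \<bar>v\<bar>)"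
proof -
  define D D' E where "D = \<bar>u\<bar> + \<bar>v\<bar>" and "D' = \<bar>u'\<bar> + \<bar>v'\<bar>" and "E = \<bar>u' - u\<bar> + \<bar>v' - v\<bar>"
  have D: "D > 0" using assms unfolding D_def by linarith
  have DD: "\<bar>D - D'\<bar> \<le> E" unfolding D_def D'_def E_def by linarith
  show ?thesis
  proof (cases "D' = 0")
    case True
    have "\<bar>1 - abs_ratio u v\<bar> \<le> 1"
      using abs_ratio_nonneg[of u v] abs_ratio_le_1[of u v] by linarith
    moreover have "1 \<le> E / D" using DD D True by (simp add: field_simps)
    moreover have "abs_ratio u' v' = 1" using True by (simp add: abs_ratio_def D'_def)
    ultimately have "\<bar>abs_ratio u' v' - abs_ratio u v\<bar> \<le> 2 * (E / D)" by linarith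
    then show ?thesis by (simp add: D_def E_def)
  next
    case False
    then have D': "D' > 0" unfolding D'_def by linarith
    define p where "p = \<bar>u + v\<bar>"
    define p' where "p' = \<bar>u' + v'\<bar>"
    have pp: "\<bar>p' - p\<bar> \<le> E" unfolding p_def p'_def E_def by linarith
    have r: "abs_ratio u v = p / D" "abs_ratio u' v' = p' / D'"
      using D D' by (auto simp: abs_ratio_def D_def D'_def p_def p'_def)
    have q: "p' / D' \<le> 1" "0 \<le> p' / D'" using r abs_ratio_le_1 abs_ratio_nonneg by metis+
    have "p' / D' - p / D = (p' - p) / D + (p' / D') * ((D - D') / D)"
      using D D' by (simp add: field_simps)
    then have "\<bar>p' / D' - p / D\<bar> \<le> \<bar>(p' - p) / D\<bar> + \<bar>(p' / D') * ((D - D') / D)\<bar>" by linarith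
    also have "\<bar>(p' / D') * ((D - D') / D)\<bar> \<le> 1 * (E / D)"
      unfolding abs_mult using q DD D by (intro mult_mono) (auto simp: divide_right_mono abs_divide)
    also have "\<bar>(p' - p) / D\<bar> \<le> E / D" using pp D by (simp add: divide_right_mono)
    finally show ?thesis unfolding r using D_def E_def by (simp add: field_simps)
  qed
qed

text \<open>If |u| is at most \<eta>, the kernel term is at least 1 and absorbs any difference of
  ratios. Otherwise homogeneity replaces (u, v) by (c u, c v), and the Lipschitz bound is split by 2
  x y <= x^2 + y^2 into a squared error and (\<eta> / u)^2. The Cauchy kernel dominates both regimes
  at once and has an explicit integral.\<close>

lemma abs_ratio_perturb:
  assumes \<eta>: "\<eta> > 0" and \<kappa>: "\<kappa> > 0" and c: "\<bar>c\<bar> \<ge> \<kappa>"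
  shows "\<bar>abs_ratio u' v' - abs_ratio u v\<bar>
           \<le> ((\<bar>u' - c * u\<bar> + \<bar>v' - c * v\<bar>) / (\<kappa> * \<eta>))\<^sup>2 + 2 * \<eta>\<^sup>2 / (\<eta>\<^sup>2 + u\<^sup>2)"
proof (cases "\<bar>u\<bar> \<le> \<eta>")
  case True
  then have "u\<^sup>2 \<le> \<eta>\<^sup>2" by (metis \<eta> abs_le_square_iff abs_of_pos)
  then have "1 \<le> 2 * \<eta>\<^sup>2 / (\<eta>\<^sup>2 + u\<^sup>2)" using \<eta> by (simp add: field_simps add_pos_nonneg)
  moreover have "\<bar>abs_ratio u' v' - abs_ratio u v\<bar> \<le> 1"
    using abs_ratio_nonneg[of u v] abs_ratio_le_1[of u v]
      abs_ratio_nonneg[of u' v'] abs_ratio_le_1[of u' v'] by linarith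
  ultimately show ?thesis
    using zero_le_power2[of "(\<bar>u' - c * u\<bar> + \<bar>v' - c * v\<bar>) / (\<kappa> * \<eta>)"] by linarith
next
  case False
  define U where "U = \<bar>u' - c * u\<bar> + \<bar>v' - c * v\<bar>"
  have U: "U \<ge> 0" by (simp add: U_def)
  have u: "\<bar>u\<bar> > \<eta>" using False by simp
  have c0: "c \<noteq> 0" using \<kappa> c by auto
  have cu: "\<kappa> * \<bar>u\<bar> \<le> \<bar>c * u\<bar> + \<bar>c * v\<bar>"
    unfolding abs_mult using mult_right_mono[OF c, of "\<bar>u\<bar>"] by (smt (verit) abs_ge_zero mult_nonneg_nonneg)
  have pos: "0 < \<kappa> * \<bar>u\<bar>" using \<kappa> u \<eta> by simp
  have "\<bar>abs_ratio u' v' - abs_ratio u v\<bar> \<le> 2 * U / (\<bar>c * u\<bar> + \<bar>c * v\<bar>)"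
    unfolding U_def using abs_ratio_diff_le[of "c * u" "c * v" u' v'] cu pos
    by (simp add: abs_ratio_scale[OF c0])
  also have "\<dots> \<le> 2 * U / (\<kappa> * \<bar>u\<bar>)" using cu pos U by (intro divide_left_mono) auto
  also have "\<dots> = 2 * (U / (\<kappa> * \<eta>)) * (\<eta> / \<bar>u\<bar>)" using \<eta> by simp
  also have "\<dots> \<le> (U / (\<kappa> * \<eta>))\<^sup>2 + (\<eta> / \<bar>u\<bar>)\<^sup>2" by (rule sum_squares_bound)
  also have "(\<eta> / \<bar>u\<bar>)\<^sup>2 \<le> 2 * \<eta>\<^sup>2 / (\<eta>\<^sup>2 + u\<^sup>2)"
  proof -
    have "\<eta>\<^sup>2 \<le> u\<^sup>2" using u \<eta> by (metis abs_le_square_iff abs_of_pos less_imp_le)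
    then have "\<eta>\<^sup>2 * (\<eta>\<^sup>2 + u\<^sup>2) \<le> \<eta>\<^sup>2 * (2 * u\<^sup>2)" by (intro mult_left_mono) auto
    then show ?thesis using \<eta> u by (auto simp: power_divide field_simps add_pos_pos)
  qed
  finally show ?thesis by (simp add: U_def)
qed

section \<open>Gaussian means of the ratio\<close>

lemma quadratic_pos:
  fixes r w :: real assumes "\<bar>r\<bar> < 2" shows "0 < 1 + r * w + w\<^sup>2"
proof -
  have "1 + r * w + w\<^sup>2 = (w + r/2)\<^sup>2 + (1 - r\<^sup>2/4)"
    by (simp add: power2_eq_square algebra_simps)
  moreover have "r\<^sup>2 < 2\<^sup>2" using assms by (metis abs_ge_zero power2_abs power_strict_mono pos2)
  then have "r\<^sup>2 < 4" by simp
  ultimately show ?thesis using zero_le_power2[of "w + r / 2"] by linarith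
qed

text \<open>Completing the square gives the arctangent primitive; s^2 is minus the
  discriminant.\<close>

lemma nn_integral_inverse_quadratic:
  fixes r :: real
  assumes r: "\<bar>r\<bar> < 2"
  defines "s \<equiv> sqrt (4 - r\<^sup>2)"
  shows "(\<integral>\<^sup>+w. ennreal (1 / (1 + r * w + w\<^sup>2)) * indicator {0..} w \<partial>lborel)
           = ennreal (2 / s * (pi / 2 - arctan (r / s)))"
proof -
  have "r\<^sup>2 < 2\<^sup>2" using r by (metis abs_ge_zero power2_abs power_strict_mono pos2)
  then have s: "s > 0" "s\<^sup>2 = 4 - r\<^sup>2" unfolding s_def by auto
  have "((\<lambda>w. 2 / s * arctan ((2 * w + r) / s)) has_field_derivative 1 / (1 + r * w + w\<^sup>2)) (at w)" for w
  proof -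
    have "1 + ((2 * w + r) / s)\<^sup>2 = 4 * (1 + r * w + w\<^sup>2) / s\<^sup>2"
      using s by (simp add: power_divide field_simps) (simp add: power2_eq_square algebra_simps)
    then have "1 / (1 + r * w + w\<^sup>2) = 2 / s * (inverse (1 + ((2 * w + r) / s)\<^sup>2) * (2 / s))"
      using s quadratic_pos[OF r, of w] by (simp add: field_simps power2_eq_square)
    moreover have "((\<lambda>w. (2 * w + r) / s) has_field_derivative 2 / s) (at w)"
      using s by (auto intro!: derivative_eq_intros)
    ultimately show ?thesis
      using DERIV_cmult[OF DERIV_chain2[OF DERIV_arctan], of "\<lambda>w. (2 * w + r) / s" "2 / s" w UNIV "2 / s"]
      by metis
  qed
  moreover have "((\<lambda>w. 2 / s * arctan ((2 * w + r) / s)) \<longlongrightarrow> 2 / s * (pi / 2)) at_top"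
  proof (intro tendsto_mult tendsto_const filterlim_compose[OF tendsto_arctan_at_top])
    show "filterlim (\<lambda>w. (2 * w + r) / s) at_top at_top" using s(1) by real_asymp
  qed
  ultimately have "(\<integral>\<^sup>+w. ennreal (1 / (1 + r * w + w\<^sup>2)) * indicator {0..} w \<partial>lborel)
        = 2 / s * (pi / 2) - 2 / s * arctan ((2 * 0 + r) / s)"
    by (intro nn_integral_FTC_atLeast) (use quadratic_pos[OF r] in \<open>auto intro: less_imp_le\<close>)
  then show ?thesis by (simp add: right_diff_distrib)
qed

text \<open>This is the contribution of pairs of opposite signs, where the ratio is |1 - w| / (1 +
  w). The primitive \<open>G\<close> vanishes at 0 and at infinity and turns at w = 1, so splitting
  there gives twice its value at 1.\<close>

lemma nn_integral_ratio_neg: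
  fixes r :: real
  assumes r: "\<bar>r\<bar> < 2"
  defines "\<alpha> \<equiv> 2 / (2 + r)"
  shows "(\<integral>\<^sup>+w. ennreal (abs_ratio 1 (- w) / (1 - r * w + w\<^sup>2)) * indicator {0..} w \<partial>lborel)
           = ennreal (2 * \<alpha> * (ln 2 - ln (2 - r) / 2))"
proof -
  \<comment> \<open>Partial fractions: \<alpha> is the value of (1 - w) / (1 - r w + w^2) at the
    pole w = -1.\<close>
  define G where "G = (\<lambda>w. \<alpha> * (ln (1 + w) - ln (1 - r * w + w\<^sup>2) / 2))"
  define f where "f = (\<lambda>w. (1 - w) / ((1 + w) * (1 - r * w + w\<^sup>2)))"
  have q: "0 < 1 - r * w + w\<^sup>2" for w
    using quadratic_pos[of "- r" w] r by simp
  have \<alpha>: "2 + r > 0" using r by linarith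
  have G: "(G has_field_derivative f w) (at w)" if "0 \<le> w" for w
  proof -
    have "(G has_field_derivative \<alpha> * (1 / (1 + w) - (2 * w - r) / (1 - r * w + w\<^sup>2) / 2)) (at w)"
      unfolding G_def
    proof (intro DERIV_cmult DERIV_diff DERIV_cdivide)
      show "((\<lambda>w. ln (1 + w)) has_field_derivative 1 / (1 + w)) (at w)"
        using that by (auto intro!: derivative_eq_intros)
      show "((\<lambda>w. ln (1 - r * w + w\<^sup>2)) has_field_derivative (2 * w - r) / (1 - r * w + w\<^sup>2)) (at w)"
        using q[of w] by (auto intro!: derivative_eq_intros)
    qed
    moreover have "\<alpha> * (1 / (1 + w) - (2 * w - r) / (1 - r * w + w\<^sup>2) / 2) = f w"
    proof -
      define Q where "Q = 1 - r * w + w\<^sup>2"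
      have "2 * Q - (2 * w - r) * (1 + w) = (2 + r) * (1 - w)"
        unfolding Q_def by (simp add: power2_eq_square algebra_simps)
      moreover have "\<alpha> * (1 / (1 + w) - (2 * w - r) / Q / 2) = (2 * Q - (2 * w - r) * (1 + w)) / ((2 + r) * ((1 + w) * Q))"
        unfolding \<alpha>_def using that q[of w] \<alpha> by (simp add: Q_def[symmetric] divide_simps)
      ultimately show ?thesis using \<alpha> by (simp add: f_def Q_def)
    qed
    ultimately show ?thesis by simp
  qed
  have fb[measurable]: "f \<in> borel_measurable borel" unfolding f_def by measurable
  have p1: "(\<integral>\<^sup>+w. ennreal (f w) * indicator {0..1} w \<partial>lborel) = ennreal (G 1 - G 0)"
    by (rule nn_integral_FTC_Icc) (use G q in \<open>auto simp: f_def intro!: divide_nonneg_pos mult_pos_pos\<close>)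
  have p2: "(\<integral>\<^sup>+w. ennreal (- f w) * indicator {1..} w \<partial>lborel) = ennreal (0 - (- G 1))"
  proof (rule nn_integral_FTC_atLeast)
    show "((\<lambda>w. - G w) \<longlongrightarrow> 0) at_top"
      unfolding G_def by real_asymp
    show "0 \<le> - f x" if "1 \<le> x" for x
      using that q[of x] unfolding f_def by (auto simp flip: minus_divide_left intro!: divide_nonpos_pos mult_pos_pos)
  qed (auto intro!: DERIV_minus G)
  \<comment> \<open>The two pieces overlap only at w = 1, where the integrand vanishes.\<close>
  have "ennreal (abs_ratio 1 (- w) / (1 - r * w + w\<^sup>2)) * indicator {0..} w
      = ennreal (f w) * indicator {0..1} w + ennreal (- f w) * indicator {1..} w" for w
    by (cases "w = 1") (auto simp: f_def abs_ratio_def indicator_def minus_divide_left)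
  then have "(\<integral>\<^sup>+w. ennreal (abs_ratio 1 (- w) / (1 - r * w + w\<^sup>2)) * indicator {0..} w \<partial>lborel)
      = ennreal (G 1 - G 0) + ennreal (0 - (- G 1))"
    by (simp add: nn_integral_add p1 p2)
  also have "\<dots> = ennreal (2 * G 1)"
  proof -
    have "2 - r \<le> 4" using r by linarith
    then have "ln (2 - r) \<le> ln (2 ^ 2)" using r by (subst ln_le_cancel_iff) auto
    also have "ln (2 ^ 2 :: real) = 2 * ln 2" by (subst ln_realpow) auto
    finally have "G 1 \<ge> 0" using \<alpha> by (simp add: G_def \<alpha>_def)
    moreover have "G 0 = 0" by (simp add: G_def)
    ultimately show ?thesis by (simp flip: ennreal_plus)
  qed
  finally show ?thesis by (simp add: G_def mult.assoc)
qed

lemma nn_integral_split_neg: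
  fixes f :: "real \<Rightarrow> ennreal"
  assumes [measurable]: "f \<in> borel_measurable borel"
  shows "(\<integral>\<^sup>+x. f x \<partial>lborel) = (\<integral>\<^sup>+x. f x * indicator {0..} x \<partial>lborel) + (\<integral>\<^sup>+x. f (- x) * indicator {0..} x \<partial>lborel)"
proof -
  have "(\<integral>\<^sup>+x. f x \<partial>lborel) = (\<integral>\<^sup>+x. f x * indicator {0..} x + f x * indicator {..<0} x \<partial>lborel)"
    by (intro nn_integral_cong) (auto simp: indicator_def)
  also have "\<dots> = (\<integral>\<^sup>+x. f x * indicator {0..} x \<partial>lborel) + (\<integral>\<^sup>+x. f x * indicator {..<0} x \<partial>lborel)"
    by (intro nn_integral_add) auto
  also have "(\<integral>\<^sup>+x. f x * indicator {..<0} x \<partial>lborel) = (\<integral>\<^sup>+x. f (- x) * indicator {..<0} (- x) \<partial>lborel)"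
    by (subst nn_integral_real_affine[where c = "- 1" and t = 0]) auto
  also have "\<dots> = (\<integral>\<^sup>+x. f (- x) * indicator {0..} x \<partial>lborel)"
  proof (intro nn_integral_cong_AE)
    have "AE x in lborel. x \<noteq> (0::real)" by (rule AE_lborel_singleton)
    then show "AE x in lborel. f (- x) * indicator {..<0} (- x) = f (- x) * indicator {0..} x"
      by eventually_elim (auto simp: indicator_def)
  qed
  finally show ?thesis .
qed

text \<open>The weight |u| is the Jacobian of v = u w; it makes the Gaussian integral
  elementary.\<close>

lemma nn_integral_abs_gauss:
  fixes c :: real assumes c: "c > 0"
  shows "(\<integral>\<^sup>+u. ennreal (\<bar>u\<bar> * exp (- c * u\<^sup>2)) \<partial>lborel) = ennreal (1 / c)"
proof -
  have h: "(\<integral>\<^sup>+u. ennreal (\<bar>u\<bar> * exp (- c * u\<^sup>2)) * indicator {0..} u \<partial>lborel) = ennreal (1 / (2 * c))"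
  proof -
    have "(\<integral>\<^sup>+u. ennreal (\<bar>u\<bar> * exp (- c * u\<^sup>2)) * indicator {0..} u \<partial>lborel)
        = (\<integral>\<^sup>+u. ennreal (u * exp (- c * u\<^sup>2)) * indicator {0..} u \<partial>lborel)"
      by (intro nn_integral_cong) (auto simp: indicator_def)
    also have "\<dots> = ennreal (0 - (- 1 / (2 * c) * exp (- c * 0\<^sup>2)))"
      by (rule nn_integral_FTC_atLeast[where F = "\<lambda>u. - 1 / (2 * c) * exp (- c * u\<^sup>2)"])
        (use c in \<open>auto intro!: derivative_eq_intros, real_asymp\<close>)
    finally show ?thesis by simp
  qed
  show ?thesis
  proof (subst nn_integral_split_neg)
    have "ennreal (1 / (2 * c)) + ennreal (1 / (2 * c)) = ennreal (1 / c)"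
      using c by (subst ennreal_plus[symmetric]) auto
    then show "(\<integral>\<^sup>+u. ennreal (\<bar>u\<bar> * exp (- c * u\<^sup>2)) * indicator {0..} u \<partial>lborel) +
        (\<integral>\<^sup>+u. ennreal (\<bar>- u\<bar> * exp (- c * (- u)\<^sup>2)) * indicator {0..} u \<partial>lborel) = ennreal (1 / c)"
      unfolding abs_minus_cancel power2_minus h .
  qed measurable
qed

text \<open>Substituting \<open>v = u w\<close> and using homogeneity of the ratio, the planar Gaussian
  integral becomes a Cauchy-type integral over \<open>w\<close>.\<close>

lemma nn_integral_abs_ratio_gauss2:
  fixes r \<kappa> :: real
  assumes r: "\<bar>r\<bar> < 2" and \<kappa>: "\<kappa> > 0"
  shows "(\<integral>\<^sup>+u. \<integral>\<^sup>+v. ennreal (abs_ratio u v * exp (- \<kappa> * (u\<^sup>2 + r * u * v + v\<^sup>2))) \<partial>lborel \<partial>lborel)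
    = ennreal (1 / \<kappa>) * (\<integral>\<^sup>+w. ennreal (abs_ratio 1 w / (1 + r * w + w\<^sup>2)) \<partial>lborel)"
proof -
  have "(\<integral>\<^sup>+u. \<integral>\<^sup>+v. ennreal (abs_ratio u v * exp (- \<kappa> * (u\<^sup>2 + r * u * v + v\<^sup>2))) \<partial>lborel \<partial>lborel)
    = (\<integral>\<^sup>+u. \<integral>\<^sup>+w. ennreal (abs_ratio 1 w) * ennreal (\<bar>u\<bar> * exp (- (\<kappa> * (1 + r * w + w\<^sup>2)) * u\<^sup>2)) \<partial>lborel \<partial>lborel)"
  proof (intro nn_integral_cong_AE)
    have "AE x in lborel. x \<noteq> (0::real)" by (rule AE_lborel_singleton)
    then show "AE u in lborel. (\<integral>\<^sup>+v. ennreal (abs_ratio u v * exp (- \<kappa> * (u\<^sup>2 + r * u * v + v\<^sup>2))) \<partial>lborel)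
      = (\<integral>\<^sup>+w. ennreal (abs_ratio 1 w) * ennreal (\<bar>u\<bar> * exp (- (\<kappa> * (1 + r * w + w\<^sup>2)) * u\<^sup>2)) \<partial>lborel)"
    proof eventually_elim
      case (elim u)
      have "(\<integral>\<^sup>+v. ennreal (abs_ratio u v * exp (- \<kappa> * (u\<^sup>2 + r * u * v + v\<^sup>2))) \<partial>lborel)
        = ennreal \<bar>u\<bar> * (\<integral>\<^sup>+w. ennreal (abs_ratio u (0 + u * w) * exp (- \<kappa> * (u\<^sup>2 + r * u * (0 + u * w) + (0 + u * w)\<^sup>2))) \<partial>lborel)"
        by (rule nn_integral_real_affine) (use elim in auto)
      also have "\<dots> = (\<integral>\<^sup>+w. ennreal \<bar>u\<bar> * ennreal (abs_ratio u (0 + u * w) * exp (- \<kappa> * (u\<^sup>2 + r * u * (0 + u * w) + (0 + u * w)\<^sup>2))) \<partial>lborel)"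
        by (rule nn_integral_cmult[symmetric]) auto
      also have "\<dots> = (\<integral>\<^sup>+w. ennreal (abs_ratio 1 w) * ennreal (\<bar>u\<bar> * exp (- (\<kappa> * (1 + r * w + w\<^sup>2)) * u\<^sup>2)) \<partial>lborel)"
      proof (intro nn_integral_cong)
        fix w
        have "abs_ratio u (0 + u * w) = abs_ratio 1 w"
          using abs_ratio_scale[OF elim, of 1 w] by simp
        moreover have "- \<kappa> * (u\<^sup>2 + r * u * (0 + u * w) + (0 + u * w)\<^sup>2) = - (\<kappa> * (1 + r * w + w\<^sup>2)) * u\<^sup>2"
          by (simp add: power2_eq_square algebra_simps)
        ultimately show "ennreal \<bar>u\<bar> * ennreal (abs_ratio u (0 + u * w) * exp (- \<kappa> * (u\<^sup>2 + r * u * (0 + u * w) + (0 + u * w)\<^sup>2)))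
          = ennreal (abs_ratio 1 w) * ennreal (\<bar>u\<bar> * exp (- (\<kappa> * (1 + r * w + w\<^sup>2)) * u\<^sup>2))"
          by (simp add: abs_ratio_nonneg mult_ac flip: ennreal_mult)
      qed
      finally show ?case .
    qed
  qed
  also have "\<dots> = (\<integral>\<^sup>+w. \<integral>\<^sup>+u. ennreal (abs_ratio 1 w) * ennreal (\<bar>u\<bar> * exp (- (\<kappa> * (1 + r * w + w\<^sup>2)) * u\<^sup>2)) \<partial>lborel \<partial>lborel)"
    by (rule lborel_pair.Fubini') measurable
  also have "\<dots> = (\<integral>\<^sup>+w. ennreal (1 / \<kappa>) * ennreal (abs_ratio 1 w / (1 + r * w + w\<^sup>2)) \<partial>lborel)"
  proof (intro nn_integral_cong)
    fix w
    have "(\<integral>\<^sup>+u. ennreal (abs_ratio 1 w) * ennreal (\<bar>u\<bar> * exp (- (\<kappa> * (1 + r * w + w\<^sup>2)) * u\<^sup>2)) \<partial>lborel)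
      = ennreal (abs_ratio 1 w) * (\<integral>\<^sup>+u. ennreal (\<bar>u\<bar> * exp (- (\<kappa> * (1 + r * w + w\<^sup>2)) * u\<^sup>2)) \<partial>lborel)"
      by (rule nn_integral_cmult) auto
    also have "(\<integral>\<^sup>+u. ennreal (\<bar>u\<bar> * exp (- (\<kappa> * (1 + r * w + w\<^sup>2)) * u\<^sup>2)) \<partial>lborel) = ennreal (1 / (\<kappa> * (1 + r * w + w\<^sup>2)))"
      using \<kappa> quadratic_pos[OF r] by (intro nn_integral_abs_gauss) simp
    finally show "(\<integral>\<^sup>+u. ennreal (abs_ratio 1 w) * ennreal (\<bar>u\<bar> * exp (- (\<kappa> * (1 + r * w + w\<^sup>2)) * u\<^sup>2)) \<partial>lborel)
       = ennreal (1 / \<kappa>) * ennreal (abs_ratio 1 w / (1 + r * w + w\<^sup>2))"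
      using \<kappa> quadratic_pos[OF r, of w] by (simp add: abs_ratio_nonneg flip: ennreal_mult)
  qed
  also have "\<dots> = ennreal (1 / \<kappa>) * (\<integral>\<^sup>+w. ennreal (abs_ratio 1 w / (1 + r * w + w\<^sup>2)) \<partial>lborel)"
    by (rule nn_integral_cmult) auto
  finally show ?thesis .
qed

text \<open>For w >= 0 the ratio is 1, which yields the arctangent; the reflected half-line yields
  the logarithm. Both terms are checked to be nonnegative, so that addition of extended reals agrees
  with real addition.\<close>

lemma nn_integral_abs_ratio_quadratic:
  fixes r :: real
  assumes r: "\<bar>r\<bar> < 2"
  defines "s \<equiv> sqrt (4 - r\<^sup>2)"
  shows "(\<integral>\<^sup>+w. ennreal (abs_ratio 1 w / (1 + r * w + w\<^sup>2)) \<partial>lborel)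
    = ennreal (2 / s * (pi / 2 - arctan (r / s)) + 4 / (2 + r) * (ln 2 - ln (2 - r) / 2))"
proof -
  have "(\<integral>\<^sup>+w. ennreal (abs_ratio 1 w / (1 + r * w + w\<^sup>2)) * indicator {0..} w \<partial>lborel)
     = (\<integral>\<^sup>+w. ennreal (1 / (1 + r * w + w\<^sup>2)) * indicator {0..} w \<partial>lborel)"
    by (intro nn_integral_cong) (auto simp: indicator_def abs_ratio_def)
  also have "\<dots> = ennreal (2 / s * (pi / 2 - arctan (r / s)))"
    unfolding s_def by (rule nn_integral_inverse_quadratic[OF r])
  finally have 1: "(\<integral>\<^sup>+w. ennreal (abs_ratio 1 w / (1 + r * w + w\<^sup>2)) * indicator {0..} w \<partial>lborel) = \<dots>" .
  have "r\<^sup>2 < 2\<^sup>2" using r by (metis abs_ge_zero power2_abs power_strict_mono pos2)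
  then have s: "s > 0" unfolding s_def by auto
  have "2 - r \<le> 4" using r by linarith
  then have "ln (2 - r) \<le> ln (2 ^ 2)" using r by (subst ln_le_cancel_iff) auto
  also have "ln (2 ^ 2 :: real) = 2 * ln 2" by (subst ln_realpow) auto
  finally have "ln 2 - ln (2 - r) / 2 \<ge> 0" by simp
  then have "4 / (2 + r) * (ln 2 - ln (2 - r) / 2) \<ge> 0" using r by (intro mult_nonneg_nonneg) auto
  moreover have "2 / s * (pi / 2 - arctan (r / s)) \<ge> 0" using s arctan_ubound[of "r / s"] by simp
  ultimately show ?thesis
  proof (subst nn_integral_split_neg)
    have "(\<integral>\<^sup>+w. ennreal (abs_ratio 1 (- w) / (1 + r * (- w) + (- w)\<^sup>2)) * indicator {0..} w \<partial>lborel)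
        = ennreal (4 / (2 + r) * (ln 2 - ln (2 - r) / 2))"
      using nn_integral_ratio_neg[OF r] by simp
    then show "(\<integral>\<^sup>+w. ennreal (abs_ratio 1 w / (1 + r * w + w\<^sup>2)) * indicator {0..} w \<partial>lborel) +
        (\<integral>\<^sup>+w. ennreal (abs_ratio 1 (- w) / (1 + r * (- w) + (- w)\<^sup>2)) * indicator {0..} w \<partial>lborel)
      = ennreal (2 / s * (pi / 2 - arctan (r / s)) + 4 / (2 + r) * (ln 2 - ln (2 - r) / 2))"
      using \<open>4 / (2 + r) * (ln 2 - ln (2 - r) / 2) \<ge> 0\<close> \<open>2 / s * (pi / 2 - arctan (r / s)) \<ge> 0\<close>
      unfolding 1 by (simp only: ennreal_plus)
  qed measurable
qed

section \<open>The Gaussian constants for first and second differences\<close>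

definition std_gauss :: "real measure" where
  "std_gauss = density lborel std_normal_density"

lemma prob_space_std_gauss: "prob_space std_gauss"
  unfolding std_gauss_def by (rule prob_space_normal_density) simp

lemma sets_std_gauss [measurable_cong, simp]: "sets std_gauss = sets borel"
  by (simp add: std_gauss_def)

lemma space_std_gauss [simp]: "space std_gauss = UNIV"
  by (simp add: std_gauss_def)

lemma nn_integral_std_gauss:
  "f \<in> borel_measurable borel \<Longrightarrow>
    (\<integral>\<^sup>+x. f x \<partial>std_gauss) = (\<integral>\<^sup>+x. ennreal (std_normal_density x) * f x \<partial>lborel)"
  unfolding std_gauss_def by (rule nn_integral_density) auto

text \<open>Independent coordinates are the case r = 0, \<kappa> = 1/2 of the planar integral; with
  the normalization 1 / (2 pi) the value is 1/2 + ln 2 / pi.\<close>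

lemma std_gauss_abs_ratio_indep:
  "(\<integral>\<^sup>+x. \<integral>\<^sup>+y. ennreal (abs_ratio x y) \<partial>std_gauss \<partial>std_gauss) = ennreal (IR_lambda 0)"
proof -
  interpret G: prob_space std_gauss by (rule prob_space_std_gauss)
  have "(\<integral>\<^sup>+x. \<integral>\<^sup>+y. ennreal (abs_ratio x y) \<partial>std_gauss \<partial>std_gauss)
    = (\<integral>\<^sup>+x. ennreal (std_normal_density x) *
        (\<integral>\<^sup>+y. ennreal (std_normal_density y) * ennreal (abs_ratio x y) \<partial>lborel) \<partial>lborel)"
    by (simp add: nn_integral_std_gauss)
  also have "\<dots> = (\<integral>\<^sup>+x. \<integral>\<^sup>+y. ennreal (1 / (2 * pi)) *
      ennreal (abs_ratio x y * exp (- (1/2) * (x\<^sup>2 + 0 * x * y + y\<^sup>2))) \<partial>lborel \<partial>lborel)"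
  proof (intro nn_integral_cong)
    fix x
    have "ennreal (std_normal_density x) * (\<integral>\<^sup>+y. ennreal (std_normal_density y) * ennreal (abs_ratio x y) \<partial>lborel)
      = (\<integral>\<^sup>+y. ennreal (std_normal_density x) * (ennreal (std_normal_density y) * ennreal (abs_ratio x y)) \<partial>lborel)"
      by (rule nn_integral_cmult[symmetric]) auto
    also have "\<dots> = (\<integral>\<^sup>+y. ennreal (1 / (2 * pi)) *
      ennreal (abs_ratio x y * exp (- (1/2) * (x\<^sup>2 + 0 * x * y + y\<^sup>2))) \<partial>lborel)"
    proof (intro nn_integral_cong)
      fix y
      have "std_normal_density x * std_normal_density y = 1 / (2 * pi) * exp (- (1/2) * (x\<^sup>2 + 0 * x * y + y\<^sup>2))"
        by (simp add: std_normal_density_def exp_add[symmetric] field_simps)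
      then show "ennreal (std_normal_density x) * (ennreal (std_normal_density y) * ennreal (abs_ratio x y)) =
         ennreal (1 / (2 * pi)) * ennreal (abs_ratio x y * exp (- (1/2) * (x\<^sup>2 + 0 * x * y + y\<^sup>2)))"
        by (simp add: abs_ratio_nonneg ennreal_mult[symmetric] mult.assoc[symmetric])
    qed
    finally show "ennreal (std_normal_density x) * (\<integral>\<^sup>+y. ennreal (std_normal_density y) * ennreal (abs_ratio x y) \<partial>lborel) = \<dots>" .
  qed
  also have "\<dots> = ennreal (1 / (2 * pi)) * (\<integral>\<^sup>+x. \<integral>\<^sup>+y. 
      ennreal (abs_ratio x y * exp (- (1/2) * (x\<^sup>2 + 0 * x * y + y\<^sup>2))) \<partial>lborel \<partial>lborel)"
    by (simp add: nn_integral_cmult)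
  also have "\<dots> = ennreal (1 / (2 * pi)) * (ennreal (1 / (1/2)) * ennreal (2 / sqrt (4 - 0\<^sup>2) * (pi / 2 - arctan (0 / sqrt (4 - 0\<^sup>2))) + 4 / (2 + 0) * (ln 2 - ln (2 - 0) / 2)))"
    by (subst nn_integral_abs_ratio_gauss2, simp, simp, subst nn_integral_abs_ratio_quadratic, simp, rule refl)
  also have "\<dots> = ennreal (1 / (2 * pi) * (2 * (pi / 2 + ln 2)))"
    by (subst ennreal_mult'[symmetric], simp, subst ennreal_mult'[symmetric], simp)
       (simp del: ennreal_plus)
  also have "1 / (2 * pi) * (2 * (pi / 2 + ln 2)) = IR_lambda 0"
    by (simp add: IR_lambda_def field_simps)
  finally show ?thesis .
qed

text \<open>The variables y - x and z - y have variance 2 and covariance -1, hence determinant 3 and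
  correlation -1/2. Integrating out the middle variable produces their joint density, which is the
  case r = 1, \<kappa> = 1/3 of the planar integral.\<close>

lemma std_gauss_abs_ratio_second_diff:
  "(\<integral>\<^sup>+x. \<integral>\<^sup>+y. \<integral>\<^sup>+z. ennreal (abs_ratio (y - x) (z - y)) \<partial>std_gauss \<partial>std_gauss \<partial>std_gauss)
     = ennreal (IR_lambda (- 1/2))"
proof -
  interpret G: prob_space std_gauss by (rule prob_space_std_gauss)
  interpret GL: pair_sigma_finite std_gauss std_gauss ..
  let ?d = "\<lambda>x. ennreal (std_normal_density x)"
  let ?Q = "\<lambda>u v::real. abs_ratio u v * exp (- (1/3) * (u\<^sup>2 + 1 * u * v + v\<^sup>2))"
  have "(\<integral>\<^sup>+x. \<integral>\<^sup>+y. \<integral>\<^sup>+z. ennreal (abs_ratio (y - x) (z - y)) \<partial>std_gauss \<partial>std_gauss \<partial>std_gauss)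
    = (\<integral>\<^sup>+y. \<integral>\<^sup>+x. \<integral>\<^sup>+z. ennreal (abs_ratio (y - x) (z - y)) \<partial>std_gauss \<partial>std_gauss \<partial>std_gauss)"
    by (rule GL.Fubini') measurable
  \<comment> \<open>With y fixed, x and z are replaced by u = y - x and v = z - y.\<close>
  also have "\<dots> = (\<integral>\<^sup>+y. \<integral>\<^sup>+u. \<integral>\<^sup>+v. ?d y * ?d (y - u) * ?d (y + v) * ennreal (abs_ratio u v) \<partial>lborel \<partial>lborel \<partial>lborel)"
  proof (subst nn_integral_std_gauss, measurable, intro nn_integral_cong)
    fix y :: real
    have z: "(\<integral>\<^sup>+z. ennreal (abs_ratio u (z - y)) \<partial>std_gauss) = (\<integral>\<^sup>+v. ?d (y + v) * ennreal (abs_ratio u v) \<partial>lborel)" for u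
      by (subst nn_integral_std_gauss, measurable, subst nn_integral_real_affine[where c = 1 and t = y]) auto
    have "(\<integral>\<^sup>+x. \<integral>\<^sup>+z. ennreal (abs_ratio (y - x) (z - y)) \<partial>std_gauss \<partial>std_gauss)
      = (\<integral>\<^sup>+u. ?d (y - u) * (\<integral>\<^sup>+z. ennreal (abs_ratio u (z - y)) \<partial>std_gauss) \<partial>lborel)"
      by (subst nn_integral_std_gauss, measurable, subst nn_integral_real_affine[where c = "-1" and t = y]) auto
    then have "?d y * (\<integral>\<^sup>+x. \<integral>\<^sup>+z. ennreal (abs_ratio (y - x) (z - y)) \<partial>std_gauss \<partial>std_gauss)
      = ?d y * (\<integral>\<^sup>+u. ?d (y - u) * (\<integral>\<^sup>+v. ?d (y + v) * ennreal (abs_ratio u v) \<partial>lborel) \<partial>lborel)"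
      by (simp add: z)
    also have "\<dots> = (\<integral>\<^sup>+u. \<integral>\<^sup>+v. ?d y * ?d (y - u) * ?d (y + v) * ennreal (abs_ratio u v) \<partial>lborel \<partial>lborel)"
      by (simp add: nn_integral_cmult[symmetric] mult.assoc)
    finally show "?d y * (\<integral>\<^sup>+x. \<integral>\<^sup>+z. ennreal (abs_ratio (y - x) (z - y)) \<partial>std_gauss \<partial>std_gauss) = \<dots>" .
  qed
  \<comment> \<open>Two exchanges bring y innermost, where its Gaussian integral can be
    evaluated.\<close>
  also have "\<dots> = (\<integral>\<^sup>+u. \<integral>\<^sup>+y. \<integral>\<^sup>+v. ?d y * ?d (y - u) * ?d (y + v) * ennreal (abs_ratio u v) \<partial>lborel \<partial>lborel \<partial>lborel)"
    by (rule lborel_pair.Fubini') measurable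
  also have "\<dots> = (\<integral>\<^sup>+u. \<integral>\<^sup>+v. \<integral>\<^sup>+y. ?d y * ?d (y - u) * ?d (y + v) * ennreal (abs_ratio u v) \<partial>lborel \<partial>lborel \<partial>lborel)"
    by (intro nn_integral_cong lborel_pair.Fubini') measurable
  also have "\<dots> = (\<integral>\<^sup>+u. \<integral>\<^sup>+v. ennreal (1 / (2 * pi * sqrt 3)) * ennreal (?Q u v) \<partial>lborel \<partial>lborel)"
  proof (intro nn_integral_cong)
    fix u v :: real
    have "?d y * ?d (y - u) * ?d (y + v) * ennreal (abs_ratio u v)
       = ennreal (1 / (2 * pi * sqrt 3)) * ennreal (?Q u v) * ennreal (normal_density ((u - v) / 3) (1 / sqrt 3) y)" for y
    proof -
      \<comment> \<open>Completing the square in y: given u and v, the middle variable is normal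
        with mean (u - v) / 3 and variance 1/3.\<close>
      have e: "- (y\<^sup>2 / 2) + (- ((y - u)\<^sup>2 / 2) + - ((y + v)\<^sup>2 / 2)) =
          - (1/3) * (u\<^sup>2 + 1 * u * v + v\<^sup>2) + - ((y - (u - v) / 3)\<^sup>2 * 3 / 2)"
        by (simp add: power2_eq_square field_simps)
      have c: "(1 / sqrt (2 * pi)) ^ 3 = 1 / (2 * pi * sqrt 3) * (sqrt 3 / sqrt (2 * pi))"
        by (simp add: power3_eq_cube field_simps)
      have n: "normal_density ((u - v) / 3) (1 / sqrt 3) y = sqrt 3 / sqrt (2 * pi) * exp (- ((y - (u - v) / 3)\<^sup>2 * 3 / 2))"
        by (simp add: normal_density_def power_divide real_sqrt_divide)
      have "std_normal_density y * std_normal_density (y - u) * std_normal_density (y + v)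
        = (1 / sqrt (2 * pi)) ^ 3 * exp (- (y\<^sup>2 / 2) + (- ((y - u)\<^sup>2 / 2) + - ((y + v)\<^sup>2 / 2)))"
        unfolding exp_add by (simp add: std_normal_density_def power3_eq_cube)
      also have "\<dots> = 1 / (2 * pi * sqrt 3) * exp (- (1/3) * (u\<^sup>2 + 1 * u * v + v\<^sup>2)) * normal_density ((u - v) / 3) (1 / sqrt 3) y"
        unfolding e c n exp_add by simp
      finally have "std_normal_density y * std_normal_density (y - u) * std_normal_density (y + v) * abs_ratio u v
        = 1 / (2 * pi * sqrt 3) * ?Q u v * normal_density ((u - v) / 3) (1 / sqrt 3) y"
        by simp
      then show ?thesis
        by (simp add: abs_ratio_nonneg ennreal_mult[symmetric] del: mult_1)
    qed
    then have "(\<integral>\<^sup>+y. ?d y * ?d (y - u) * ?d (y + v) * ennreal (abs_ratio u v) \<partial>lborel)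
      = ennreal (1 / (2 * pi * sqrt 3)) * ennreal (?Q u v) * (\<integral>\<^sup>+y. ennreal (normal_density ((u - v) / 3) (1 / sqrt 3) y) \<partial>lborel)"
      by (simp add: nn_integral_cmult)
    also have "(\<integral>\<^sup>+y. ennreal (normal_density ((u - v) / 3) (1 / sqrt 3) y) \<partial>lborel) = 1"
      by (subst nn_integral_eq_integral) auto
    finally show "(\<integral>\<^sup>+y. ?d y * ?d (y - u) * ?d (y + v) * ennreal (abs_ratio u v) \<partial>lborel)
      = ennreal (1 / (2 * pi * sqrt 3)) * ennreal (?Q u v)" by simp
  qed
  also have "\<dots> = ennreal (1 / (2 * pi * sqrt 3)) * (\<integral>\<^sup>+u. \<integral>\<^sup>+v. ennreal (?Q u v) \<partial>lborel \<partial>lborel)"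
    by (simp add: nn_integral_cmult)
  also have "\<dots> = ennreal (1 / (2 * pi * sqrt 3)) * (ennreal (1 / (1/3)) * ennreal (2 / sqrt (4 - 1\<^sup>2) * (pi / 2 - arctan (1 / sqrt (4 - 1\<^sup>2))) + 4 / (2 + 1) * (ln 2 - ln (2 - 1) / 2)))"
    by (subst nn_integral_abs_ratio_gauss2, simp, simp, subst nn_integral_abs_ratio_quadratic, simp, rule refl)
  also have "\<dots> = ennreal (IR_lambda (- 1/2))"
  proof -
    define a where "a = sqrt (3::real)"
    have a: "a > 0" "a * a = 3" by (simp_all add: a_def)
    have at: "arctan (1 / a) = pi / 6"
      unfolding a_def by (rule arctan_unique) (auto simp: tan_30)
    have ac: "arccos (1 / 2) = pi / 3"
      using arccos_cos[of "pi / 3"] by (simp add: cos_60)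
    have l4: "ln 4 = 2 * ln (2::real)"
      using ln_realpow[of 2 2] by simp
    have sq: "sqrt (1 / 3) = 1 / a" "sqrt (4 - 1\<^sup>2) = a" by (simp_all add: real_sqrt_divide a_def)
    have "1 / (2 * pi * a) * (1 / (1/3) * (2 / a * (pi / 2 - pi / 6) + 4 / (2 + 1) * (ln 2 - ln (2 - 1) / 2)))
       = 1 / (a * a) + 2 * ln 2 / (pi * a)"
      using a(1) by (simp add: field_simps)
    also have "\<dots> = IR_lambda (- 1/2)"
      using a(1) by (simp add: IR_lambda_def ac l4 sq a(2) field_simps)
    finally show ?thesis
      unfolding a_def[symmetric] sq at
      by (subst ennreal_mult'[symmetric], simp, subst ennreal_mult'[symmetric]) (use a in simp_all)
  qed
  finally show ?thesis .
qed

section \<open>Sums of variables with small conditional means\<close>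

text \<open>For negative x, exp x is at most 1 / (1 - x), and (1 + x + x^2) (1 - x) = 1 - x^3 is at
  least 1.\<close>

lemma exp_le_quadratic:
  fixes x :: real assumes "\<bar>x\<bar> \<le> 1" shows "exp x \<le> 1 + x + x\<^sup>2"
proof (cases "0 \<le> x")
  case True
  then show ?thesis using exp_bound[of x] assms by auto
next
  case False
  have "exp x * (1 - x) \<le> exp x * exp (- x)"
    using exp_ge_add_one_self[of "- x"] by (intro mult_left_mono) auto
  also have "\<dots> = 1" by (simp flip: exp_add)
  also have "1 \<le> (1 + x + x\<^sup>2) * (1 - x)"
  proof -
    have "(1 + x + x\<^sup>2) * (1 - x) = 1 + (- x) * x\<^sup>2" by (simp add: power2_eq_square algebra_simps)
    moreover have "(- x) * x\<^sup>2 \<ge> 0" using False by (intro mult_nonneg_nonneg) auto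
    ultimately show ?thesis by linarith
  qed
  finally show ?thesis using False by (subst (asm) mult_le_cancel_right_pos) auto
qed

text \<open>An almost sure upper bound for the conditional mean given \<open>G\<close>, tested
  against bounded nonnegative weights so that no version of a conditional expectation has to be
  chosen. It is one-sided; a two-sided bound is obtained by using it for a variable and its
  negative.\<close>

definition cond_mean_le :: "'a measure \<Rightarrow> 'a measure \<Rightarrow> ('a \<Rightarrow> real) \<Rightarrow> real \<Rightarrow> bool" where
  "cond_mean_le M G \<eta> \<epsilon> \<longleftrightarrow>
     (\<forall>Z\<in>borel_measurable G. (\<forall>\<omega>. 0 \<le> Z \<omega>) \<longrightarrow> (\<exists>C. \<forall>\<omega>. Z \<omega> \<le> C) \<longrightarrow>
        (\<integral>\<omega>. Z \<omega> * \<eta> \<omega> \<partial>M) \<le> \<epsilon> * (\<integral>\<omega>. Z \<omega> \<partial>M))"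

context prob_space
begin

lemma integrable_bdd:
  fixes f :: "'a \<Rightarrow> real"
  shows "f \<in> borel_measurable M \<Longrightarrow> (\<And>\<omega>. \<bar>f \<omega>\<bar> \<le> C) \<Longrightarrow> integrable M f"
  by (rule integrable_const_bound[of _ C]) auto

text \<open>Induction on the number of terms: the exponential \<open>Z\<close> of the partial sum is
  an admissible weight for the next term, and exp x <= 1 + x + x^2 costs a factor of at most 1 +
  \<epsilon>^2 + \<epsilon> \<epsilon>. Taking the bound on the conditional means also as the
  exponential parameter makes the linear and the quadratic contribution equal, whence the 2.\<close>

lemma exp_moment_le:
  fixes \<eta> :: "nat \<Rightarrow> 'a \<Rightarrow> real"
  assumes \<epsilon>: "0 \<le> \<epsilon>" "\<epsilon> \<le> 1"
    and sub: "\<And>j. subalgebra M (G j)" and mono: "\<And>i j. i \<le> j \<Longrightarrow> subalgebra (G j) (G i)"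
    and bd: "\<And>j \<omega>. \<bar>\<eta> j \<omega>\<bar> \<le> 1"
    and meas: "\<And>j. \<eta> j \<in> borel_measurable (G (Suc j))"
    and cond: "\<And>j. cond_mean_le M (G j) (\<eta> j) \<epsilon>"
  shows "(\<integral>\<omega>. exp (\<epsilon> * (\<Sum>j<m. \<eta> j \<omega>)) \<partial>M) \<le> exp (2 * \<epsilon>\<^sup>2 * real m)"
proof (induction m)
  case 0
  then show ?case by (simp add: prob_space)
next
  case (Suc m)
  define Z where "Z = (\<lambda>\<omega>. exp (\<epsilon> * (\<Sum>j<m. \<eta> j \<omega>)))"
  \<comment> \<open>\<open>Z\<close> involves only indices below \<open>m\<close>, and the term of
    index j is known at Suc j, hence at \<open>m\<close>.\<close>
  have ZG: "Z \<in> borel_measurable (G m)"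
    unfolding Z_def
    by (intro borel_measurable_exp measurable_compose[OF _ borel_measurable_exp] borel_measurable_times borel_measurable_const borel_measurable_sum
          measurable_from_subalg[OF mono meas]) auto
  then have [measurable]: "Z \<in> borel_measurable M" by (rule measurable_from_subalg[OF sub])
  have [measurable]: "\<And>j. \<eta> j \<in> borel_measurable M" using meas by (rule measurable_from_subalg[OF sub])
  have Z0: "0 \<le> Z \<omega>" for \<omega> by (simp add: Z_def)
  have Zb: "Z \<omega> \<le> exp (real m)" for \<omega>
  proof -
    have "(\<Sum>j<m. \<eta> j \<omega>) \<le> (\<Sum>j<m. 1)" using bd by (intro sum_mono) (meson abs_le_D1)
    then have "\<epsilon> * (\<Sum>j<m. \<eta> j \<omega>) \<le> \<epsilon> * real m" using \<epsilon> by (intro mult_left_mono) auto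
    also have "\<dots> \<le> real m" using \<epsilon> by (simp add: mult_left_le_one_le)
    finally show ?thesis by (simp add: Z_def)
  qed
  have eb: "exp (\<epsilon> * \<eta> m \<omega>) \<le> exp 1" for \<omega>
    using \<epsilon> abs_le_D1[OF bd[of m \<omega>]] by (simp add: mult_left_le order.trans[of _ \<epsilon>])
  have iZ: "integrable M Z" using Zb Z0 by (intro integrable_bdd[of _ "exp (real m)"]) auto
  have iZe: "integrable M (\<lambda>\<omega>. Z \<omega> * \<eta> m \<omega>)"
    using mult_mono[OF Zb bd] Z0 by (intro integrable_bdd[of _ "exp (real m) * 1"]) (auto simp: abs_mult)
  have "(\<integral>\<omega>. exp (\<epsilon> * (\<Sum>j<Suc m. \<eta> j \<omega>)) \<partial>M) \<le> (\<integral>\<omega>. (1 + \<epsilon>\<^sup>2) * Z \<omega> + \<epsilon> * (Z \<omega> * \<eta> m \<omega>) \<partial>M)"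
  proof (rule integral_mono)
    show "integrable M (\<lambda>\<omega>. exp (\<epsilon> * (\<Sum>j<Suc m. \<eta> j \<omega>)))"
      using mult_mono[OF Zb eb] Z0 by (intro integrable_bdd[of _ "exp (real m) * exp 1"]) (auto simp: Z_def distrib_left exp_add)
    show "integrable M (\<lambda>\<omega>. (1 + \<epsilon>\<^sup>2) * Z \<omega> + \<epsilon> * (Z \<omega> * \<eta> m \<omega>))" using iZ iZe by auto
    fix \<omega>
    have "\<bar>\<epsilon> * \<eta> m \<omega>\<bar> \<le> 1" using \<epsilon> bd[of m \<omega>] by (simp add: abs_mult mult_le_one)
    then have "exp (\<epsilon> * \<eta> m \<omega>) \<le> 1 + \<epsilon> * \<eta> m \<omega> + (\<epsilon> * \<eta> m \<omega>)\<^sup>2" by (rule exp_le_quadratic)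
    moreover have "(\<eta> m \<omega>)\<^sup>2 \<le> 1" using bd[of m \<omega>] by (simp add: abs_square_le_1)
    then have "(\<epsilon> * \<eta> m \<omega>)\<^sup>2 \<le> \<epsilon>\<^sup>2" by (simp add: power_mult_distrib mult_left_le)
    ultimately have "exp (\<epsilon> * \<eta> m \<omega>) \<le> 1 + \<epsilon>\<^sup>2 + \<epsilon> * \<eta> m \<omega>" by linarith
    then have "Z \<omega> * exp (\<epsilon> * \<eta> m \<omega>) \<le> Z \<omega> * (1 + \<epsilon>\<^sup>2 + \<epsilon> * \<eta> m \<omega>)" using Z0 by (rule mult_left_mono)
    then show "exp (\<epsilon> * (\<Sum>j<Suc m. \<eta> j \<omega>)) \<le> (1 + \<epsilon>\<^sup>2) * Z \<omega> + \<epsilon> * (Z \<omega> * \<eta> m \<omega>)"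
      by (simp add: Z_def distrib_left exp_add algebra_simps)
  qed
  also have "\<dots> = (1 + \<epsilon>\<^sup>2) * (\<integral>\<omega>. Z \<omega> \<partial>M) + \<epsilon> * (\<integral>\<omega>. Z \<omega> * \<eta> m \<omega> \<partial>M)"
    using iZ iZe by simp
  also have "\<dots> \<le> (1 + \<epsilon>\<^sup>2) * (\<integral>\<omega>. Z \<omega> \<partial>M) + \<epsilon> * (\<epsilon> * (\<integral>\<omega>. Z \<omega> \<partial>M))"
    using cond[of m] ZG Z0 Zb \<epsilon> unfolding cond_mean_le_def by (intro add_left_mono mult_left_mono) blast+
  also have "\<dots> = (1 + 2 * \<epsilon>\<^sup>2) * (\<integral>\<omega>. Z \<omega> \<partial>M)" by (simp add: power2_eq_square algebra_simps)
  also have "\<dots> \<le> exp (2 * \<epsilon>\<^sup>2) * exp (2 * \<epsilon>\<^sup>2 * real m)"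
    using Suc.IH exp_ge_add_one_self[of "2 * \<epsilon>\<^sup>2"] by (intro mult_mono) (auto simp: Z_def)
  also have "\<dots> = exp (2 * \<epsilon>\<^sup>2 * real (Suc m))" by (simp add: algebra_simps flip: exp_add)
  finally show ?case .
qed

text \<open>Markov's inequality for the exponential: the threshold contributes the exponent 3
  \<epsilon>^2 m against the 2 \<epsilon>^2 m of the moment bound.\<close>

lemma prob_sum_ge_le:
  fixes \<eta> :: "nat \<Rightarrow> 'a \<Rightarrow> real"
  assumes \<epsilon>: "0 \<le> \<epsilon>" "\<epsilon> \<le> 1"
    and sub: "\<And>j. subalgebra M (G j)" and mono: "\<And>i j. i \<le> j \<Longrightarrow> subalgebra (G j) (G i)"
    and bd: "\<And>j \<omega>. \<bar>\<eta> j \<omega>\<bar> \<le> 1"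
    and meas: "\<And>j. \<eta> j \<in> borel_measurable (G (Suc j))"
    and cond: "\<And>j. cond_mean_le M (G j) (\<eta> j) \<epsilon>"
  shows "prob {\<omega> \<in> space M. (\<Sum>j<m. \<eta> j \<omega>) \<ge> 3 * \<epsilon> * real m} \<le> exp (- (\<epsilon>\<^sup>2 * real m))"
proof -
  have [measurable]: "\<And>j. \<eta> j \<in> borel_measurable M" using meas by (rule measurable_from_subalg[OF sub])
  define Y where "Y = (\<lambda>\<omega>. exp (\<epsilon> * (\<Sum>j<m. \<eta> j \<omega>)))"
  have Yb: "Y \<omega> \<le> exp (real m)" for \<omega>
  proof -
    have "(\<Sum>j<m. \<eta> j \<omega>) \<le> (\<Sum>j<m. 1)" using bd by (intro sum_mono) (meson abs_le_D1)
    then have "\<epsilon> * (\<Sum>j<m. \<eta> j \<omega>) \<le> \<epsilon> * real m" using \<epsilon> by (intro mult_left_mono) auto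
    also have "\<dots> \<le> real m" using \<epsilon> by (simp add: mult_left_le_one_le)
    finally show ?thesis by (simp add: Y_def)
  qed
  have [measurable]: "Y \<in> borel_measurable M" unfolding Y_def by measurable
  have iY: "integrable M Y" using Yb by (intro integrable_bdd[of _ "exp (real m)"]) (auto simp: Y_def)
  have "prob {\<omega> \<in> space M. (\<Sum>j<m. \<eta> j \<omega>) \<ge> 3 * \<epsilon> * real m} \<le> prob {\<omega> \<in> space M. Y \<omega> \<ge> exp (3 * \<epsilon>\<^sup>2 * real m)}"
  proof (intro finite_measure_mono subsetI)
    fix \<omega> assume "\<omega> \<in> {\<omega> \<in> space M. (\<Sum>j<m. \<eta> j \<omega>) \<ge> 3 * \<epsilon> * real m}"
    then have "\<epsilon> * (3 * \<epsilon> * real m) \<le> \<epsilon> * (\<Sum>j<m. \<eta> j \<omega>)" "\<omega> \<in> space M"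
      using \<epsilon> by (auto intro: mult_left_mono)
    then show "\<omega> \<in> {\<omega> \<in> space M. Y \<omega> \<ge> exp (3 * \<epsilon>\<^sup>2 * real m)}"
      by (simp add: Y_def power2_eq_square mult_ac)
  qed measurable
  also have "\<dots> \<le> (\<integral>\<omega>. Y \<omega> \<partial>M) / exp (3 * \<epsilon>\<^sup>2 * real m)"
    by (rule integral_Markov_inequality_measure[OF iY, where A = "{}"]) (auto simp: Y_def)
  also have "\<dots> \<le> exp (2 * \<epsilon>\<^sup>2 * real m) / exp (3 * \<epsilon>\<^sup>2 * real m)"
    unfolding Y_def by (intro divide_right_mono exp_moment_le[where G = G] assms) auto
  also have "\<dots> = exp (- (\<epsilon>\<^sup>2 * real m))" by (simp flip: exp_diff)
  finally show ?thesis .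
qed

text \<open>Within one residue class modulo \<open>L\<close> the terms have lag one with respect to
  the filtration sampled at \<open>j * L + r\<close>. If the whole sum reaches the threshold, some
  class reaches its share, and the union bound gives the factor \<open>L\<close>.\<close>

lemma prob_sum_lag_ge_le:
  fixes \<xi> :: "nat \<Rightarrow> 'a \<Rightarrow> real"
  assumes \<epsilon>: "0 \<le> \<epsilon>" "\<epsilon> \<le> 1"
    and sub: "\<And>j. subalgebra M (G j)" and mono: "\<And>i j. i \<le> j \<Longrightarrow> subalgebra (G j) (G i)"
    and bd: "\<And>j \<omega>. \<bar>\<xi> j \<omega>\<bar> \<le> 1"
    and meas: "\<And>j. \<xi> j \<in> borel_measurable (G (j + L))"
    and cond: "\<And>j. cond_mean_le M (G j) (\<xi> j) \<epsilon>" and L: "L > 0"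
  shows "prob {\<omega> \<in> space M. (\<Sum>k<m * L. \<xi> k \<omega>) \<ge> 3 * \<epsilon> * real (m * L)} \<le> real L * exp (- (\<epsilon>\<^sup>2 * real m))"
proof -
  have [measurable]: "\<And>j. \<xi> j \<in> borel_measurable M" using meas by (rule measurable_from_subalg[OF sub])
  define E where "E = (\<lambda>r. {\<omega> \<in> space M. (\<Sum>j<m. \<xi> (j * L + r) \<omega>) \<ge> 3 * \<epsilon> * real m})"
  have [measurable]: "E r \<in> events" for r unfolding E_def by measurable
  have s: "(\<Sum>k<m * L. \<xi> k \<omega>) = (\<Sum>r<L. \<Sum>j<m. \<xi> (j * L + r) \<omega>)" for \<omega>
  proof -
    have "(\<Sum>k<m * L. \<xi> k \<omega>) = (\<Sum>j<m. \<Sum>k = j * L..<j * L + L. \<xi> k \<omega>)"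
      by (rule sum.nat_group[symmetric])
    also have "\<dots> = (\<Sum>j<m. \<Sum>r<L. \<xi> (j * L + r) \<omega>)"
    proof (rule sum.cong[OF refl])
      fix j
      show "(\<Sum>k = j * L..<j * L + L. \<xi> k \<omega>) = (\<Sum>r<L. \<xi> (j * L + r) \<omega>)"
        using sum.shift_bounds_nat_ivl[of "\<lambda>k. \<xi> k \<omega>" 0 "j * L" L]
        by (simp add: lessThan_atLeast0 add.commute)
    qed
    finally show ?thesis by (simp add: sum.swap[of _ "{..<L}"])
  qed
  have "{\<omega> \<in> space M. (\<Sum>k<m * L. \<xi> k \<omega>) \<ge> 3 * \<epsilon> * real (m * L)} \<subseteq> (\<Union>r<L. E r)"
  proof
    fix \<omega> assume *: "\<omega> \<in> {\<omega> \<in> space M. (\<Sum>k<m * L. \<xi> k \<omega>) \<ge> 3 * \<epsilon> * real (m * L)}"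
    show "\<omega> \<in> (\<Union>r<L. E r)"
    proof (rule ccontr)
      assume "\<omega> \<notin> (\<Union>r<L. E r)"
      then have "(\<Sum>r<L. \<Sum>j<m. \<xi> (j * L + r) \<omega>) < (\<Sum>r<L. 3 * \<epsilon> * real m)"
        using * L by (intro sum_strict_mono) (auto simp: E_def not_le)
      then show False using * unfolding mem_Collect_eq s by (simp add: algebra_simps)
    qed
  qed
  then have "prob {\<omega> \<in> space M. (\<Sum>k<m * L. \<xi> k \<omega>) \<ge> 3 * \<epsilon> * real (m * L)} \<le> prob (\<Union>r<L. E r)"
    by (intro finite_measure_mono) auto
  also have "\<dots> \<le> (\<Sum>r<L. prob (E r))" by (intro finite_measure_subadditive_finite) auto
  also have "\<dots> \<le> (\<Sum>r<L. exp (- (\<epsilon>\<^sup>2 * real m)))"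
    unfolding E_def
  proof (intro sum_mono prob_sum_ge_le[OF \<epsilon>, where G = "\<lambda>j. G (j * L + _)"])
    fix r j
    show "\<xi> (j * L + r) \<in> borel_measurable (G (Suc j * L + r))"
      using meas[of "j * L + r"] by (simp add: algebra_simps)
  qed (auto intro: sub mono bd cond)
  finally show ?thesis by simp
qed

text \<open>With \<epsilon> = C n^(-1/3) the deviation probability is at most L exp(- n^(1/3)),
  which is summable, and the threshold 3 \<epsilon> n L becomes 3 C L n^(2/3). Row n has
  \<open>n * L\<close> terms so that every residue class has exactly n of them.\<close>

lemma AE_sum_bound:
  fixes \<xi> :: "nat \<Rightarrow> nat \<Rightarrow> 'a \<Rightarrow> real" and C :: real
  assumes C: "C \<ge> 1" and L: "L > 0"
    and sub: "\<And>n j. subalgebra M (G n j)" and mono: "\<And>n i j. i \<le> j \<Longrightarrow> subalgebra (G n j) (G n i)"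
    and bd: "\<And>n j \<omega>. \<bar>\<xi> n j \<omega>\<bar> \<le> 1"
    and meas: "\<And>n j. \<xi> n j \<in> borel_measurable (G n (j + L))"
    and cond: "\<And>n j. n \<ge> n0 \<Longrightarrow> cond_mean_le M (G n j) (\<xi> n j) (C * real n powr (- 1/3))"
  shows "AE \<omega> in M. eventually (\<lambda>n. (\<Sum>k<n * L. \<xi> n k \<omega>) < 3 * C * L * real n powr (2/3)) sequentially"
proof -
  have [measurable]: "\<And>n j. \<xi> n j \<in> borel_measurable M" using meas by (rule measurable_from_subalg[OF sub])
  \<comment> \<open>The exponential moment bound asks for \<epsilon> <= 1.\<close>
  have "eventually (\<lambda>n. C * real n powr (- 1/3) \<le> 1) sequentially" by real_asymp
  then obtain n1 where n1: "\<And>n. n \<ge> n1 \<Longrightarrow> C * real n powr (- 1/3) \<le> 1" by (auto simp: eventually_sequentially)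
  have "eventually (\<lambda>n. exp (- (real n powr (1/3))) \<le> 1 / real n ^ 2) sequentially"
    by real_asymp
  then have "eventually (\<lambda>n. real L * exp (- (real n powr (1/3))) \<le> real L * (1 / real n ^ 2)) sequentially"
    by eventually_elim (intro mult_left_mono, auto)
  then obtain n2 where n2: "\<And>n. n \<ge> n2 \<Longrightarrow> real L * exp (- (real n powr (1/3))) \<le> real L * (1 / real n ^ 2)"
    by (auto simp: eventually_sequentially)
  \<comment> \<open>Shifting the index by \<open>n3\<close> puts every term of the series in the
    range where all asymptotic bounds hold, and keeps the row number positive.\<close>
  define n3 where "n3 = Max {n0, n1, n2, 1}"
  have n3: "n3 \<ge> n0" "n3 \<ge> n1" "n3 \<ge> n2" "n3 \<ge> 1" by (auto simp: n3_def)
  define A where "A = (\<lambda>n. {\<omega> \<in> space M. (\<Sum>k<(n + n3) * L. \<xi> (n + n3) k \<omega>) \<ge> 3 * C * L * real (n + n3) powr (2/3)})"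
  have bound: "prob (A n) \<le> real L * (1 / real (n + n3) ^ 2)" for n
  proof -
    define N where "N = n + n3"
    have N: "N \<ge> n0" "N \<ge> n1" "N \<ge> n2" "N \<ge> 1" using n3 by (auto simp: N_def)
    define w where "w = real N powr (- 1/3)"
    define \<epsilon> where "\<epsilon> = C * w"
    have e: "0 \<le> \<epsilon>" "\<epsilon> \<le> 1" using C n1[OF N(2)] by (auto simp: \<epsilon>_def w_def)
    have p: "w * real N = real N powr (2/3)"
      using N powr_add[of "real N" "- 1/3" 1] by (simp add: w_def)
    have p': "w\<^sup>2 * real N = real N powr (1/3)"
      using N powr_add[of "real N" "- 2/3" 1] by (simp add: w_def powr_power)
    have "3 * \<epsilon> * real (N * L) = 3 * C * L * (w * real N)"
      by (simp add: \<epsilon>_def)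
    then have eq: "3 * \<epsilon> * real (N * L) = 3 * C * L * real N powr (2/3)" by (simp add: p)
    then have "prob (A n) = prob {\<omega> \<in> space M. (\<Sum>k<N * L. \<xi> N k \<omega>) \<ge> 3 * \<epsilon> * real (N * L)}"
      unfolding A_def N_def[symmetric] eq by simp
    also have "\<dots> \<le> real L * exp (- (\<epsilon>\<^sup>2 * real N))"
      using cond[OF N(1)] by (intro prob_sum_lag_ge_le[OF e, where G = "G N"] sub mono bd meas L) (auto simp: \<epsilon>_def w_def)
    also have "\<dots> \<le> real L * exp (- (real N powr (1/3)))"
    proof -
      \<comment> \<open>As C >= 1, the factor C^2 may be dropped from the exponent.\<close>
      have "real N powr (1/3) = 1 * (w\<^sup>2 * real N)" by (simp add: p')
      also have "\<dots> \<le> C\<^sup>2 * (w\<^sup>2 * real N)"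
        using C by (intro mult_right_mono) auto
      also have "\<dots> = \<epsilon>\<^sup>2 * real N" by (simp add: \<epsilon>_def power_mult_distrib)
      finally show ?thesis by (intro mult_left_mono) auto
    qed
    also have "\<dots> \<le> real L * (1 / real N ^ 2)" by (rule n2[OF N(3)])
    finally show ?thesis by (simp add: N_def)
  qed
  have "summable (\<lambda>n. 1 / real (n + n3) ^ 2)"
    using inverse_power_summable[of 2, where 'a = real] by (subst summable_iff_shift) (simp add: inverse_eq_divide)
  then have "summable (\<lambda>n. prob (A n))"
  proof (rule summable_comparison_test'[OF summable_mult[of _ "real L"], of _ 0])
    show "norm (prob (A n)) \<le> real L * (1 / real (n + n3) ^ 2)" for n
      using bound[of n] by (simp only: real_norm_def abs_of_nonneg[OF measure_nonneg])
  qed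
  then have "AE \<omega> in M. eventually (\<lambda>n. \<omega> \<in> space M - A n) sequentially"
  proof (intro borel_cantelli_AE1)
    show "A n \<in> events" for n unfolding A_def by measurable
    show "emeasure M (A n) < \<infinity>" for n by (simp add: emeasure_eq_measure)
  qed
  then show ?thesis
  proof eventually_elim
    case (elim \<omega>)
    then have "eventually (\<lambda>n. (\<Sum>k<(n + n3) * L. \<xi> (n + n3) k \<omega>) < 3 * C * L * real (n + n3) powr (2/3)) sequentially"
      by eventually_elim (auto simp: A_def not_le)
    then show ?case by (subst (asm) eventually_sequentially_seg)
  qed
qed

end

section \<open>Brownian increments\<close>

lemma nn_integral_normal_density_std_gauss:
  fixes f :: "real \<Rightarrow> ennreal"
  assumes \<sigma>: "\<sigma> > 0" and [measurable]: "f \<in> borel_measurable borel"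
  shows "(\<integral>\<^sup>+x. f x \<partial>density lborel (normal_density 0 \<sigma>)) = (\<integral>\<^sup>+x. f (\<sigma> * x) \<partial>std_gauss)"
proof -
  have "(\<integral>\<^sup>+x. f x \<partial>density lborel (normal_density 0 \<sigma>)) = (\<integral>\<^sup>+x. ennreal (normal_density 0 \<sigma> x) * f x \<partial>lborel)"
    by (rule nn_integral_density) auto
  also have "\<dots> = ennreal \<bar>\<sigma>\<bar> * (\<integral>\<^sup>+x. ennreal (normal_density 0 \<sigma> (0 + \<sigma> * x)) * f (0 + \<sigma> * x) \<partial>lborel)"
    by (rule nn_integral_real_affine) (use \<sigma> in auto)
  also have "\<dots> = (\<integral>\<^sup>+x. ennreal \<bar>\<sigma>\<bar> * (ennreal (normal_density 0 \<sigma> (0 + \<sigma> * x)) * f (0 + \<sigma> * x)) \<partial>lborel)"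
    by (rule nn_integral_cmult[symmetric]) measurable
  also have "\<dots> = (\<integral>\<^sup>+x. ennreal (std_normal_density x) * f (\<sigma> * x) \<partial>lborel)"
  proof (intro nn_integral_cong)
    fix x
    have "\<sigma> * normal_density 0 \<sigma> (\<sigma> * x) = std_normal_density x"
      using \<sigma> by (simp add: normal_density_def real_sqrt_mult power_mult_distrib)
    then show "ennreal \<bar>\<sigma>\<bar> * (ennreal (normal_density 0 \<sigma> (0 + \<sigma> * x)) * f (0 + \<sigma> * x))
        = ennreal (std_normal_density x) * f (\<sigma> * x)"
      using \<sigma> by (simp add: mult.assoc[symmetric] ennreal_mult[symmetric])
  qed
  also have "\<dots> = (\<integral>\<^sup>+x. f (\<sigma> * x) \<partial>std_gauss)"
    by (rule nn_integral_std_gauss[symmetric]) measurable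
  finally show ?thesis .
qed

lemma std_gauss_second_moment: "(\<integral>\<^sup>+x. ennreal (x\<^sup>2) \<partial>std_gauss) = 1"
proof -
  have "(\<integral>\<^sup>+x. ennreal (x\<^sup>2) \<partial>std_gauss) = (\<integral>\<^sup>+x. ennreal (std_normal_density x * x ^ (2 * 1)) \<partial>lborel)"
    by (subst nn_integral_std_gauss) (auto simp: ennreal_mult)
  also have "\<dots> = ennreal (fact (2 * 1) / (2 ^ 1 * fact 1))"
    by (rule nn_integral_eq_integrable[THEN iffD2]) (use std_normal_moment_even[of 1] in \<open>auto simp: has_bochner_integral_iff\<close>)
  finally show ?thesis by simp
qed

text \<open>The factor \<open>1 / \<sigma>\<close> comes from bounding the Gaussian density by a constant and
  integrating the Cauchy kernel exactly.\<close>

lemma std_gauss_cauchy_kernel_le: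
  assumes \<eta>: "\<eta> > 0" and \<sigma>: "\<sigma> > 0"
  shows "(\<integral>\<^sup>+x. ennreal (2 * \<eta>\<^sup>2 / (\<eta>\<^sup>2 + (\<sigma> * x - v)\<^sup>2)) \<partial>std_gauss) \<le> ennreal (7 * \<eta> / \<sigma>)"
proof -
  have "(\<integral>\<^sup>+x. ennreal (2 * \<eta>\<^sup>2 / (\<eta>\<^sup>2 + (\<sigma> * x - v)\<^sup>2)) \<partial>std_gauss)
      = (\<integral>\<^sup>+x. ennreal (std_normal_density x) * ennreal (2 * \<eta>\<^sup>2 / (\<eta>\<^sup>2 + (\<sigma> * x - v)\<^sup>2)) \<partial>lborel)"
    by (rule nn_integral_std_gauss) measurable
  also have "\<dots> \<le> (\<integral>\<^sup>+x. ennreal (2 * \<eta>\<^sup>2 / (\<eta>\<^sup>2 + (\<sigma> * x - v)\<^sup>2)) \<partial>lborel)"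
  proof (intro nn_integral_mono)
    fix x
    have "1 \<le> sqrt (2 * pi)" using pi_gt3 by (intro real_le_rsqrt) auto
    then have "std_normal_density x \<le> 1"
      unfolding std_normal_density_def by (intro mult_le_one) auto
    then have "ennreal (std_normal_density x) * ennreal (2 * \<eta>\<^sup>2 / (\<eta>\<^sup>2 + (\<sigma> * x - v)\<^sup>2))
      \<le> 1 * ennreal (2 * \<eta>\<^sup>2 / (\<eta>\<^sup>2 + (\<sigma> * x - v)\<^sup>2))"
      by (intro mult_right_mono) auto
    then show "ennreal (std_normal_density x) * ennreal (2 * \<eta>\<^sup>2 / (\<eta>\<^sup>2 + (\<sigma> * x - v)\<^sup>2))
      \<le> ennreal (2 * \<eta>\<^sup>2 / (\<eta>\<^sup>2 + (\<sigma> * x - v)\<^sup>2))" by simp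
  qed
  also have "\<dots> = ennreal \<bar>\<eta> / \<sigma>\<bar> * (\<integral>\<^sup>+y. ennreal (2 * \<eta>\<^sup>2 / (\<eta>\<^sup>2 + (\<sigma> * (v / \<sigma> + \<eta> / \<sigma> * y) - v)\<^sup>2)) \<partial>lborel)"
    by (rule nn_integral_real_affine) (use \<eta> \<sigma> in auto)
  also have "(\<lambda>y. 2 * \<eta>\<^sup>2 / (\<eta>\<^sup>2 + (\<sigma> * (v / \<sigma> + \<eta> / \<sigma> * y) - v)\<^sup>2)) = (\<lambda>y. 2 * (1 / (1 + 0 * y + y\<^sup>2)))"
  proof
    fix y
    have "\<sigma> * (v / \<sigma> + \<eta> / \<sigma> * y) - v = \<eta> * y" using \<sigma> by (simp add: field_simps)
    then have "\<eta>\<^sup>2 + (\<sigma> * (v / \<sigma> + \<eta> / \<sigma> * y) - v)\<^sup>2 = \<eta>\<^sup>2 * (1 + y\<^sup>2)"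
      by (simp add: power_mult_distrib algebra_simps)
    then show "2 * \<eta>\<^sup>2 / (\<eta>\<^sup>2 + (\<sigma> * (v / \<sigma> + \<eta> / \<sigma> * y) - v)\<^sup>2) = 2 * (1 / (1 + 0 * y + y\<^sup>2))"
      using \<eta> by simp
  qed
  also have "(\<integral>\<^sup>+y. ennreal (2 * (1 / (1 + 0 * y + y\<^sup>2))) \<partial>lborel) = ennreal (2 * pi)"
  proof -
    have h: "(\<integral>\<^sup>+y. ennreal (1 / (1 + 0 * y + y\<^sup>2)) * indicator {0..} y \<partial>lborel) = ennreal (pi / 2)"
      using nn_integral_inverse_quadratic[of 0] by simp
    have "(\<integral>\<^sup>+y. ennreal (1 / (1 + 0 * y + y\<^sup>2)) \<partial>lborel) = ennreal (pi / 2) + ennreal (pi / 2)"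
      by (subst nn_integral_split_neg) (use h in simp_all)
    also have "\<dots> = ennreal pi" by (subst ennreal_plus[symmetric]) auto
    finally have "(\<integral>\<^sup>+y. ennreal (1 / (1 + 0 * y + y\<^sup>2)) \<partial>lborel) = ennreal pi" .
    then have "ennreal 2 * (\<integral>\<^sup>+y. ennreal (1 / (1 + 0 * y + y\<^sup>2)) \<partial>lborel) = ennreal (2 * pi)"
      by (simp add: ennreal_mult)
    then show ?thesis
      by (subst ennreal_mult) (simp_all add: nn_integral_cmult)
  qed
  also have "ennreal \<bar>\<eta> / \<sigma>\<bar> * ennreal (2 * pi) = ennreal (\<eta> / \<sigma> * (2 * pi))"
    using \<eta> \<sigma> by (subst ennreal_mult) auto
  also have "\<dots> \<le> ennreal (7 * \<eta> / \<sigma>)"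
  proof (intro ennreal_leI)
    have "2 * pi \<le> 7" using pi_less_4 pi_approx by simp
    then have "\<eta> / \<sigma> * (2 * pi) \<le> \<eta> / \<sigma> * 7" using \<eta> \<sigma> by (intro mult_left_mono) auto
    then show "\<eta> / \<sigma> * (2 * pi) \<le> 7 * \<eta> / \<sigma>" by (simp add: mult.commute)
  qed
  finally show ?thesis .
qed

locale filtered_brownian = prob_space M for M :: "'a measure" +
  fixes F :: "real \<Rightarrow> 'a measure" and B :: "real \<Rightarrow> 'a \<Rightarrow> real"
  assumes filt: "right_cont_filtration M F" and bm: "brownian_motion M F B"
begin

lemma subalgebra_F: "0 \<le> t \<Longrightarrow> t \<le> 1 \<Longrightarrow> subalgebra M (F t)"
  using filt by (auto simp: right_cont_filtration_def)

lemma subalgebra_F_mono: "0 \<le> s \<Longrightarrow> s \<le> t \<Longrightarrow> t \<le> 1 \<Longrightarrow> subalgebra (F t) (F s)"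
  using filt by (auto simp: right_cont_filtration_def subalgebra_def)

lemma measurable_F_mono: "f \<in> measurable (F s) N \<Longrightarrow> 0 \<le> s \<Longrightarrow> s \<le> t \<Longrightarrow> t \<le> 1 \<Longrightarrow> f \<in> measurable (F t) N"
  using measurable_from_subalg subalgebra_F_mono by blast

lemma measurable_F: "f \<in> measurable (F s) N \<Longrightarrow> 0 \<le> s \<Longrightarrow> s \<le> 1 \<Longrightarrow> f \<in> measurable M N"
  using measurable_from_subalg subalgebra_F by blast

lemma B_measurable_F: "0 \<le> s \<Longrightarrow> s \<le> t \<Longrightarrow> t \<le> 1 \<Longrightarrow> B s \<in> borel_measurable (F t)"
  using bm measurable_F_mono[of "B s" s borel t] by (auto simp: brownian_motion_def adapted_def)

lemma B_measurable: "0 \<le> s \<Longrightarrow> s \<le> 1 \<Longrightarrow> B s \<in> borel_measurable M"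
  using B_measurable_F measurable_F by blast

section \<open>Independence of the past, and moments of increments\<close>

lemma increment_indep:
  fixes W :: "'a \<Rightarrow> real"
  assumes st: "0 \<le> s" "s < t" "t \<le> 1" and W: "W \<in> measurable (F s) N"
  shows "indep_var N W borel (\<lambda>\<omega>. B t \<omega> - B s \<omega>)"
proof -
  let ?D = "\<lambda>\<omega>. B t \<omega> - B s \<omega>"
  have [measurable]: "B t \<in> borel_measurable M" "B s \<in> borel_measurable M"
    using st by (auto intro: B_measurable)
  have sub: "subalgebra M (F s)" using st by (auto intro: subalgebra_F)
  have WM: "W \<in> measurable M N" using st by (intro measurable_F[OF W]) auto
  have "indep_set (sets (F s)) (sets (vimage_algebra (space M) ?D borel))"
    using bm st by (auto simp: brownian_motion_def)
  moreover have "sigma_sets (space M) {W -` A \<inter> space M |A. A \<in> sets N} \<subseteq> sets (F s)"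
  proof -
    have "{W -` A \<inter> space M |A. A \<in> sets N} \<subseteq> sets (F s)"
      using measurable_sets[OF W] sub by (auto simp: subalgebra_def)
    then show ?thesis using sub sets.sigma_sets_subset[of _ "F s"] by (simp add: subalgebra_def)
  qed
  ultimately have "indep_set (sigma_sets (space M) {W -` A \<inter> space M |A. A \<in> sets N})
      (sigma_sets (space M) {?D -` A \<inter> space M |A. A \<in> sets borel})"
    unfolding indep_sets2_eq sets_vimage_algebra by (meson subset_iff)
  moreover have "?D \<in> borel_measurable M" by measurable
  ultimately show ?thesis using WM unfolding indep_var_eq by blast
qed

lemma distr_increment:
  assumes st: "0 \<le> s" "s < t" "t \<le> 1"
  shows "distr M borel (\<lambda>\<omega>. B t \<omega> - B s \<omega>) = density lborel (normal_density 0 (sqrt (t - s)))"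
proof -
  have "distributed M lborel (\<lambda>\<omega>. B t \<omega> - B s \<omega>) (normal_density 0 (sqrt (t - s)))"
    using bm st by (auto simp: brownian_motion_def)
  then have "distr M lborel (\<lambda>\<omega>. B t \<omega> - B s \<omega>) = density lborel (normal_density 0 (sqrt (t - s)))"
    by (simp add: distributed_def)
  moreover have "distr M lborel (\<lambda>\<omega>. B t \<omega> - B s \<omega>) = distr M borel (\<lambda>\<omega>. B t \<omega> - B s \<omega>)"
    by (intro distr_cong) auto
  ultimately show ?thesis by simp
qed

text \<open>By independence the joint law of the past datum \<open>W\<close> and the increment is a
  product, so the increment can be integrated out as a scaled Gaussian with \<open>W\<close> frozen.
  \<open>W\<close> takes values in an arbitrary space, so that earlier increments can be carried
  along and removed one at a time.\<close>

lemma nn_integral_increment: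
  assumes st: "0 \<le> s" "s < t" "t \<le> 1" and W: "W \<in> measurable (F s) N"
    and f[measurable]: "f \<in> borel_measurable (N \<Otimes>\<^sub>M borel)"
  shows "(\<integral>\<^sup>+\<omega>. f (W \<omega>, B t \<omega> - B s \<omega>) \<partial>M)
     = (\<integral>\<^sup>+\<omega>. (\<integral>\<^sup>+x. f (W \<omega>, sqrt (t - s) * x) \<partial>std_gauss) \<partial>M)"
proof -
  let ?D = "\<lambda>\<omega>. B t \<omega> - B s \<omega>"
  interpret G: prob_space std_gauss by (rule prob_space_std_gauss)
  have [measurable]: "B t \<in> borel_measurable M" "B s \<in> borel_measurable M"
    using st by (auto intro: B_measurable)
  have WM[measurable]: "W \<in> measurable M N" using st by (intro measurable_F[OF W]) auto
  interpret D: prob_space "distr M borel ?D" by (rule prob_space_distr) measurable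
  interpret W: prob_space "distr M N W" by (rule prob_space_distr) measurable
  have sub: "subalgebra M (F s)" using st by (auto intro: subalgebra_F)
  \<comment> \<open>Rectangles determine the product law, and on rectangles the identity is the
    independence contained in \<open>brownian_motion\<close>.\<close>
  have "distr M N W \<Otimes>\<^sub>M distr M borel ?D = distr M (N \<Otimes>\<^sub>M borel) (\<lambda>\<omega>. (W \<omega>, ?D \<omega>))"
  proof (rule pair_measure_eqI)
    fix A C assume A: "A \<in> sets (distr M N W)" and C: "C \<in> sets (distr M borel ?D)"
    have [measurable]: "A \<in> sets N" "C \<in> sets borel" using A C by auto
    have "indep_set (sets (F s)) (sets (vimage_algebra (space M) ?D borel))"
      using bm st by (auto simp: brownian_motion_def)
    moreover have "W -` A \<inter> space M \<in> sets (F s)"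
      using measurable_sets[OF W, of A] sub by (simp add: subalgebra_def)
    moreover have "?D -` C \<inter> space M \<in> sets (vimage_algebra (space M) ?D borel)"
      by (rule in_vimage_algebra) measurable
    ultimately have "prob ((W -` A \<inter> space M) \<inter> (?D -` C \<inter> space M)) = prob (W -` A \<inter> space M) * prob (?D -` C \<inter> space M)"
      by (rule indep_setD)
    moreover have "(\<lambda>\<omega>. (W \<omega>, ?D \<omega>)) -` (A \<times> C) \<inter> space M = (W -` A \<inter> space M) \<inter> (?D -` C \<inter> space M)" by auto
    ultimately show "emeasure (distr M N W) A * emeasure (distr M borel ?D) C
        = emeasure (distr M (N \<Otimes>\<^sub>M borel) (\<lambda>\<omega>. (W \<omega>, ?D \<omega>))) (A \<times> C)"
      by (simp add: emeasure_distr emeasure_eq_measure ennreal_mult)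
  qed (auto intro: W.sigma_finite_measure_axioms D.sigma_finite_measure_axioms cong: sets_pair_measure_cong)
  then have "(\<integral>\<^sup>+\<omega>. f (W \<omega>, ?D \<omega>) \<partial>M) = (\<integral>\<^sup>+z. f z \<partial>(distr M N W \<Otimes>\<^sub>M distr M borel ?D))"
    by (simp add: nn_integral_distr)
  also have "\<dots> = (\<integral>\<^sup>+w. \<integral>\<^sup>+x. f (w, x) \<partial>distr M borel ?D \<partial>distr M N W)"
    by (rule D.nn_integral_fst[symmetric]) measurable
  also have "\<dots> = (\<integral>\<^sup>+\<omega>. \<integral>\<^sup>+x. f (W \<omega>, x) \<partial>distr M borel ?D \<partial>M)"
    by (rule nn_integral_distr) measurable
  also have "\<dots> = (\<integral>\<^sup>+\<omega>. (\<integral>\<^sup>+x. f (W \<omega>, sqrt (t - s) * x) \<partial>std_gauss) \<partial>M)"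
  proof (intro nn_integral_cong)
    fix \<omega> assume "\<omega> \<in> space M"
    then have "W \<omega> \<in> space N" using measurable_space[OF WM] by simp
    then have [measurable]: "(\<lambda>x. f (W \<omega>, x)) \<in> borel_measurable borel" by measurable
    show "(\<integral>\<^sup>+x. f (W \<omega>, x) \<partial>distr M borel ?D) = (\<integral>\<^sup>+x. f (W \<omega>, sqrt (t - s) * x) \<partial>std_gauss)"
      unfolding distr_increment[OF st] by (rule nn_integral_normal_density_std_gauss) (use st in auto)
  qed
  finally show ?thesis .
qed

text \<open>Stated in extended reals, it also covers \<zeta> without a second moment.\<close>

lemma increment_second_moment:
  assumes st: "0 \<le> s" "s < t" "t \<le> 1" and \<zeta>: "\<zeta> \<in> borel_measurable (F s)"
  shows "(\<integral>\<^sup>+\<omega>. ennreal ((\<zeta> \<omega> * (B t \<omega> - B s \<omega>))\<^sup>2) \<partial>M) = (\<integral>\<^sup>+\<omega>. ennreal ((\<zeta> \<omega>)\<^sup>2 * (t - s)) \<partial>M)"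
proof -
  have "(\<integral>\<^sup>+\<omega>. ennreal ((\<zeta> \<omega> * (B t \<omega> - B s \<omega>))\<^sup>2) \<partial>M)
     = (\<integral>\<^sup>+\<omega>. \<integral>\<^sup>+x. ennreal ((\<zeta> \<omega> * (sqrt (t - s) * x))\<^sup>2) \<partial>std_gauss \<partial>M)"
    using nn_integral_increment[OF st \<zeta>, of "\<lambda>(w, x). ennreal ((w * x)\<^sup>2)"] by simp
  also have "\<dots> = (\<integral>\<^sup>+\<omega>. ennreal ((\<zeta> \<omega>)\<^sup>2 * (t - s)) \<partial>M)"
  proof (intro nn_integral_cong)
    fix \<omega>
    have "(\<integral>\<^sup>+x. ennreal ((\<zeta> \<omega> * (sqrt (t - s) * x))\<^sup>2) \<partial>std_gauss)
      = (\<integral>\<^sup>+x. ennreal ((\<zeta> \<omega>)\<^sup>2 * (t - s)) * ennreal (x\<^sup>2) \<partial>std_gauss)"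
      using st by (intro nn_integral_cong) (simp add: power_mult_distrib ennreal_mult[symmetric] mult.assoc)
    also have "\<dots> = ennreal ((\<zeta> \<omega>)\<^sup>2 * (t - s))"
      by (simp add: nn_integral_cmult std_gauss_second_moment)
    finally show "(\<integral>\<^sup>+x. ennreal ((\<zeta> \<omega> * (sqrt (t - s) * x))\<^sup>2) \<partial>std_gauss) = ennreal ((\<zeta> \<omega>)\<^sup>2 * (t - s))" .
  qed
  finally show ?thesis .
qed

lemma increment_mean_zero:
  assumes st: "0 \<le> s" "s < t" "t \<le> 1" and \<zeta>: "\<zeta> \<in> borel_measurable (F s)" and int: "integrable M \<zeta>"
  shows "integrable M (\<lambda>\<omega>. \<zeta> \<omega> * (B t \<omega> - B s \<omega>))" "(\<integral>\<omega>. \<zeta> \<omega> * (B t \<omega> - B s \<omega>) \<partial>M) = 0"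
proof -
  have D: "distributed M lborel (\<lambda>\<omega>. B t \<omega> - B s \<omega>) (normal_density 0 (sqrt (t - s)))"
    using bm st by (auto simp: brownian_motion_def)
  have i: "integrable M (\<lambda>\<omega>. B t \<omega> - B s \<omega>)"
    using distributed_integrable[OF D, of "\<lambda>x. x"] integrable_normal_moment_nz_1[of "sqrt (t - s)" 0] st by simp
  have e: "expectation (\<lambda>\<omega>. B t \<omega> - B s \<omega>) = 0"
    using normal_distributed_expectation[OF _ D] st by simp
  note ind = increment_indep[OF st \<zeta>]
  show "integrable M (\<lambda>\<omega>. \<zeta> \<omega> * (B t \<omega> - B s \<omega>))" by (rule indep_var_integrable[OF ind int i])
  show "(\<integral>\<omega>. \<zeta> \<omega> * (B t \<omega> - B s \<omega>) \<partial>M) = 0"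
    using indep_var_lebesgue_integral[OF ind int i] e by simp
qed

text \<open>The shift \<open>V\<close> is meant for second differences, in which a past increment is
  subtracted from a new one; the kernel estimate is uniform in it.\<close>

lemma small_increment_bound:
  assumes st: "0 \<le> s" "s < t" "t \<le> 1" and \<eta>: "\<eta> > 0"
    and Z: "Z \<in> borel_measurable (F s)" and V: "V \<in> borel_measurable (F s)"
  shows "(\<integral>\<^sup>+\<omega>. ennreal (Z \<omega>) * ennreal (2 * \<eta>\<^sup>2 / (\<eta>\<^sup>2 + (B t \<omega> - B s \<omega> - V \<omega>)\<^sup>2)) \<partial>M)
     \<le> ennreal (7 * \<eta> / sqrt (t - s)) * (\<integral>\<^sup>+\<omega>. ennreal (Z \<omega>) \<partial>M)"
proof -
  have [measurable]: "Z \<in> borel_measurable M" using st by (intro measurable_F[OF Z]) auto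
  have W: "(\<lambda>\<omega>. (Z \<omega>, V \<omega>)) \<in> measurable (F s) (borel \<Otimes>\<^sub>M borel)"
    using Z V by measurable
  have "(\<integral>\<^sup>+\<omega>. ennreal (Z \<omega>) * ennreal (2 * \<eta>\<^sup>2 / (\<eta>\<^sup>2 + (B t \<omega> - B s \<omega> - V \<omega>)\<^sup>2)) \<partial>M)
     = (\<integral>\<^sup>+\<omega>. \<integral>\<^sup>+x. ennreal (Z \<omega>) * ennreal (2 * \<eta>\<^sup>2 / (\<eta>\<^sup>2 + (sqrt (t - s) * x - V \<omega>)\<^sup>2)) \<partial>std_gauss \<partial>M)"
  proof -
    have "(\<lambda>q. ennreal (fst (fst q)) * ennreal (2 * \<eta>\<^sup>2 / (\<eta>\<^sup>2 + (snd q - snd (fst q))\<^sup>2)))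
        \<in> borel_measurable ((borel \<Otimes>\<^sub>M borel) \<Otimes>\<^sub>M borel)" by measurable
    from nn_integral_increment[OF st W this] show ?thesis by simp
  qed
  also have "\<dots> \<le> (\<integral>\<^sup>+\<omega>. ennreal (7 * \<eta> / sqrt (t - s)) * ennreal (Z \<omega>) \<partial>M)"
  proof (intro nn_integral_mono)
    fix \<omega>
    have "(\<integral>\<^sup>+x. ennreal (Z \<omega>) * ennreal (2 * \<eta>\<^sup>2 / (\<eta>\<^sup>2 + (sqrt (t - s) * x - V \<omega>)\<^sup>2)) \<partial>std_gauss)
      = ennreal (Z \<omega>) * (\<integral>\<^sup>+x. ennreal (2 * \<eta>\<^sup>2 / (\<eta>\<^sup>2 + (sqrt (t - s) * x - V \<omega>)\<^sup>2)) \<partial>std_gauss)"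
      by (rule nn_integral_cmult) measurable
    also have "\<dots> \<le> ennreal (Z \<omega>) * ennreal (7 * \<eta> / sqrt (t - s))"
      by (intro mult_left_mono std_gauss_cauchy_kernel_le \<eta>) (use st in auto)
    finally show "(\<integral>\<^sup>+x. ennreal (Z \<omega>) * ennreal (2 * \<eta>\<^sup>2 / (\<eta>\<^sup>2 + (sqrt (t - s) * x - V \<omega>)\<^sup>2)) \<partial>std_gauss)
       \<le> ennreal (7 * \<eta> / sqrt (t - s)) * ennreal (Z \<omega>)" by (simp add: mult.commute)
  qed
  also have "\<dots> = ennreal (7 * \<eta> / sqrt (t - s)) * (\<integral>\<^sup>+\<omega>. ennreal (Z \<omega>) \<partial>M)"
    by (rule nn_integral_cmult) measurable
  finally show ?thesis .
qed

text \<open>Removing the increments from the last one backwards leaves two independent Gaussians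
  with the common scale sqrt h, which homogeneity cancels.\<close>

lemma abs_ratio_increments_mean:
  assumes tu: "0 \<le> t" "0 < h" "t + 2 * h \<le> 1" and Z: "Z \<in> borel_measurable (F t)"
  shows "(\<integral>\<^sup>+\<omega>. ennreal (Z \<omega>) * ennreal (abs_ratio (B (t + h) \<omega> - B t \<omega>) (B (t + 2 * h) \<omega> - B (t + h) \<omega>)) \<partial>M)
    = ennreal (IR_lambda 0) * (\<integral>\<^sup>+\<omega>. ennreal (Z \<omega>) \<partial>M)"
proof -
  interpret G: prob_space std_gauss by (rule prob_space_std_gauss)
  let ?D = "\<lambda>\<omega>. B (t + h) \<omega> - B t \<omega>"
  have s: "sqrt h \<noteq> 0" using tu by simp
  have [measurable]: "Z \<in> borel_measurable M" using tu by (intro measurable_F[OF Z]) auto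
  have "Z \<in> borel_measurable (F (t + h))" "B t \<in> borel_measurable (F (t + h))" "B (t + h) \<in> borel_measurable (F (t + h))"
    using tu by (auto intro: B_measurable_F) (auto intro: measurable_F_mono[OF Z])
  then have W: "(\<lambda>\<omega>. (Z \<omega>, ?D \<omega>)) \<in> measurable (F (t + h)) (borel \<Otimes>\<^sub>M borel)" by measurable
  have "(\<integral>\<^sup>+\<omega>. ennreal (Z \<omega>) * ennreal (abs_ratio (?D \<omega>) (B (t + 2 * h) \<omega> - B (t + h) \<omega>)) \<partial>M)
    = (\<integral>\<^sup>+\<omega>. \<integral>\<^sup>+y. ennreal (Z \<omega>) * ennreal (abs_ratio (?D \<omega>) (sqrt h * y)) \<partial>std_gauss \<partial>M)"
  proof -
    have "(\<lambda>q. ennreal (fst (fst q)) * ennreal (abs_ratio (snd (fst q)) (snd q)))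
        \<in> borel_measurable ((borel \<Otimes>\<^sub>M borel) \<Otimes>\<^sub>M borel)" by measurable
    from nn_integral_increment[OF _ _ _ W this, of "t + 2 * h"] tu show ?thesis by simp
  qed
  also have "\<dots> = (\<integral>\<^sup>+\<omega>. \<integral>\<^sup>+x. \<integral>\<^sup>+y. ennreal (Z \<omega>) * ennreal (abs_ratio (sqrt h * x) (sqrt h * y)) \<partial>std_gauss \<partial>std_gauss \<partial>M)"
  proof -
    have "(\<lambda>q. \<integral>\<^sup>+y. ennreal (fst q) * ennreal (abs_ratio (snd q) (sqrt h * y)) \<partial>std_gauss)
        \<in> borel_measurable (borel \<Otimes>\<^sub>M borel)" by measurable
    from nn_integral_increment[OF _ _ _ Z this, of "t + h"] tu show ?thesis by simp
  qed
  also have "\<dots> = (\<integral>\<^sup>+\<omega>. ennreal (IR_lambda 0) * ennreal (Z \<omega>) \<partial>M)"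
    unfolding abs_ratio_scale[OF s]
    by (simp add: nn_integral_cmult std_gauss_abs_ratio_indep nn_integral_multc mult.commute)
  also have "\<dots> = ennreal (IR_lambda 0) * (\<integral>\<^sup>+\<omega>. ennreal (Z \<omega>) \<partial>M)"
    by (rule nn_integral_cmult) measurable
  finally show ?thesis .
qed

text \<open>The same elimination with three increments, which become the x, y, z of
  \<open>std_gauss_abs_ratio_second_diff\<close>.\<close>

lemma abs_ratio_second_increments_mean:
  assumes tu: "0 \<le> t" "0 < h" "t + 3 * h \<le> 1" and Z: "Z \<in> borel_measurable (F t)"
  shows "(\<integral>\<^sup>+\<omega>. ennreal (Z \<omega>) * ennreal (abs_ratio
        ((B (t + 2 * h) \<omega> - B (t + h) \<omega>) - (B (t + h) \<omega> - B t \<omega>))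
        ((B (t + 3 * h) \<omega> - B (t + 2 * h) \<omega>) - (B (t + 2 * h) \<omega> - B (t + h) \<omega>))) \<partial>M)
    = ennreal (IR_lambda (- 1/2)) * (\<integral>\<^sup>+\<omega>. ennreal (Z \<omega>) \<partial>M)"
proof -
  interpret G: prob_space std_gauss by (rule prob_space_std_gauss)
  let ?D = "\<lambda>\<omega>. B (t + h) \<omega> - B t \<omega>" and ?E = "\<lambda>\<omega>. B (t + 2 * h) \<omega> - B (t + h) \<omega>"
  have s: "sqrt h \<noteq> 0" using tu by simp
  have [measurable]: "Z \<in> borel_measurable M" using tu by (intro measurable_F[OF Z]) auto
  have "Z \<in> borel_measurable (F (t + h))" "B t \<in> borel_measurable (F (t + h))" "B (t + h) \<in> borel_measurable (F (t + h))"
    using tu by (auto intro: B_measurable_F) (auto intro: measurable_F_mono[OF Z])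
  then have W1: "(\<lambda>\<omega>. (Z \<omega>, ?D \<omega>)) \<in> measurable (F (t + h)) (borel \<Otimes>\<^sub>M borel)" by measurable
  have "Z \<in> borel_measurable (F (t + 2 * h))" "B t \<in> borel_measurable (F (t + 2 * h))"
     "B (t + h) \<in> borel_measurable (F (t + 2 * h))" "B (t + 2 * h) \<in> borel_measurable (F (t + 2 * h))"
    using tu by (auto intro: B_measurable_F) (auto intro: measurable_F_mono[OF Z])
  then have W2: "(\<lambda>\<omega>. (Z \<omega>, ?D \<omega>, ?E \<omega>)) \<in> measurable (F (t + 2 * h)) (borel \<Otimes>\<^sub>M borel \<Otimes>\<^sub>M borel)" by measurable
  have "(\<integral>\<^sup>+\<omega>. ennreal (Z \<omega>) * ennreal (abs_ratio (?E \<omega> - ?D \<omega>) ((B (t + 3 * h) \<omega> - B (t + 2 * h) \<omega>) - ?E \<omega>)) \<partial>M)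
    = (\<integral>\<^sup>+\<omega>. \<integral>\<^sup>+z. ennreal (Z \<omega>) * ennreal (abs_ratio (?E \<omega> - ?D \<omega>) (sqrt h * z - ?E \<omega>)) \<partial>std_gauss \<partial>M)"
  proof -
    have "(\<lambda>q. ennreal (fst (fst q)) * ennreal (abs_ratio (snd (snd (fst q)) - fst (snd (fst q))) (snd q - snd (snd (fst q)))))
        \<in> borel_measurable ((borel \<Otimes>\<^sub>M borel \<Otimes>\<^sub>M borel) \<Otimes>\<^sub>M borel)" by measurable
    from nn_integral_increment[OF _ _ _ W2 this, of "t + 3 * h"] tu show ?thesis by simp
  qed
  also have "\<dots> = (\<integral>\<^sup>+\<omega>. \<integral>\<^sup>+y. \<integral>\<^sup>+z. ennreal (Z \<omega>) * ennreal (abs_ratio (sqrt h * y - ?D \<omega>) (sqrt h * z - sqrt h * y)) \<partial>std_gauss \<partial>std_gauss \<partial>M)"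
  proof -
    have "(\<lambda>q. \<integral>\<^sup>+x. ennreal (fst (fst q)) * ennreal (abs_ratio (snd q - snd (fst q)) (sqrt h * x - snd q)) \<partial>std_gauss)
        \<in> borel_measurable ((borel \<Otimes>\<^sub>M borel) \<Otimes>\<^sub>M borel)" by measurable
    from nn_integral_increment[OF _ _ _ W1 this, of "t + 2 * h"] tu show ?thesis by simp
  qed
  also have "\<dots> = (\<integral>\<^sup>+\<omega>. \<integral>\<^sup>+x. \<integral>\<^sup>+y. \<integral>\<^sup>+z. ennreal (Z \<omega>) * ennreal (abs_ratio (sqrt h * y - sqrt h * x) (sqrt h * z - sqrt h * y)) \<partial>std_gauss \<partial>std_gauss \<partial>std_gauss \<partial>M)"
  proof -
    have "(\<lambda>q. \<integral>\<^sup>+e. \<integral>\<^sup>+x. ennreal (fst q) * ennreal (abs_ratio (sqrt h * e - snd q) (sqrt h * x - sqrt h * e)) \<partial>std_gauss \<partial>std_gauss)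
        \<in> borel_measurable (borel \<Otimes>\<^sub>M borel)" by measurable
    from nn_integral_increment[OF _ _ _ Z this, of "t + h"] tu show ?thesis by simp
  qed
  also have "\<dots> = (\<integral>\<^sup>+\<omega>. ennreal (IR_lambda (- 1/2)) * ennreal (Z \<omega>) \<partial>M)"
    unfolding right_diff_distrib[symmetric] abs_ratio_scale[OF s]
    by (simp add: nn_integral_cmult std_gauss_abs_ratio_second_diff nn_integral_multc mult.commute del: divide_minus_left)
  also have "\<dots> = ennreal (IR_lambda (- 1/2)) * (\<integral>\<^sup>+\<omega>. ennreal (Z \<omega>) \<partial>M)"
    by (rule nn_integral_cmult) measurable
  finally show ?thesis .
qed

end

section \<open>The stochastic integral over a short interval\<close>

context filtered_brownian
begin

text \<open>Adding one interval to \<open>S k\<close> creates a new square and a cross term, which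
  has mean zero because \<open>S k\<close> and \<open>\<zeta> k\<close> are known at time
  \<open>\<sigma> k\<close>. Clipped partitions contain degenerate intervals; they are treated
  apart, since a Brownian increment has a density only for distinct times. The bound
  \<open>C i\<close> may vary with i because truncation yields bounds that grow as the intervals
  shrink.\<close>

lemma isometry_partition:
  fixes \<zeta> :: "nat \<Rightarrow> 'a \<Rightarrow> real" and \<sigma> C :: "nat \<Rightarrow> real"
  assumes \<sigma>0: "0 \<le> \<sigma> 0" and \<sigma>m: "\<And>i. i < m \<Longrightarrow> \<sigma> i \<le> \<sigma> (Suc i)" and \<sigma>1: "\<And>i. i \<le> m \<Longrightarrow> \<sigma> i \<le> 1"
    and \<zeta>: "\<And>i. i < m \<Longrightarrow> \<zeta> i \<in> borel_measurable (F (\<sigma> i))" and C: "\<And>i \<omega>. i < m \<Longrightarrow> \<bar>\<zeta> i \<omega>\<bar> \<le> C i"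
  defines "S \<equiv> \<lambda>k \<omega>. \<Sum>i<k. \<zeta> i \<omega> * (B (\<sigma> (Suc i)) \<omega> - B (\<sigma> i) \<omega>)"
  shows "integrable M (\<lambda>\<omega>. (S m \<omega>)\<^sup>2)"
    "(\<integral>\<omega>. (S m \<omega>)\<^sup>2 \<partial>M) = (\<integral>\<omega>. (\<Sum>i<m. (\<zeta> i \<omega>)\<^sup>2 * (\<sigma> (Suc i) - \<sigma> i)) \<partial>M)"
proof -
  have \<sigma>pos: "0 \<le> \<sigma> k" if "k \<le> m" for k
    using that by (induction k) (use \<sigma>0 \<sigma>m in \<open>auto intro: order_trans simp: Suc_le_eq\<close>)
  have \<zeta>M: "\<zeta> i \<in> borel_measurable M" if "i < m" for i
    using measurable_F[OF \<zeta>[OF that]] \<sigma>pos \<sigma>1 that by auto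
  have i\<zeta>: "integrable M (\<lambda>\<omega>. (\<zeta> i \<omega>)\<^sup>2 * d)" if "i < m" for i d
    using \<zeta>M[OF that] C[OF that] by (intro integrable_mult_left integrable_bdd[of _ "(C i)\<^sup>2"])
      (auto simp: abs_le_square_iff[symmetric] intro: order_trans[OF _ abs_ge_self])
  have main: "S k \<in> borel_measurable (F (\<sigma> k)) \<and> integrable M (\<lambda>\<omega>. (S k \<omega>)\<^sup>2) \<and>
     (\<integral>\<omega>. (S k \<omega>)\<^sup>2 \<partial>M) = (\<integral>\<omega>. (\<Sum>i<k. (\<zeta> i \<omega>)\<^sup>2 * (\<sigma> (Suc i) - \<sigma> i)) \<partial>M)" if "k \<le> m" for k
    using that
  proof (induction k)
    case 0
    then show ?case by (simp add: S_def)
  next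
    case (Suc k)
    have k: "k < m" "k \<le> m" using Suc.prems by auto
    note IH = Suc.IH[OF k(2)]
    let ?D = "\<lambda>\<omega>. B (\<sigma> (Suc k)) \<omega> - B (\<sigma> k) \<omega>"
    have bnds: "0 \<le> \<sigma> k" "\<sigma> k \<le> \<sigma> (Suc k)" "\<sigma> (Suc k) \<le> 1" "\<sigma> k \<le> 1" "0 \<le> \<sigma> (Suc k)"
      using \<sigma>pos \<sigma>m \<sigma>1 k Suc.prems by auto
    have "S k \<in> borel_measurable (F (\<sigma> (Suc k)))" "\<zeta> k \<in> borel_measurable (F (\<sigma> (Suc k)))"
      "B (\<sigma> (Suc k)) \<in> borel_measurable (F (\<sigma> (Suc k)))" "B (\<sigma> k) \<in> borel_measurable (F (\<sigma> (Suc k)))"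
      using IH \<zeta>[OF k(1)] bnds by (auto intro: measurable_F_mono[of _ "\<sigma> k"] B_measurable_F)
    then have mS: "S (Suc k) \<in> borel_measurable (F (\<sigma> (Suc k)))"
      unfolding S_def by simp
    have SM[measurable]: "S k \<in> borel_measurable M" using IH bnds by (auto intro: measurable_F)
    have ZM[measurable]: "\<zeta> k \<in> borel_measurable M" using \<zeta>M k by auto
    have BM[measurable]: "B (\<sigma> (Suc k)) \<in> borel_measurable M" "B (\<sigma> k) \<in> borel_measurable M"
      using bnds by (auto intro: B_measurable)
    have iS: "integrable M (\<lambda>\<omega>. (S k \<omega>)\<^sup>2)" using IH by simp
    have iSZ: "integrable M (\<lambda>\<omega>. S k \<omega> * \<zeta> k \<omega>)"
    proof (rule Bochner_Integration.integrable_bound)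
      show "integrable M (\<lambda>\<omega>. (S k \<omega>)\<^sup>2 + (C k)\<^sup>2)" using iS by auto
      show "AE \<omega> in M. norm (S k \<omega> * \<zeta> k \<omega>) \<le> norm ((S k \<omega>)\<^sup>2 + (C k)\<^sup>2)"
      proof (rule AE_I2)
        fix \<omega>
        have "2 * \<bar>S k \<omega>\<bar> * \<bar>\<zeta> k \<omega>\<bar> \<le> \<bar>S k \<omega>\<bar>\<^sup>2 + \<bar>\<zeta> k \<omega>\<bar>\<^sup>2" by (rule sum_squares_bound)
        moreover have "\<bar>\<zeta> k \<omega>\<bar>\<^sup>2 \<le> (C k)\<^sup>2" using C[OF k(1)] by (intro power_mono) auto
        moreover have "0 \<le> \<bar>S k \<omega>\<bar> * \<bar>\<zeta> k \<omega>\<bar>" by simp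
        ultimately have "\<bar>S k \<omega>\<bar> * \<bar>\<zeta> k \<omega>\<bar> \<le> (S k \<omega>)\<^sup>2 + (C k)\<^sup>2"
          unfolding power2_abs by linarith
        then show "norm (S k \<omega> * \<zeta> k \<omega>) \<le> norm ((S k \<omega>)\<^sup>2 + (C k)\<^sup>2)" by (simp add: abs_mult)
      qed
    qed measurable
    have cross: "integrable M (\<lambda>\<omega>. S k \<omega> * \<zeta> k \<omega> * ?D \<omega>) \<and> (\<integral>\<omega>. S k \<omega> * \<zeta> k \<omega> * ?D \<omega> \<partial>M) = 0"
    proof (cases "\<sigma> k = \<sigma> (Suc k)")
      case False
      have "(\<lambda>\<omega>. S k \<omega> * \<zeta> k \<omega>) \<in> borel_measurable (F (\<sigma> k))" using conjunct1[OF IH] \<zeta>[OF k(1)] by (rule borel_measurable_times)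
      then show ?thesis using increment_mean_zero[of "\<sigma> k" "\<sigma> (Suc k)"] False bnds iSZ by auto
    qed simp
    have sq: "integrable M (\<lambda>\<omega>. (\<zeta> k \<omega> * ?D \<omega>)\<^sup>2) \<and>
      (\<integral>\<omega>. (\<zeta> k \<omega> * ?D \<omega>)\<^sup>2 \<partial>M) = (\<integral>\<omega>. (\<zeta> k \<omega>)\<^sup>2 * (\<sigma> (Suc k) - \<sigma> k) \<partial>M)"
    proof (cases "\<sigma> k = \<sigma> (Suc k)")
      case False
      have "(\<integral>\<^sup>+\<omega>. ennreal ((\<zeta> k \<omega> * ?D \<omega>)\<^sup>2) \<partial>M) = (\<integral>\<^sup>+\<omega>. ennreal ((\<zeta> k \<omega>)\<^sup>2 * (\<sigma> (Suc k) - \<sigma> k)) \<partial>M)"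
        using increment_second_moment[of "\<sigma> k" "\<sigma> (Suc k)"] False bnds \<zeta>[OF k(1)] by auto
      also have "\<dots> = ennreal (\<integral>\<omega>. (\<zeta> k \<omega>)\<^sup>2 * (\<sigma> (Suc k) - \<sigma> k) \<partial>M)"
        using bnds by (intro nn_integral_eq_integral i\<zeta> k AE_I2 mult_nonneg_nonneg) auto
      finally show ?thesis
        using bnds by (subst (asm) nn_integral_eq_integrable) (auto intro!: integral_nonneg_AE AE_I2 mult_nonneg_nonneg)
    qed simp
    have exp: "(S (Suc k) \<omega>)\<^sup>2 = (S k \<omega>)\<^sup>2 + 2 * (S k \<omega> * \<zeta> k \<omega> * ?D \<omega>) + (\<zeta> k \<omega> * ?D \<omega>)\<^sup>2" for \<omega>
      by (simp add: S_def power2_sum)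
    have int: "integrable M (\<lambda>\<omega>. (S (Suc k) \<omega>)\<^sup>2)"
      unfolding exp using iS cross sq by auto
    have "(\<integral>\<omega>. (S (Suc k) \<omega>)\<^sup>2 \<partial>M) = (\<integral>\<omega>. (S k \<omega>)\<^sup>2 \<partial>M) + 2 * (\<integral>\<omega>. S k \<omega> * \<zeta> k \<omega> * ?D \<omega> \<partial>M) + (\<integral>\<omega>. (\<zeta> k \<omega> * ?D \<omega>)\<^sup>2 \<partial>M)"
      unfolding exp using iS cross sq by (simp add: Bochner_Integration.integral_add)
    also have "\<dots> = (\<integral>\<omega>. (\<Sum>i<k. (\<zeta> i \<omega>)\<^sup>2 * (\<sigma> (Suc i) - \<sigma> i)) \<partial>M) + (\<integral>\<omega>. (\<zeta> k \<omega>)\<^sup>2 * (\<sigma> (Suc k) - \<sigma> k) \<partial>M)"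
      using IH cross sq by simp
    also have "\<dots> = (\<integral>\<omega>. (\<Sum>i<Suc k. (\<zeta> i \<omega>)\<^sup>2 * (\<sigma> (Suc i) - \<sigma> i)) \<partial>M)"
      unfolding sum.lessThan_Suc
      by (intro Bochner_Integration.integral_add[symmetric] Bochner_Integration.integrable_sum i\<zeta>) (use k in auto)
    finally show ?case using mS int by blast
  qed
  show "integrable M (\<lambda>\<omega>. (S m \<omega>)\<^sup>2)"
    "(\<integral>\<omega>. (S m \<omega>)\<^sup>2 \<partial>M) = (\<integral>\<omega>. (\<Sum>i<m. (\<zeta> i \<omega>)\<^sup>2 * (\<sigma> (Suc i) - \<sigma> i)) \<partial>M)"
    using main[of m] by auto
qed

text \<open>The integrand is switched off once its quadratic variation \<open>Q\<close> would exceed \<open>N\<close>; this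
  is predictable because \<open>Q\<close> up to \<open>\<sigma> (Suc i)\<close> is already known at time \<open>\<sigma> i\<close>.\<close>

lemma truncated_isometry:
  fixes \<zeta> :: "nat \<Rightarrow> 'a \<Rightarrow> real" and \<sigma> :: "nat \<Rightarrow> real"
  assumes \<sigma>0: "0 \<le> \<sigma> 0" and \<sigma>m: "\<And>i. i < m \<Longrightarrow> \<sigma> i \<le> \<sigma> (Suc i)" and \<sigma>1: "\<And>i. i \<le> m \<Longrightarrow> \<sigma> i \<le> 1"
    and \<zeta>: "\<And>i. i < m \<Longrightarrow> \<sigma> i < \<sigma> (Suc i) \<Longrightarrow> \<zeta> i \<in> borel_measurable (F (\<sigma> i))" and N: "N > 0"
  shows "(\<integral>\<^sup>+\<omega>. ennreal (min N ((\<Sum>i<m. \<zeta> i \<omega> * (B (\<sigma> (Suc i)) \<omega> - B (\<sigma> i) \<omega>))\<^sup>2)) \<partial>M)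
    \<le> 2 * (\<integral>\<^sup>+\<omega>. ennreal (min N (\<Sum>i<m. (\<zeta> i \<omega>)\<^sup>2 * (\<sigma> (Suc i) - \<sigma> i))) \<partial>M)"
proof -
  \<comment> \<open>On degenerate intervals no measurability of \<open>\<zeta> i\<close> is given,
    so the coefficient is set to 0 there; the sums do not change.\<close>
  define z where "z = (\<lambda>i \<omega>. if \<sigma> i < \<sigma> (Suc i) then \<zeta> i \<omega> else 0)"
  define Q where "Q = (\<lambda>k \<omega>. \<Sum>i<k. (z i \<omega>)\<^sup>2 * (\<sigma> (Suc i) - \<sigma> i))"
  define y where "y = (\<lambda>i \<omega>. if Q (Suc i) \<omega> \<le> N then z i \<omega> else 0)"
  have \<sigma>pos: "0 \<le> \<sigma> k" if "k \<le> m" for k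
    using that by (induction k) (use \<sigma>0 \<sigma>m in \<open>auto intro: order_trans simp: Suc_le_eq\<close>)
  have \<sigma>mono: "\<sigma> i \<le> \<sigma> k" if "i \<le> k" "k \<le> m" for i k
    using that by (induction rule: dec_induct) (use \<sigma>m in \<open>auto intro: order_trans simp: Suc_le_eq\<close>)
  have zF: "z i \<in> borel_measurable (F (\<sigma> k))" if "i \<le> k" "k < m" for i k
  proof (cases "\<sigma> i < \<sigma> (Suc i)")
    case True
    then have "z i \<in> borel_measurable (F (\<sigma> i))" using \<zeta>[of i] that by (simp add: z_def)
    then show ?thesis by (rule measurable_F_mono) (use that in \<open>auto intro: \<sigma>pos \<sigma>mono \<sigma>1\<close>)
  qed (simp add: z_def)
  have QF: "Q (Suc k) \<in> borel_measurable (F (\<sigma> k))" if "k < m" for k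
    unfolding Q_def using that by (intro borel_measurable_sum borel_measurable_times borel_measurable_power zF borel_measurable_const) auto
  have yF: "y k \<in> borel_measurable (F (\<sigma> k))" if "k < m" for k
    unfolding y_def using QF[OF that] zF[OF order_refl that] by measurable
  have term0: "0 \<le> (z i \<omega>)\<^sup>2 * (\<sigma> (Suc i) - \<sigma> i)" if "i < m" for i \<omega> using \<sigma>m[OF that] by simp
  have Qmono: "Q i \<omega> \<le> Q k \<omega>" if "i \<le> k" "k \<le> m" for i k \<omega>
    unfolding Q_def using that term0 by (intro sum_mono2) auto
  \<comment> \<open>While the switch is on, the last term of \<open>Q (Suc i)\<close> is at most N,
    which bounds the coefficient.\<close>
  have yb: "\<bar>y i \<omega>\<bar> \<le> sqrt (N / (\<sigma> (Suc i) - \<sigma> i))" if i: "i < m" for i \<omega>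
  proof (cases "\<sigma> i < \<sigma> (Suc i) \<and> Q (Suc i) \<omega> \<le> N")
    case True
    have "0 \<le> Q i \<omega>" unfolding Q_def using i term0 by (intro sum_nonneg) auto
    then have "(z i \<omega>)\<^sup>2 * (\<sigma> (Suc i) - \<sigma> i) \<le> N" using True by (simp add: Q_def)
    then have "(z i \<omega>)\<^sup>2 \<le> N / (\<sigma> (Suc i) - \<sigma> i)" using True by (simp add: pos_le_divide_eq)
    then show ?thesis using True by (auto simp: y_def intro: real_le_rsqrt)
  qed (use N \<sigma>m[OF i] in \<open>auto simp: y_def z_def\<close>)
  let ?S = "\<lambda>\<omega>. \<Sum>i<m. \<zeta> i \<omega> * (B (\<sigma> (Suc i)) \<omega> - B (\<sigma> i) \<omega>)"
  let ?Q = "\<lambda>\<omega>. \<Sum>i<m. (\<zeta> i \<omega>)\<^sup>2 * (\<sigma> (Suc i) - \<sigma> i)"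
  let ?T = "\<lambda>\<omega>. \<Sum>i<m. y i \<omega> * (B (\<sigma> (Suc i)) \<omega> - B (\<sigma> i) \<omega>)"
  let ?R = "\<lambda>\<omega>. \<Sum>i<m. (y i \<omega>)\<^sup>2 * (\<sigma> (Suc i) - \<sigma> i)"
  have Sz: "?S \<omega> = (\<Sum>i<m. z i \<omega> * (B (\<sigma> (Suc i)) \<omega> - B (\<sigma> i) \<omega>))" for \<omega>
    using \<sigma>m by (intro sum.cong) (auto simp: z_def dest: antisym simp: not_less)
  have Qz: "?Q \<omega> = Q m \<omega>" for \<omega>
    unfolding Q_def using \<sigma>m by (intro sum.cong) (auto simp: z_def dest: antisym simp: not_less)
  have R0: "0 \<le> ?R \<omega>" for \<omega> using \<sigma>m by (intro sum_nonneg) auto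
  have R: "(\<Sum>i<k. (y i \<omega>)\<^sup>2 * (\<sigma> (Suc i) - \<sigma> i)) \<le> min N (Q k \<omega>)" if "k \<le> m" for k \<omega>
    using that
  proof (induction k)
    case 0
    then show ?case using N by (simp add: Q_def)
  next
    case (Suc k)
    show ?case
    proof (cases "Q (Suc k) \<omega> \<le> N")
      case True
      then show ?thesis using Suc by (simp add: y_def) (simp add: Q_def)
    next
      case False
      then show ?thesis using Suc Qmono[of k "Suc k" \<omega>] by (simp add: y_def)
    qed
  qed
  \<comment> \<open>If \<open>Q m\<close> is at most N, nothing was switched off and both stochastic
    sums agree; otherwise \<open>min N (Q m)\<close> equals N and already covers the left side. Each
    of the two terms has mean at most that of \<open>min N (Q m)\<close>, whence the factor
    2.\<close>
  have ST: "min N ((?S \<omega>)\<^sup>2) \<le> (?T \<omega>)\<^sup>2 + min N (?Q \<omega>)" for \<omega>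
  proof (cases "Q m \<omega> \<le> N")
    case True
    have "y i \<omega> = z i \<omega>" if "i < m" for i
      using Qmono[of "Suc i" m \<omega>] True that by (simp add: y_def)
    then have eq: "?S \<omega> = ?T \<omega>" unfolding Sz by simp
    have "0 \<le> min N (?Q \<omega>)" using R[of m \<omega>] R0[of \<omega>] unfolding Qz by simp
    then show ?thesis unfolding eq using min.cobounded2[of N "(?T \<omega>)\<^sup>2"] by linarith
  next
    case False
    then have "min N (?Q \<omega>) = N" unfolding Qz by simp
    then show ?thesis using zero_le_power2[of "?T \<omega>"] min.cobounded1[of N "(?S \<omega>)\<^sup>2"] by linarith
  qed
  have iso: "integrable M (\<lambda>\<omega>. (?T \<omega>)\<^sup>2)" "(\<integral>\<omega>. (?T \<omega>)\<^sup>2 \<partial>M) = (\<integral>\<omega>. ?R \<omega> \<partial>M)"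
    using isometry_partition[where \<sigma> = \<sigma> and m = m and \<zeta> = y and C = "\<lambda>i. sqrt (N / (\<sigma> (Suc i) - \<sigma> i))", OF \<sigma>0 \<sigma>m \<sigma>1 yF yb]
    by blast+
  have mM[measurable]: "Q m \<in> borel_measurable M"
  proof (cases m)
    case (Suc k)
    have "Q (Suc k) \<in> borel_measurable M"
      by (rule measurable_F[OF QF]) (use Suc \<sigma>pos[of k] \<sigma>1[of k] in simp_all)
    then show ?thesis unfolding Suc .
  qed (simp add: Q_def)
  have yM: "y i \<in> borel_measurable M" if "i < m" for i
    by (rule measurable_F[OF yF[OF that]]) (use that \<sigma>pos[of i] \<sigma>1[of i] in simp_all)
  have RM[measurable]: "?R \<in> borel_measurable M" using yM by (intro borel_measurable_sum) auto
  have TM[measurable]: "?T \<in> borel_measurable M"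
    using yM \<sigma>pos \<sigma>1 by (intro borel_measurable_sum borel_measurable_times borel_measurable_diff B_measurable) auto
  have Qi: "integrable M (\<lambda>\<omega>. ?R \<omega>)"
    using R[OF order_refl] R0 by (intro integrable_bdd[OF RM, of N]) auto
  have "(\<integral>\<^sup>+\<omega>. ennreal (min N ((?S \<omega>)\<^sup>2)) \<partial>M) \<le> (\<integral>\<^sup>+\<omega>. ennreal ((?T \<omega>)\<^sup>2) + ennreal (min N (Q m \<omega>)) \<partial>M)"
  proof (intro nn_integral_mono)
    fix \<omega>
    have "0 \<le> min N (Q m \<omega>)" using R[of m \<omega>] R0[of \<omega>] by simp
    then show "ennreal (min N ((?S \<omega>)\<^sup>2)) \<le> ennreal ((?T \<omega>)\<^sup>2) + ennreal (min N (Q m \<omega>))"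
      using ST[of \<omega>] unfolding Qz by (subst ennreal_plus[symmetric]) (auto simp del: ennreal_plus intro!: ennreal_leI)
  qed
  also have "\<dots> = (\<integral>\<^sup>+\<omega>. ennreal ((?T \<omega>)\<^sup>2) \<partial>M) + (\<integral>\<^sup>+\<omega>. ennreal (min N (Q m \<omega>)) \<partial>M)"
    by (rule nn_integral_add) measurable
  also have "(\<integral>\<^sup>+\<omega>. ennreal ((?T \<omega>)\<^sup>2) \<partial>M) = (\<integral>\<^sup>+\<omega>. ennreal (?R \<omega>) \<partial>M)"
    using iso R0 Qi by (simp add: nn_integral_eq_integral)
  also have "\<dots> \<le> (\<integral>\<^sup>+\<omega>. ennreal (min N (Q m \<omega>)) \<partial>M)"
    using R[OF order_refl] by (intro nn_integral_mono ennreal_leI) auto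
  finally show ?thesis unfolding Qz by (simp add: mult_2 add_right_mono)
qed

end

text \<open>The function is small near 0 and at most \<open>L\<close> elsewhere, an event of
  vanishing probability. The truncations applied later provide this boundedness, so that convergence
  in probability is enough to pass to the limit under the integral.\<close>

lemma in_prob_nn_integral_tendsto:
  fixes g :: "real \<Rightarrow> real"
  assumes "prob_space M" and Y: "tendsto_in_prob M Y Z" and g[measurable]: "g \<in> borel_measurable borel"
    and bd: "\<And>y. 0 \<le> g y" "\<And>y. g y \<le> L" and cont: "isCont g 0" "g 0 = 0"
  shows "(\<lambda>n. \<integral>\<^sup>+\<omega>. ennreal (g (Y n \<omega> - Z \<omega>)) \<partial>M) \<longlonglongrightarrow> 0"
proof (rule order_tendstoI)
  interpret prob_space M by fact
  have [measurable]: "Y n \<in> borel_measurable M" "Z \<in> borel_measurable M" for n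
    using Y by (auto simp: tendsto_in_prob_def)
  have L: "L \<ge> 0" using bd[of 0] by linarith
  fix a :: ennreal assume a: "0 < a"
  obtain e where e: "e > 0" "ennreal (2 * e) < a"
  proof (cases a)
    case (real r)
    then show ?thesis using a that[of "r / 3"] by (auto simp: ennreal_less_iff)
  next
    case top
    then show ?thesis using that[of 1] by auto
  qed
  have "\<exists>d>0. \<forall>x. x \<noteq> 0 \<and> norm (x - 0) < d \<longrightarrow> norm (g x - 0) < e"
    using cont e by (intro LIM_D) (auto simp: isCont_def)
  then obtain d where d: "d > 0" "\<And>x. \<bar>x\<bar> < d \<Longrightarrow> g x \<le> e"
    using cont e by (metis abs_le_D1 diff_zero less_imp_le real_norm_def)
  \<comment> \<open>Exceedance is strict in \<open>tendsto_in_prob\<close>, so taking half of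
    \<open>d\<close> leaves the complement strictly inside the neighborhood.\<close>
  have "(\<lambda>n. measure M {\<omega> \<in> space M. \<bar>Y n \<omega> - Z \<omega>\<bar> > d / 2}) \<longlonglongrightarrow> 0"
    using Y half_gt_zero[OF d(1)] unfolding tendsto_in_prob_def by blast
  \<comment> \<open>The denominator \<open>L + 1\<close> stays positive when \<open>L\<close> is
    0.\<close>
  then have "eventually (\<lambda>n. measure M {\<omega> \<in> space M. \<bar>Y n \<omega> - Z \<omega>\<bar> > d / 2} < e / (L + 1)) sequentially"
    using e L by (intro order_tendstoD) auto
  then show "eventually (\<lambda>n. (\<integral>\<^sup>+\<omega>. ennreal (g (Y n \<omega> - Z \<omega>)) \<partial>M) < a) sequentially"
  proof eventually_elim
    case (elim n)
    let ?E = "{\<omega> \<in> space M. \<bar>Y n \<omega> - Z \<omega>\<bar> > d / 2}"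
    have "(\<integral>\<^sup>+\<omega>. ennreal (g (Y n \<omega> - Z \<omega>)) \<partial>M) \<le> (\<integral>\<^sup>+\<omega>. ennreal e + ennreal L * indicator ?E \<omega> \<partial>M)"
    proof (intro nn_integral_mono)
      fix \<omega> assume "\<omega> \<in> space M"
      then show "ennreal (g (Y n \<omega> - Z \<omega>)) \<le> ennreal e + ennreal L * indicator ?E \<omega>"
      proof (cases "\<omega> \<in> ?E")
        case True
        have "ennreal (g (Y n \<omega> - Z \<omega>)) \<le> ennreal L" using bd by (intro ennreal_leI) auto
        then show ?thesis using True by (simp add: add_increasing)
      next
        case False
        then have "\<bar>Y n \<omega> - Z \<omega>\<bar> < d" using \<open>\<omega> \<in> space M\<close> d by auto
        then show ?thesis using d(2) False by (simp add: ennreal_leI)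
      qed
    qed
    also have "\<dots> = ennreal e + ennreal L * emeasure M ?E"
      by (subst nn_integral_add) (auto simp: nn_integral_cmult emeasure_space_1)
    also have "\<dots> = ennreal (e + L * measure M ?E)"
      using e L by (simp add: emeasure_eq_measure ennreal_mult)
    also have "\<dots> \<le> ennreal (2 * e)"
    proof (intro ennreal_leI)
      have "L * measure M ?E \<le> L * (e / (L + 1))" using elim L by (intro mult_left_mono) auto
      also have "\<dots> \<le> e" using L e by (simp add: field_simps)
      finally show "e + L * measure M ?E \<le> 2 * e" by simp
    qed
    finally show ?case using e by simp
  qed
qed auto

text \<open>Processes are constrained on [0,1] only. Composing the time variable with this
  retraction extends them to jointly measurable functions on the whole line, to which Tonelli's
  theorem for \<open>lborel\<close> applies.\<close>

definition unit_clip :: "real \<Rightarrow> real" where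
  "unit_clip s = max 0 (min 1 s)"

lemma unit_clip_id: "0 \<le> s \<Longrightarrow> s \<le> 1 \<Longrightarrow> unit_clip s = s"
  by (simp add: unit_clip_def)

lemma measurable_process_clip:
  assumes "measurable_process M Z"
  shows "(\<lambda>q. Z (unit_clip (fst q)) (snd q)) \<in> borel_measurable (borel \<Otimes>\<^sub>M M)"
proof -
  have "unit_clip \<in> borel \<rightarrow>\<^sub>M restrict_space borel {0..1}"
    by (intro measurable_restrict_space2) (auto simp: unit_clip_def[abs_def])
  then have "(\<lambda>q. (unit_clip (fst q), snd q)) \<in> borel \<Otimes>\<^sub>M M \<rightarrow>\<^sub>M restrict_space borel {0..1} \<Otimes>\<^sub>M M"
    by measurable
  from measurable_compose[OF this assms[unfolded measurable_process_def]] show ?thesis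
    by simp
qed

lemma simple_process_eq:
  assumes "\<And>i. i < m \<Longrightarrow> \<tau> i \<le> \<tau> (Suc i)" "k < m" "\<tau> k < s" "s \<le> \<tau> (Suc k)"
  shows "simple_process m \<tau> \<xi> s \<omega> = \<xi> k \<omega>"
proof -
  have mono: "\<tau> i \<le> \<tau> j" if "i \<le> j" "j \<le> m" for i j
    using that by (induction rule: dec_induct) (use assms(1) in \<open>auto intro: order_trans simp: Suc_le_eq\<close>)
  have "\<xi> i \<omega> * indicator {\<tau> i<..\<tau> (Suc i)} s = (if i = k then \<xi> k \<omega> else 0)" if "i < m" for i
  proof (cases i k rule: linorder_cases)
    case less
    then have "\<tau> (Suc i) \<le> \<tau> k" using assms by (intro mono) auto
    then show ?thesis using less assms by auto
  next
    case greater
    then have "\<tau> (Suc k) \<le> \<tau> i" using that by (intro mono) auto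
    then show ?thesis using greater assms by auto
  qed (use assms in auto)
  then have "simple_process m \<tau> \<xi> s \<omega> = (\<Sum>i<m. if i = k then \<xi> k \<omega> else 0)"
    unfolding simple_process_def by (intro sum.cong) auto
  then show ?thesis using assms by simp
qed

text \<open>Adding the endpoints 0 and 1 with zero coefficients makes the partition cover [0,1]. A
  constant subtracted on all of (t, u] can then be absorbed into the coefficients of the same
  partition.\<close>

lemma simple_repr_extend:
  assumes "simple_repr M F m \<tau> \<xi>"
  obtains m' \<tau>' \<xi>' where "simple_repr M F m' \<tau>' \<xi>'" "\<tau>' 0 = 0" "\<tau>' m' = 1"
    "simple_process m' \<tau>' \<xi>' = simple_process m \<tau> \<xi>"
    "\<And>B. simple_integral B m' \<tau>' \<xi>' = simple_integral B m \<tau> \<xi>"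
proof -
  define \<tau>' where "\<tau>' = (\<lambda>i. if i = 0 then 0 else if i \<le> Suc m then \<tau> (i - 1) else 1)"
  define \<xi>' where "\<xi>' = (\<lambda>i (\<omega>::'a). if i = 0 \<or> i = Suc m then 0 else \<xi> (i - 1) \<omega>)"
  have sum: "(\<Sum>i<Suc (Suc m). f i) = f 0 + (\<Sum>i<m. f (Suc i)) + f (Suc m)" for f :: "nat \<Rightarrow> real"
    by (subst sum.lessThan_Suc, subst sum.lessThan_Suc_shift) simp
  have \<tau>: "0 \<le> \<tau> 0" "\<tau> m \<le> 1" "\<And>i. i < m \<Longrightarrow> \<tau> i \<le> \<tau> (Suc i)"
    and \<xi>: "\<And>i. i < m \<Longrightarrow> \<xi> i \<in> borel_measurable (F (\<tau> i))" "\<And>i. i < m \<Longrightarrow> \<exists>C. \<forall>\<omega>\<in>space M. \<bar>\<xi> i \<omega>\<bar> \<le> C"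
    using assms(1) by (auto simp: simple_repr_def)
  show thesis
  proof (rule that[of "Suc (Suc m)" \<tau>' \<xi>'])
    have "\<tau>' i \<le> \<tau>' (Suc i)" if "i < Suc (Suc m)" for i
      using that \<tau> by (cases i) (auto simp: \<tau>'_def less_Suc_eq_le le_less)
    moreover have "\<xi>' i \<in> borel_measurable (F (\<tau>' i)) \<and> (\<exists>C. \<forall>\<omega>\<in>space M. \<bar>\<xi>' i \<omega>\<bar> \<le> C)" if "i < Suc (Suc m)" for i
    proof (cases "i = 0 \<or> i = Suc m")
      case True
      then have "\<xi>' i = (\<lambda>_. 0)" by (auto simp: \<xi>'_def)
      then show ?thesis by (auto intro!: exI[of _ 0])
    next
      case False
      then obtain j where j: "i = Suc j" "j < m" using \<open>i < Suc (Suc m)\<close> by (cases i) auto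
      then show ?thesis using \<xi>[of j] by (auto simp: \<xi>'_def \<tau>'_def)
    qed
    ultimately show "simple_repr M F (Suc (Suc m)) \<tau>' \<xi>'"
      unfolding simple_repr_def by (auto simp: \<tau>'_def)
    show "simple_process (Suc (Suc m)) \<tau>' \<xi>' = simple_process m \<tau> \<xi>"
      unfolding simple_process_def sum by (auto simp: fun_eq_iff \<tau>'_def \<xi>'_def intro!: sum.cong)
    show "simple_integral B (Suc (Suc m)) \<tau>' \<xi>' = simple_integral B m \<tau> \<xi>" for B
      unfolding simple_integral_def sum by (auto simp: fun_eq_iff \<tau>'_def \<xi>'_def intro!: sum.cong)
  qed (auto simp: \<tau>'_def)
qed

context filtered_brownian
begin

text \<open>Restricting a simple process to \<open>(t, u]\<close> and subtracting the constant \<open>c\<close> amounts to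
  clipping its partition to \<open>[t, u]\<close>.\<close>

lemma simple_increment_bound:
  assumes repr: "simple_repr M F m \<tau> \<xi>" and tu: "0 \<le> t" "t \<le> u" "u \<le> 1"
    and w: "w \<in> borel_measurable (F t)" and c: "c \<in> borel_measurable (F t)" and N: "N > 0"
  shows "(\<integral>\<^sup>+\<omega>. ennreal (min N ((w \<omega> * (simple_integral B m \<tau> \<xi> u \<omega> - simple_integral B m \<tau> \<xi> t \<omega> - c \<omega> * (B u \<omega> - B t \<omega>)))\<^sup>2)) \<partial>M)
    \<le> 2 * (\<integral>\<^sup>+\<omega>. min (ennreal N) (\<integral>\<^sup>+s. ennreal ((w \<omega> * (simple_process m \<tau> \<xi> s \<omega> - c \<omega>))\<^sup>2) * indicator {t..u} s \<partial>lborel) \<partial>M)"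
proof -
  from simple_repr_extend[OF repr]
  obtain m' \<tau>' \<xi>' where repr': "simple_repr M F m' \<tau>' \<xi>'" and \<tau>0: "\<tau>' 0 = 0" and \<tau>1: "\<tau>' m' = 1"
    and eq: "simple_process m' \<tau>' \<xi>' = simple_process m \<tau> \<xi>"
    "simple_integral B m' \<tau>' \<xi>' = simple_integral B m \<tau> \<xi>" by metis
  have \<tau>m: "\<And>i. i < m' \<Longrightarrow> \<tau>' i \<le> \<tau>' (Suc i)" and \<xi>: "\<And>i. i < m' \<Longrightarrow> \<xi>' i \<in> borel_measurable (F (\<tau>' i))"
    using repr' by (auto simp: simple_repr_def)
  have \<tau>pos: "0 \<le> \<tau>' k" if "k \<le> m'" for k
    using that by (induction k) (use \<tau>0 \<tau>m in \<open>auto intro: order_trans simp: Suc_le_eq\<close>)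
  define \<sigma> where "\<sigma> = (\<lambda>i. max t (min u (\<tau>' i)))"
  define \<zeta> where "\<zeta> = (\<lambda>i \<omega>. w \<omega> * (\<xi>' i \<omega> - c \<omega>))"
  have \<sigma>0: "\<sigma> 0 = t" and \<sigma>1: "\<sigma> m' = u" using \<tau>0 \<tau>1 tu by (auto simp: \<sigma>_def)
  have \<sigma>b: "t \<le> \<sigma> i" "\<sigma> i \<le> u" for i using tu by (auto simp: \<sigma>_def)
  have \<sigma>m: "\<sigma> i \<le> \<sigma> (Suc i)" if "i < m'" for i using \<tau>m[OF that] by (auto simp: \<sigma>_def)
  have \<zeta>m: "\<zeta> i \<in> borel_measurable (F (\<sigma> i))" if i: "i < m'" "\<sigma> i < \<sigma> (Suc i)" for i
  proof -
    \<comment> \<open>A nondegenerate clipped interval has \<open>\<tau>' i\<close> below u, so its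
      left end is not earlier than \<open>\<tau>' i\<close> and the coefficient is known
      there.\<close>
    have "\<tau>' i \<le> \<sigma> i" using i(2) by (auto simp: \<sigma>_def)
    then have "\<xi>' i \<in> borel_measurable (F (\<sigma> i))"
      using \<xi>[OF i(1)] \<tau>pos[of i] \<sigma>b(2)[of i] tu i by (intro measurable_F_mono[of "\<xi>' i" "\<tau>' i" borel "\<sigma> i"]) auto
    moreover have "w \<in> borel_measurable (F (\<sigma> i))" "c \<in> borel_measurable (F (\<sigma> i))"
      using \<sigma>b[of i] tu measurable_F_mono[OF w, of "\<sigma> i"] measurable_F_mono[OF c, of "\<sigma> i"] by auto
    ultimately show ?thesis unfolding \<zeta>_def by measurable
  qed
  have J: "w \<omega> * (simple_integral B m \<tau> \<xi> u \<omega> - simple_integral B m \<tau> \<xi> t \<omega> - c \<omega> * (B u \<omega> - B t \<omega>))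
    = (\<Sum>i<m'. \<zeta> i \<omega> * (B (\<sigma> (Suc i)) \<omega> - B (\<sigma> i) \<omega>))" for \<omega>
  proof -
    \<comment> \<open>Stopping at u minus stopping at t is the increment from t to the clipped
      time.\<close>
    have clip: "B (min x u) \<omega> - B (min x t) \<omega> = B (max t (min u x)) \<omega> - B t \<omega>" for x
      using tu by (auto simp: min_def max_def)
    have "simple_integral B m' \<tau>' \<xi>' u \<omega> - simple_integral B m' \<tau>' \<xi>' t \<omega>
      = (\<Sum>i<m'. \<xi>' i \<omega> * ((B (min (\<tau>' (Suc i)) u) \<omega> - B (min (\<tau>' (Suc i)) t) \<omega>) - (B (min (\<tau>' i) u) \<omega> - B (min (\<tau>' i) t) \<omega>)))"
      unfolding simple_integral_def sum_subtractf[symmetric] by (intro sum.cong refl) (simp add: algebra_simps)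
    also have "\<dots> = (\<Sum>i<m'. \<xi>' i \<omega> * (B (\<sigma> (Suc i)) \<omega> - B (\<sigma> i) \<omega>))"
      unfolding clip \<sigma>_def by simp
    finally have 1: "simple_integral B m \<tau> \<xi> u \<omega> - simple_integral B m \<tau> \<xi> t \<omega> = \<dots>" unfolding eq .
    have "B u \<omega> - B t \<omega> = (\<Sum>i<m'. B (\<sigma> (Suc i)) \<omega> - B (\<sigma> i) \<omega>)"
      using sum_lessThan_telescope[of "\<lambda>i. B (\<sigma> i) \<omega>" m'] \<sigma>0 \<sigma>1 by simp
    then show ?thesis unfolding 1 \<zeta>_def
      by (simp add: sum_distrib_left sum_subtractf[symmetric] algebra_simps)
  qed
  have Q: "ennreal (\<Sum>i<m'. (\<zeta> i \<omega>)\<^sup>2 * (\<sigma> (Suc i) - \<sigma> i))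
     \<le> (\<integral>\<^sup>+s. ennreal ((w \<omega> * (simple_process m \<tau> \<xi> s \<omega> - c \<omega>))\<^sup>2) * indicator {t..u} s \<partial>lborel)" for \<omega>
  proof -
    let ?f = "\<lambda>s. ennreal ((w \<omega> * (simple_process m \<tau> \<xi> s \<omega> - c \<omega>))\<^sup>2)"
    have [measurable]: "?f \<in> borel_measurable borel" unfolding simple_process_def by measurable
    \<comment> \<open>Induction over the clipped intervals: the simple process is constant on each,
      so the sum of squares is the integral of the square.\<close>
    have "ennreal (\<Sum>i<k. (\<zeta> i \<omega>)\<^sup>2 * (\<sigma> (Suc i) - \<sigma> i)) = (\<integral>\<^sup>+s. ?f s * indicator {t<..\<sigma> k} s \<partial>lborel)" if "k \<le> m'" for k
      using that
    proof (induction k)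
      case 0
      then show ?case by (simp add: \<sigma>0)
    next
      case (Suc k)
      have "(\<integral>\<^sup>+s. ?f s * indicator {t<..\<sigma> (Suc k)} s \<partial>lborel)
        = (\<integral>\<^sup>+s. ?f s * indicator {t<..\<sigma> k} s + ennreal ((\<zeta> k \<omega>)\<^sup>2) * indicator {\<sigma> k<..\<sigma> (Suc k)} s \<partial>lborel)"
      proof (intro nn_integral_cong)
        fix s
        show "?f s * indicator {t<..\<sigma> (Suc k)} s = ?f s * indicator {t<..\<sigma> k} s + ennreal ((\<zeta> k \<omega>)\<^sup>2) * indicator {\<sigma> k<..\<sigma> (Suc k)} s"
        proof (cases "s \<in> {\<sigma> k<..\<sigma> (Suc k)}")
          case True
          then have "\<tau>' k < s" "s \<le> \<tau>' (Suc k)" using \<sigma>b(2)[of "Suc k"] \<sigma>b(1)[of k] by (auto simp: \<sigma>_def)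
          then have "simple_process m \<tau> \<xi> s \<omega> = \<xi>' k \<omega>"
            unfolding eq(1)[symmetric] using \<tau>m Suc.prems by (intro simple_process_eq) auto
          then show ?thesis using True \<sigma>b(1)[of k] by (auto simp: \<zeta>_def)
        next
          case False
          then show ?thesis using \<sigma>m[of k] Suc.prems by (auto simp: indicator_def)
        qed
      qed
      also have "\<dots> = ennreal (\<Sum>i<k. (\<zeta> i \<omega>)\<^sup>2 * (\<sigma> (Suc i) - \<sigma> i)) + ennreal ((\<zeta> k \<omega>)\<^sup>2 * (\<sigma> (Suc k) - \<sigma> k))"
        using Suc \<sigma>m[of k] by (subst nn_integral_add) (auto simp: nn_integral_cmult_indicator ennreal_mult)
      also have "\<dots> = ennreal (\<Sum>i<Suc k. (\<zeta> i \<omega>)\<^sup>2 * (\<sigma> (Suc i) - \<sigma> i))"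
        using Suc.prems \<sigma>m by (subst ennreal_plus[symmetric]) (auto intro!: sum_nonneg mult_nonneg_nonneg)
      finally show ?case by simp
    qed
    then have "ennreal (\<Sum>i<m'. (\<zeta> i \<omega>)\<^sup>2 * (\<sigma> (Suc i) - \<sigma> i)) = (\<integral>\<^sup>+s. ?f s * indicator {t<..u} s \<partial>lborel)"
      using \<sigma>1 by simp
    also have "\<dots> \<le> (\<integral>\<^sup>+s. ?f s * indicator {t..u} s \<partial>lborel)"
      by (intro nn_integral_mono mult_left_mono) (auto simp: indicator_def)
    finally show ?thesis .
  qed
  have "(\<integral>\<^sup>+\<omega>. ennreal (min N ((\<Sum>i<m'. \<zeta> i \<omega> * (B (\<sigma> (Suc i)) \<omega> - B (\<sigma> i) \<omega>))\<^sup>2)) \<partial>M)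
    \<le> 2 * (\<integral>\<^sup>+\<omega>. ennreal (min N (\<Sum>i<m'. (\<zeta> i \<omega>)\<^sup>2 * (\<sigma> (Suc i) - \<sigma> i))) \<partial>M)"
    using truncated_isometry[of \<sigma> m' \<zeta> N] \<sigma>0 \<sigma>m \<sigma>b(2) tu \<zeta>m N by (meson order_trans order.refl \<sigma>b(1))
  also have "\<dots> \<le> 2 * (\<integral>\<^sup>+\<omega>. min (ennreal N) (\<integral>\<^sup>+s. ennreal ((w \<omega> * (simple_process m \<tau> \<xi> s \<omega> - c \<omega>))\<^sup>2) * indicator {t..u} s \<partial>lborel) \<partial>M)"
  proof (intro mult_left_mono nn_integral_mono)
    fix \<omega>
    have "0 \<le> (\<Sum>i<m'. (\<zeta> i \<omega>)\<^sup>2 * (\<sigma> (Suc i) - \<sigma> i))" using \<sigma>m by (intro sum_nonneg) auto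
    then show "ennreal (min N (\<Sum>i<m'. (\<zeta> i \<omega>)\<^sup>2 * (\<sigma> (Suc i) - \<sigma> i)))
      \<le> min (ennreal N) (\<integral>\<^sup>+s. ennreal ((w \<omega> * (simple_process m \<tau> \<xi> s \<omega> - c \<omega>))\<^sup>2) * indicator {t..u} s \<partial>lborel)"
      by (intro min.boundedI order_trans[OF ennreal_leI Q]) (auto intro: ennreal_leI)
  qed simp
  finally show ?thesis unfolding J .
qed

end

section \<open>From simple processes to the Ito integral\<close>

lemma nn_integral_min_Sup:
  fixes f :: "'a \<Rightarrow> real"
  assumes [measurable]: "f \<in> borel_measurable M" and nn: "\<And>\<omega>. 0 \<le> f \<omega>"
    and le: "\<And>N::nat. 0 < N \<Longrightarrow> (\<integral>\<^sup>+\<omega>. ennreal (min (real N) (f \<omega>)) \<partial>M) \<le> A"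
  shows "(\<integral>\<^sup>+\<omega>. ennreal (f \<omega>) \<partial>M) \<le> A"
proof -
  have "(\<integral>\<^sup>+\<omega>. ennreal (f \<omega>) \<partial>M) = (\<integral>\<^sup>+\<omega>. liminf (\<lambda>N. ennreal (min (real N) (f \<omega>))) \<partial>M)"
  proof (intro nn_integral_cong)
    fix \<omega>
    have "eventually (\<lambda>N. f \<omega> \<le> real N) sequentially"
      using filterlim_real_sequentially by (simp add: filterlim_at_top)
    then have "eventually (\<lambda>N. ennreal (min (real N) (f \<omega>)) = ennreal (f \<omega>)) sequentially"
      by eventually_elim (simp add: min_absorb2)
    then have "(\<lambda>N. ennreal (min (real N) (f \<omega>))) \<longlonglongrightarrow> ennreal (f \<omega>)"
      by (rule tendsto_eventually)
    then show "ennreal (f \<omega>) = liminf (\<lambda>N. ennreal (min (real N) (f \<omega>)))"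
      by (simp add: lim_imp_Liminf)
  qed
  also have "\<dots> \<le> liminf (\<lambda>N. \<integral>\<^sup>+\<omega>. ennreal (min (real N) (f \<omega>)) \<partial>M)"
    by (rule nn_integral_liminf) measurable
  also have "\<dots> \<le> A"
  proof (rule Liminf_le)
    show "eventually (\<lambda>N. (\<integral>\<^sup>+\<omega>. ennreal (min (real N) (f \<omega>)) \<partial>M) \<le> A) sequentially"
      using eventually_gt_at_top[of 0] by eventually_elim (rule le)
  qed simp
  finally show ?thesis .
qed

lemma min_split3:
  fixes x y z :: real
  assumes "0 \<le> N" "0 \<le> x" "0 \<le> y" "0 \<le> z" "q \<le> 2 * x + 4 * y + 4 * z"
  shows "min N q \<le> 2 * min N x + 4 * min N y + 4 * min N z"
  using assms by (auto simp: min_def)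

context filtered_brownian
begin

text \<open>The integrand is split at \<open>a\<close> by (x + y)^2 <= 2 x^2 + 2 y^2. The first part
  is the distance that vanishes in probability along the approximating sequence; the second does not
  involve the simple process.\<close>

lemma simple_process_approx_bound:
  assumes a: "ito_integrand M F a" and tu: "0 \<le> t" "t \<le> u" "u \<le> 1" and wb: "\<And>\<omega>. \<bar>w \<omega>\<bar> \<le> W"
  shows "AE \<omega> in M. (\<integral>\<^sup>+s. ennreal ((w \<omega> * (simple_process m \<tau> \<xi> s \<omega> - c \<omega>))\<^sup>2) * indicator {t..u} s \<partial>lborel)
    \<le> ennreal (2 * W\<^sup>2 * \<bar>LBINT s:{0..1}. (simple_process m \<tau> \<xi> s \<omega> - a s \<omega>)\<^sup>2\<bar>)
      + 2 * (\<integral>\<^sup>+s. ennreal ((w \<omega> * (a (unit_clip s) \<omega> - c \<omega>))\<^sup>2) * indicator {t..u} s \<partial>lborel)"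
proof -
  have am: "measurable_process M a" and ai: "AE \<omega> in M. set_integrable lborel {0..1} (\<lambda>s. (a s \<omega>)\<^sup>2)"
    using a by (auto simp: ito_integrand_def)
  show ?thesis
    using ai AE_space
  proof eventually_elim
    case (elim \<omega>)
    let ?\<phi> = "\<lambda>s. simple_process m \<tau> \<xi> s \<omega>"
    let ?i = "\<lambda>s. indicator {0..1} s :: real"
    have [measurable]: "(\<lambda>s. a (unit_clip s) \<omega>) \<in> borel_measurable borel"
      using measurable_compose[OF measurable_Pair2'[OF elim(2)] measurable_process_clip[OF am]] by simp
    have \<phi>m[measurable]: "?\<phi> \<in> borel_measurable borel" unfolding simple_process_def by measurable
    have ic: "?i s * f (a s \<omega>) = ?i s * f (a (unit_clip s) \<omega>)" for s and f :: "real \<Rightarrow> real"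
      by (auto simp: indicator_def unit_clip_id)
    \<comment> \<open>Integrability must be established because the Bochner integral of a
      nonintegrable function is 0 and would bound nothing.\<close>
    have int: "integrable lborel (\<lambda>s. ?i s * (?\<phi> s - a (unit_clip s) \<omega>)\<^sup>2)"
    proof (rule Bochner_Integration.integrable_bound)
      have "integrable lborel (\<lambda>s. ?i s * (a (unit_clip s) \<omega>)\<^sup>2)"
        using elim(1) ic[of _ "\<lambda>x. x\<^sup>2"] by (simp add: set_integrable_def)
      then show "integrable lborel (\<lambda>s. 2 * (?i s * (\<Sum>i<m. \<bar>\<xi> i \<omega>\<bar>)\<^sup>2) + 2 * (?i s * (a (unit_clip s) \<omega>)\<^sup>2))"
        by (intro Bochner_Integration.integrable_add integrable_mult_right integrable_mult_left integrable_real_indicator) auto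
      show "AE s in lborel. norm (?i s * (?\<phi> s - a (unit_clip s) \<omega>)\<^sup>2)
          \<le> norm (2 * (?i s * (\<Sum>i<m. \<bar>\<xi> i \<omega>\<bar>)\<^sup>2) + 2 * (?i s * (a (unit_clip s) \<omega>)\<^sup>2))"
      proof (rule AE_I2)
        fix s
        have "\<bar>?\<phi> s\<bar> \<le> (\<Sum>i<m. \<bar>\<xi> i \<omega>\<bar>)"
          unfolding simple_process_def by (intro order_trans[OF sum_abs] sum_mono) (auto simp: abs_mult indicator_def)
        then have "(?\<phi> s)\<^sup>2 \<le> (\<Sum>i<m. \<bar>\<xi> i \<omega>\<bar>)\<^sup>2" by (metis abs_ge_zero power2_abs power_mono)
        moreover have "(?\<phi> s - a (unit_clip s) \<omega>)\<^sup>2 + (?\<phi> s + a (unit_clip s) \<omega>)\<^sup>2 = 2 * (?\<phi> s)\<^sup>2 + 2 * (a (unit_clip s) \<omega>)\<^sup>2"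
          by (simp add: power2_eq_square algebra_simps)
        ultimately have "(?\<phi> s - a (unit_clip s) \<omega>)\<^sup>2 \<le> 2 * (\<Sum>i<m. \<bar>\<xi> i \<omega>\<bar>)\<^sup>2 + 2 * (a (unit_clip s) \<omega>)\<^sup>2"
          using zero_le_power2[of "?\<phi> s + a (unit_clip s) \<omega>"] by linarith
        then show "norm (?i s * (?\<phi> s - a (unit_clip s) \<omega>)\<^sup>2)
          \<le> norm (2 * (?i s * (\<Sum>i<m. \<bar>\<xi> i \<omega>\<bar>)\<^sup>2) + 2 * (?i s * (a (unit_clip s) \<omega>)\<^sup>2))"
          by (auto simp: indicator_def)
      qed
    qed measurable
    have D: "(LBINT s:{0..1}. (?\<phi> s - a s \<omega>)\<^sup>2) = (\<integral>s. ?i s * (?\<phi> s - a (unit_clip s) \<omega>)\<^sup>2 \<partial>lborel)"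
      unfolding set_lebesgue_integral_def real_scaleR_def
      by (intro Bochner_Integration.integral_cong refl) (auto simp: indicator_def unit_clip_id)
    have D0: "0 \<le> (\<integral>s. ?i s * (?\<phi> s - a (unit_clip s) \<omega>)\<^sup>2 \<partial>lborel)" by (intro integral_nonneg_AE AE_I2) auto
    have "(\<integral>\<^sup>+s. ennreal ((w \<omega> * (?\<phi> s - c \<omega>))\<^sup>2) * indicator {t..u} s \<partial>lborel)
      \<le> (\<integral>\<^sup>+s. ennreal (2 * W\<^sup>2) * ennreal (?i s * (?\<phi> s - a (unit_clip s) \<omega>)\<^sup>2)
          + 2 * (ennreal ((w \<omega> * (a (unit_clip s) \<omega> - c \<omega>))\<^sup>2) * indicator {t..u} s) \<partial>lborel)"
    proof (intro nn_integral_mono)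
      fix s
      show "ennreal ((w \<omega> * (?\<phi> s - c \<omega>))\<^sup>2) * indicator {t..u} s \<le> ennreal (2 * W\<^sup>2) * ennreal (?i s * (?\<phi> s - a (unit_clip s) \<omega>)\<^sup>2)
          + 2 * (ennreal ((w \<omega> * (a (unit_clip s) \<omega> - c \<omega>))\<^sup>2) * indicator {t..u} s)"
      proof (cases "s \<in> {t..u}")
        case True
        define x where "x = w \<omega> * (?\<phi> s - a (unit_clip s) \<omega>)"
        define y where "y = w \<omega> * (a (unit_clip s) \<omega> - c \<omega>)"
        have "(x + y)\<^sup>2 + (x - y)\<^sup>2 = 2 * x\<^sup>2 + 2 * y\<^sup>2" by (simp add: power2_eq_square algebra_simps)
        then have "(x + y)\<^sup>2 \<le> 2 * x\<^sup>2 + 2 * y\<^sup>2" using zero_le_power2[of "x - y"] by linarith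
        moreover have "x + y = w \<omega> * (?\<phi> s - c \<omega>)" by (simp add: x_def y_def algebra_simps)
        moreover have "x\<^sup>2 \<le> W\<^sup>2 * (?\<phi> s - a (unit_clip s) \<omega>)\<^sup>2"
          unfolding x_def power_mult_distrib using wb[of \<omega>]
          by (intro mult_right_mono) (metis abs_ge_zero power2_abs power_mono, simp)
        ultimately have "(w \<omega> * (?\<phi> s - c \<omega>))\<^sup>2 \<le> 2 * W\<^sup>2 * (?\<phi> s - a (unit_clip s) \<omega>)\<^sup>2 + 2 * y\<^sup>2" by simp
        then have "ennreal ((w \<omega> * (?\<phi> s - c \<omega>))\<^sup>2) \<le> ennreal (2 * W\<^sup>2 * (?\<phi> s - a (unit_clip s) \<omega>)\<^sup>2 + 2 * y\<^sup>2)"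
          by (rule ennreal_leI)
        also have "\<dots> = ennreal (2 * W\<^sup>2) * ennreal ((?\<phi> s - a (unit_clip s) \<omega>)\<^sup>2) + 2 * ennreal (y\<^sup>2)"
          by (simp add: ennreal_mult)
        finally show ?thesis using True tu by (simp add: y_def)
      qed simp
    qed
    also have "\<dots> = ennreal (2 * W\<^sup>2) * (\<integral>\<^sup>+s. ennreal (?i s * (?\<phi> s - a (unit_clip s) \<omega>)\<^sup>2) \<partial>lborel)
        + 2 * (\<integral>\<^sup>+s. ennreal ((w \<omega> * (a (unit_clip s) \<omega> - c \<omega>))\<^sup>2) * indicator {t..u} s \<partial>lborel)"
      by (subst nn_integral_add) (simp_all add: nn_integral_cmult)
    also have "(\<integral>\<^sup>+s. ennreal (?i s * (?\<phi> s - a (unit_clip s) \<omega>)\<^sup>2) \<partial>lborel) = ennreal (\<integral>s. ?i s * (?\<phi> s - a (unit_clip s) \<omega>)\<^sup>2 \<partial>lborel)"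
      by (rule nn_integral_eq_integral[OF int]) auto
    finally show ?case
      unfolding D using D0 by (simp add: ennreal_mult)
  qed
qed

text \<open>With \<open>c\<close> equal to \<open>a t\<close> this measures the error of freezing
  the integrand at time t. Truncation at N lets the bound pass from simple processes to their limit
  in probability; N is released last. The 8 is 2 * 2 * 2, from replacing the integral by a simple
  one, from the truncated isometry, and from replacing the simple integrand by
  \<open>a\<close>.\<close>

lemma ito_increment_bound:
  assumes I: "has_ito_integral M F B a I" and tu: "0 \<le> t" "t \<le> u" "u \<le> 1"
    and w: "w \<in> borel_measurable (F t)" and wb: "\<And>\<omega>. \<bar>w \<omega>\<bar> \<le> W" and c: "c \<in> borel_measurable (F t)"
  shows "(\<integral>\<^sup>+\<omega>. ennreal ((w \<omega> * (I u \<omega> - I t \<omega> - c \<omega> * (B u \<omega> - B t \<omega>)))\<^sup>2) \<partial>M)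
    \<le> 8 * (\<integral>\<^sup>+\<omega>. \<integral>\<^sup>+s. ennreal ((w \<omega> * (a (unit_clip s) \<omega> - c \<omega>))\<^sup>2) * indicator {t..u} s \<partial>lborel \<partial>M)"
proof -
  obtain m \<tau> \<xi> where repr: "\<And>n. simple_repr M F (m n) (\<tau> n) (\<xi> n)"
    and appr: "tendsto_in_prob M (\<lambda>n \<omega>. LBINT s:{0..1}. (simple_process (m n) (\<tau> n) (\<xi> n) s \<omega> - a s \<omega>)\<^sup>2) (\<lambda>\<omega>. 0)"
    and lim: "\<And>t. t \<in> {0..1} \<Longrightarrow> tendsto_in_prob M (\<lambda>n. simple_integral B (m n) (\<tau> n) (\<xi> n) t) (I t)"
    and a: "ito_integrand M F a"
    using I unfolding has_ito_integral_def by blast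
  have am: "measurable_process M a" using a by (auto simp: ito_integrand_def)
  have [measurable]: "w \<in> borel_measurable M" "c \<in> borel_measurable M"
    using measurable_F[OF w] measurable_F[OF c] tu by auto
  have [measurable]: "B u \<in> borel_measurable M" "B t \<in> borel_measurable M" using tu by (auto intro: B_measurable)
  have limu: "tendsto_in_prob M (\<lambda>n. simple_integral B (m n) (\<tau> n) (\<xi> n) u) (I u)"
    and limt: "tendsto_in_prob M (\<lambda>n. simple_integral B (m n) (\<tau> n) (\<xi> n) t) (I t)"
    using lim tu by auto
  then have [measurable]: "I u \<in> borel_measurable M" "I t \<in> borel_measurable M"
    "\<And>n. simple_integral B (m n) (\<tau> n) (\<xi> n) u \<in> borel_measurable M"
    "\<And>n. simple_integral B (m n) (\<tau> n) (\<xi> n) t \<in> borel_measurable M"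
    by (auto simp: tendsto_in_prob_def)
  have [measurable]: "(\<lambda>q. a (unit_clip (fst q)) (snd q)) \<in> borel_measurable (borel \<Otimes>\<^sub>M M)"
    by (rule measurable_process_clip[OF am])
  have [measurable]: "(\<lambda>q. a (unit_clip (snd q)) (fst q)) \<in> borel_measurable (M \<Otimes>\<^sub>M borel)"
    using measurable_compose[OF measurable_pair_swap' measurable_process_clip[OF am]]
    by (simp add: case_prod_beta)
  have Dm[measurable]: "\<And>n. (\<lambda>\<omega>. LBINT s:{0..1}. (simple_process (m n) (\<tau> n) (\<xi> n) s \<omega> - a s \<omega>)\<^sup>2) \<in> borel_measurable M"
    using appr by (auto simp: tendsto_in_prob_def)
  let ?D = "\<lambda>n \<omega>. LBINT s:{0..1}. (simple_process (m n) (\<tau> n) (\<xi> n) s \<omega> - a s \<omega>)\<^sup>2"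
  let ?S = "\<lambda>n. simple_integral B (m n) (\<tau> n) (\<xi> n)"
  let ?J = "\<lambda>\<omega>. w \<omega> * (I u \<omega> - I t \<omega> - c \<omega> * (B u \<omega> - B t \<omega>))"
  let ?R = "\<lambda>\<omega>. \<integral>\<^sup>+s. ennreal ((w \<omega> * (a (unit_clip s) \<omega> - c \<omega>))\<^sup>2) * indicator {t..u} s \<partial>lborel"
  define A where "A = (\<integral>\<^sup>+\<omega>. ?R \<omega> \<partial>M)"
  have Rm[measurable]: "?R \<in> borel_measurable M" by measurable
  show ?thesis
    unfolding A_def[symmetric]
  proof (rule nn_integral_min_Sup)
    fix k :: nat assume "0 < k"
    define N where "N = real k"
    have N: "N > 0" using \<open>0 < k\<close> by (simp add: N_def)
    \<comment> \<open>The truncated errors of the integrand and of the integrals at u and at t; each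
      tends to 0 by convergence in probability.\<close>
    define T1 where "T1 = (\<lambda>n. \<integral>\<^sup>+\<omega>. ennreal (min N (2 * W\<^sup>2 * \<bar>?D n \<omega> - 0\<bar>)) \<partial>M)"
    define T2 where "T2 = (\<lambda>n. \<integral>\<^sup>+\<omega>. ennreal (min N (W\<^sup>2 * (?S n u \<omega> - I u \<omega>)\<^sup>2)) \<partial>M)"
    define T3 where "T3 = (\<lambda>n. \<integral>\<^sup>+\<omega>. ennreal (min N (W\<^sup>2 * (?S n t \<omega> - I t \<omega>)\<^sup>2)) \<partial>M)"
    have cont: "isCont (\<lambda>y. min N (2 * W\<^sup>2 * \<bar>y\<bar>)) 0" "isCont (\<lambda>y. min N (W\<^sup>2 * y\<^sup>2)) 0"
      unfolding isCont_def by (intro tendsto_min tendsto_intros)+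
    have T: "T1 \<longlonglongrightarrow> 0" "T2 \<longlonglongrightarrow> 0" "T3 \<longlonglongrightarrow> 0"
      unfolding T1_def T2_def T3_def
      using in_prob_nn_integral_tendsto[OF prob_space_axioms appr, of "\<lambda>y. min N (2 * W\<^sup>2 * \<bar>y\<bar>)" N]
        in_prob_nn_integral_tendsto[OF prob_space_axioms limu, of "\<lambda>y. min N (W\<^sup>2 * y\<^sup>2)" N]
        in_prob_nn_integral_tendsto[OF prob_space_axioms limt, of "\<lambda>y. min N (W\<^sup>2 * y\<^sup>2)" N] N cont
      by simp_all
    have le: "(\<integral>\<^sup>+\<omega>. ennreal (min N ((?J \<omega>)\<^sup>2)) \<partial>M) \<le> 4 * T1 n + 4 * T2 n + 4 * T3 n + 8 * A" for n
    proof -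
      let ?Jn = "\<lambda>\<omega>. w \<omega> * (?S n u \<omega> - ?S n t \<omega> - c \<omega> * (B u \<omega> - B t \<omega>))"
      have "(\<integral>\<^sup>+\<omega>. ennreal (min N ((?J \<omega>)\<^sup>2)) \<partial>M)
        \<le> (\<integral>\<^sup>+\<omega>. 2 * ennreal (min N ((?Jn \<omega>)\<^sup>2)) + 4 * ennreal (min N (W\<^sup>2 * (?S n u \<omega> - I u \<omega>)\<^sup>2))
             + 4 * ennreal (min N (W\<^sup>2 * (?S n t \<omega> - I t \<omega>)\<^sup>2)) \<partial>M)"
      proof (intro nn_integral_mono)
        fix \<omega>
        define x y z where "x = ?Jn \<omega>" and "y = w \<omega> * (I u \<omega> - ?S n u \<omega>)" and "z = w \<omega> * (I t \<omega> - ?S n t \<omega>)"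
        have J: "?J \<omega> = x + (y - z)" by (simp add: x_def y_def z_def algebra_simps)
        have "(x + (y - z))\<^sup>2 + (x - (y - z))\<^sup>2 = 2 * x\<^sup>2 + 2 * (y - z)\<^sup>2" "(y - z)\<^sup>2 + (y + z)\<^sup>2 = 2 * y\<^sup>2 + 2 * z\<^sup>2"
          by (simp_all add: power2_eq_square algebra_simps)
        then have J2: "(x + (y - z))\<^sup>2 \<le> 2 * x\<^sup>2 + 4 * y\<^sup>2 + 4 * z\<^sup>2"
          using zero_le_power2[of "x - (y - z)"] zero_le_power2[of "y + z"] by linarith
        have W: "(w \<omega>)\<^sup>2 \<le> W\<^sup>2" using wb[of \<omega>] by (metis abs_ge_zero power2_abs power_mono)
        have y2: "y\<^sup>2 \<le> W\<^sup>2 * (?S n u \<omega> - I u \<omega>)\<^sup>2"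
          unfolding y_def power_mult_distrib power2_commute[of "I u \<omega>"] using W by (intro mult_right_mono) auto
        have z2: "z\<^sup>2 \<le> W\<^sup>2 * (?S n t \<omega> - I t \<omega>)\<^sup>2"
          unfolding z_def power_mult_distrib power2_commute[of "I t \<omega>"] using W by (intro mult_right_mono) auto
        have "min N ((?J \<omega>)\<^sup>2) \<le> 2 * min N (x\<^sup>2) + 4 * min N (W\<^sup>2 * (?S n u \<omega> - I u \<omega>)\<^sup>2) + 4 * min N (W\<^sup>2 * (?S n t \<omega> - I t \<omega>)\<^sup>2)"
          unfolding J using N J2 y2 z2 by (intro min_split3) auto
        then have "ennreal (min N ((?J \<omega>)\<^sup>2)) \<le> ennreal (2 * min N (x\<^sup>2) + 4 * min N (W\<^sup>2 * (?S n u \<omega> - I u \<omega>)\<^sup>2) + 4 * min N (W\<^sup>2 * (?S n t \<omega> - I t \<omega>)\<^sup>2))"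
          by (rule ennreal_leI)
        also have "\<dots> = 2 * ennreal (min N (x\<^sup>2)) + 4 * ennreal (min N (W\<^sup>2 * (?S n u \<omega> - I u \<omega>)\<^sup>2)) + 4 * ennreal (min N (W\<^sup>2 * (?S n t \<omega> - I t \<omega>)\<^sup>2))"
          using N by (simp add: ennreal_plus ennreal_mult)
        finally show "ennreal (min N ((?J \<omega>)\<^sup>2)) \<le> 2 * ennreal (min N ((?Jn \<omega>)\<^sup>2)) + 4 * ennreal (min N (W\<^sup>2 * (?S n u \<omega> - I u \<omega>)\<^sup>2))
             + 4 * ennreal (min N (W\<^sup>2 * (?S n t \<omega> - I t \<omega>)\<^sup>2))" unfolding x_def .
      qed
      also have "\<dots> = 2 * (\<integral>\<^sup>+\<omega>. ennreal (min N ((?Jn \<omega>)\<^sup>2)) \<partial>M) + 4 * T2 n + 4 * T3 n"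
        unfolding T2_def T3_def by (simp add: nn_integral_add nn_integral_cmult)
      also have "(\<integral>\<^sup>+\<omega>. ennreal (min N ((?Jn \<omega>)\<^sup>2)) \<partial>M) \<le> 2 * (T1 n + 2 * A)"
      proof -
        have "(\<integral>\<^sup>+\<omega>. ennreal (min N ((?Jn \<omega>)\<^sup>2)) \<partial>M)
          \<le> 2 * (\<integral>\<^sup>+\<omega>. min (ennreal N) (\<integral>\<^sup>+s. ennreal ((w \<omega> * (simple_process (m n) (\<tau> n) (\<xi> n) s \<omega> - c \<omega>))\<^sup>2) * indicator {t..u} s \<partial>lborel) \<partial>M)"
          by (rule simple_increment_bound[OF repr tu w c N])
        also have "\<dots> \<le> 2 * (\<integral>\<^sup>+\<omega>. ennreal (min N (2 * W\<^sup>2 * \<bar>?D n \<omega> - 0\<bar>)) + 2 * ?R \<omega> \<partial>M)"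
        proof (intro mult_left_mono nn_integral_mono_AE)
          show "AE \<omega> in M. min (ennreal N) (\<integral>\<^sup>+s. ennreal ((w \<omega> * (simple_process (m n) (\<tau> n) (\<xi> n) s \<omega> - c \<omega>))\<^sup>2) * indicator {t..u} s \<partial>lborel)
             \<le> ennreal (min N (2 * W\<^sup>2 * \<bar>?D n \<omega> - 0\<bar>)) + 2 * ?R \<omega>"
            using simple_process_approx_bound[where w = w and W = W and m = "m n" and \<tau> = "\<tau> n" and \<xi> = "\<xi> n" and c = c, OF a tu wb]
          proof eventually_elim
            case (elim \<omega>)
            \<comment> \<open>Truncation is kept only on the part that tends to 0; the other part
              does not depend on n.\<close>
            have "min (ennreal N) (x + y) \<le> min (ennreal N) x + y" for x y :: ennreal
              by (auto simp: min_def add_increasing2 intro: order_trans)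
            note sub = this[of "ennreal (2 * W\<^sup>2 * \<bar>?D n \<omega>\<bar>)" "2 * ?R \<omega>"]
            have eq: "min (ennreal N) (ennreal (2 * W\<^sup>2 * \<bar>?D n \<omega>\<bar>)) = ennreal (min N (2 * W\<^sup>2 * \<bar>?D n \<omega> - 0\<bar>))"
              using N by (auto simp: min_def ennreal_le_iff)
            show ?case
              by (rule order_trans[OF min.mono[OF order_refl elim] sub[unfolded eq]])
          qed
        qed simp
        also have "\<dots> = 2 * (T1 n + 2 * A)"
          unfolding T1_def A_def by (simp add: nn_integral_add nn_integral_cmult)
        finally show ?thesis .
      qed
      finally have "(\<integral>\<^sup>+\<omega>. ennreal (min N ((?J \<omega>)\<^sup>2)) \<partial>M) \<le> 2 * (2 * (T1 n + 2 * A)) + 4 * T2 n + 4 * T3 n"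
        by (simp add: add_right_mono mult_left_mono)
      also have "\<dots> = 4 * T1 n + 4 * T2 n + 4 * T3 n + 8 * A"
        by (simp only: distrib_left mult.assoc[symmetric] mult_numeral_1 numeral_times_numeral mult_num_simps) (simp add: ac_simps)
      finally show ?thesis .
    qed
    have "(\<lambda>n. 4 * T1 n + 4 * T2 n + 4 * T3 n + 8 * A) \<longlonglongrightarrow> 4 * 0 + 4 * 0 + 4 * 0 + 8 * A"
      using T by (intro tendsto_add tendsto_const tendsto_mult_ennreal) auto
    then have "(\<lambda>n. 4 * T1 n + 4 * T2 n + 4 * T3 n + 8 * A) \<longlonglongrightarrow> 8 * A" by simp
    then show "(\<integral>\<^sup>+\<omega>. ennreal (min (real k) ((?J \<omega>)\<^sup>2)) \<partial>M) \<le> 8 * A"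
      using le unfolding N_def by (intro LIMSEQ_le_const) auto
  qed auto
qed

end

section \<open>Localization and increments of the process\<close>

text \<open>Cauchy-Schwarz, from the nonnegative integral of (f - m)^2 with m the mean of f over the
  interval. If f is not square integrable, the right side is infinite.\<close>

lemma set_integral_power2_le:
  fixes f :: "real \<Rightarrow> real"
  assumes tu: "t < u" and f: "set_integrable lborel {t..u} f" and fm: "(\<lambda>s. indicator {t..u} s * f s) \<in> borel_measurable borel"
  shows "ennreal ((LBINT s:{t..u}. f s)\<^sup>2) \<le> ennreal (u - t) * (\<integral>\<^sup>+s. ennreal ((f s)\<^sup>2) * indicator {t..u} s \<partial>lborel)"
proof -
  let ?i = "indicator {t..u} :: real \<Rightarrow> real"
  let ?A = "\<integral>\<^sup>+s. ennreal ((f s)\<^sup>2) * indicator {t..u} s \<partial>lborel"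
  have sq: "(?i s * f s)\<^sup>2 = ?i s * (f s)\<^sup>2" for s by (simp add: indicator_def)
  have A: "?A = (\<integral>\<^sup>+s. ennreal ((?i s * f s)\<^sup>2) \<partial>lborel)"
    by (intro nn_integral_cong) (auto simp: indicator_def)
  show ?thesis
  proof (cases "?A = \<infinity>")
    case True
    then show ?thesis using tu by (simp add: ennreal_mult_top)
  next
    case False
    have i1: "integrable lborel (\<lambda>s. ?i s * f s)" using f by (simp add: set_integrable_def)
    have i2: "integrable lborel (\<lambda>s. (?i s * f s)\<^sup>2)"
      using False fm unfolding A by (intro integrableI_nonneg) (auto simp: less_top)
    have i3: "integrable lborel ?i" using tu by (intro integrable_real_indicator) auto
    define J where "J = (\<integral>s. ?i s * f s \<partial>lborel)"
    define m where "m = J / (u - t)"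
    have mJ: "m * (u - t) = J" using tu by (simp add: m_def)
    have "0 \<le> (\<integral>s. (?i s * f s)\<^sup>2 - 2 * m * (?i s * f s) + m\<^sup>2 * ?i s \<partial>lborel)"
    proof (intro integral_nonneg_AE AE_I2)
      fix s
      have "(?i s * f s)\<^sup>2 - 2 * m * (?i s * f s) + m\<^sup>2 * ?i s = ?i s * (f s - m)\<^sup>2"
        by (auto simp: indicator_def power2_eq_square algebra_simps)
      then show "0 \<le> (?i s * f s)\<^sup>2 - 2 * m * (?i s * f s) + m\<^sup>2 * ?i s" by simp
    qed
    also have "\<dots> = (\<integral>s. (?i s * f s)\<^sup>2 \<partial>lborel) - 2 * m * J + m\<^sup>2 * (u - t)"
      using i1 i2 i3 tu by (simp add: J_def)
    also have "\<dots> = (\<integral>s. (?i s * f s)\<^sup>2 \<partial>lborel) - m * J"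
      using mJ by (simp add: power2_eq_square mult.assoc)
    finally have "(u - t) * (m * J) \<le> (u - t) * (\<integral>s. (?i s * f s)\<^sup>2 \<partial>lborel)"
      using tu by (intro mult_left_mono) auto
    moreover have "(u - t) * (m * J) = J\<^sup>2"
      using mJ by (simp add: power2_eq_square mult_ac)
    ultimately have "J\<^sup>2 \<le> (u - t) * (\<integral>s. (?i s * f s)\<^sup>2 \<partial>lborel)" by simp
    then have "ennreal (J\<^sup>2) \<le> ennreal (u - t) * ennreal (\<integral>s. (?i s * f s)\<^sup>2 \<partial>lborel)"
      using tu by (subst ennreal_mult[symmetric]) (auto intro!: ennreal_leI integral_nonneg_AE)
    also have "ennreal (\<integral>s. (?i s * f s)\<^sup>2 \<partial>lborel) = ?A"
      unfolding A by (rule nn_integral_eq_integral[symmetric, OF i2]) auto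
    finally show ?thesis by (simp add: J_def set_lebesgue_integral_def)
  qed
qed

text \<open>The smallest event of the sub-\<open>\<sigma>\<close>-algebra containing \<open>G\<close> up to a null set.\<close>

definition essential_hull :: "'a measure \<Rightarrow> 'a measure \<Rightarrow> 'a set \<Rightarrow> 'a set" where
  "essential_hull M F G = {\<omega> \<in> space M. nn_cond_exp M F (indicator G) \<omega> \<noteq> 0}"

section \<open>Transfer of bounds from an event to its hull\<close>

context sigma_finite_subalgebra
begin

lemma essential_hull_sets: "essential_hull M F G \<in> sets F"
proof -
  have "{\<omega> \<in> space F. nn_cond_exp M F (indicator G) \<omega> \<noteq> 0} \<in> sets F" by measurable
  moreover have "space F = space M" using subalg by (simp add: subalgebra_def)
  ultimately show ?thesis by (simp only: essential_hull_def)
qed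

text \<open>Off the hull the conditional probability of \<open>G\<close> is 0; its integral over
  that event of \<open>F\<close>, which is the mass of \<open>G\<close> there, is therefore
  0.\<close>

lemma essential_hull_superset:
  assumes [measurable]: "G \<in> sets M"
  shows "AE \<omega> in M. \<omega> \<in> G \<longrightarrow> \<omega> \<in> essential_hull M F G"
proof -
  let ?A = "essential_hull M F G"
  have sp: "space F = space M" using subalg by (simp add: subalgebra_def)
  have C: "space M - ?A \<in> sets F" using sets.Diff[OF sets.top essential_hull_sets[of G]] sp by simp
  then have CM[measurable]: "space M - ?A \<in> sets M" using subalg by (auto simp: subalgebra_def)
  have "(\<integral>\<^sup>+\<omega>. indicator (space M - ?A) \<omega> * indicator G \<omega> \<partial>M)
      = (\<integral>\<^sup>+\<omega>. indicator (space M - ?A) \<omega> * nn_cond_exp M F (indicator G) \<omega> \<partial>M)"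
    using C by (intro nn_cond_exp_intg[symmetric]) auto
  also have "\<dots> = (\<integral>\<^sup>+\<omega>. 0 \<partial>M)"
    by (intro nn_integral_cong) (auto simp: essential_hull_def indicator_def)
  finally have "(\<integral>\<^sup>+\<omega>. indicator (space M - ?A) \<omega> * indicator G \<omega> \<partial>M) = 0" by simp
  then have "AE \<omega> in M. indicator (space M - ?A) \<omega> * indicator G \<omega> = (0::ennreal)"
    by (subst (asm) nn_integral_0_iff_AE) auto
  with AE_space show ?thesis by eventually_elim (auto simp: indicator_def split: if_splits)
qed

text \<open>Minimality of the hull: over an event of \<open>F\<close> that misses \<open>G\<close>,
  the conditional probability of \<open>G\<close> integrates to 0, while it is nonzero on the hull.
  Through this lemma \<open>F\<close>-measurable bounds known on \<open>G\<close> reach the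
  hull.\<close>

lemma essential_hull_AE:
  assumes [measurable]: "G \<in> sets M" and U: "U \<in> sets F" and ae: "AE \<omega> in M. \<omega> \<in> G \<longrightarrow> \<omega> \<notin> U"
  shows "AE \<omega> in M. \<omega> \<in> essential_hull M F G \<longrightarrow> \<omega> \<notin> U"
proof -
  have UM[measurable]: "U \<in> sets M" using U subalg by (auto simp: subalgebra_def)
  have "(\<integral>\<^sup>+\<omega>. indicator U \<omega> * nn_cond_exp M F (indicator G) \<omega> \<partial>M) = (\<integral>\<^sup>+\<omega>. indicator U \<omega> * indicator G \<omega> \<partial>M)"
    using U by (intro nn_cond_exp_intg) auto
  also have "\<dots> = (\<integral>\<^sup>+\<omega>. 0 \<partial>M)"
    using ae by (intro nn_integral_cong_AE) (auto simp: indicator_def)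
  finally have "(\<integral>\<^sup>+\<omega>. indicator U \<omega> * nn_cond_exp M F (indicator G) \<omega> \<partial>M) = 0" by simp
  then have "AE \<omega> in M. indicator U \<omega> * nn_cond_exp M F (indicator G) \<omega> = 0"
    by (subst (asm) nn_integral_0_iff_AE) auto
  then show ?thesis by eventually_elim (auto simp: essential_hull_def indicator_def)
qed

text \<open>The event where the conditional expectation exceeds \<open>q\<close> lies in
  \<open>F\<close> and misses \<open>G\<close>, so it misses the hull, which carries
  \<open>f\<close>.\<close>

lemma nn_integral_le_on_hull:
  assumes G: "G \<in> sets M" and [measurable]: "Z \<in> borel_measurable M" "f \<in> borel_measurable F"
    and supp: "\<And>\<omega>. \<omega> \<in> space M \<Longrightarrow> \<omega> \<notin> essential_hull M F G \<Longrightarrow> f \<omega> = 0"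
    and le: "AE \<omega> in M. \<omega> \<in> G \<longrightarrow> nn_cond_exp M F Z \<omega> \<le> q"
  shows "(\<integral>\<^sup>+\<omega>. f \<omega> * Z \<omega> \<partial>M) \<le> q * (\<integral>\<^sup>+\<omega>. f \<omega> \<partial>M)"
proof -
  have [measurable]: "f \<in> borel_measurable M" by (rule measurable_from_subalg[OF subalg]) measurable
  let ?U = "{\<omega> \<in> space F. q < nn_cond_exp M F Z \<omega>}"
  have U: "?U \<in> sets F" by measurable
  have "AE \<omega> in M. \<omega> \<in> G \<longrightarrow> \<omega> \<notin> ?U" using le by eventually_elim (auto simp: not_less)
  from essential_hull_AE[OF G U this] AE_space
  have ae: "AE \<omega> in M. f \<omega> * nn_cond_exp M F Z \<omega> \<le> q * f \<omega>"
  proof eventually_elim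
    case (elim \<omega>)
    show ?case
    proof (cases "\<omega> \<in> essential_hull M F G")
      case True
      then have "nn_cond_exp M F Z \<omega> \<le> q" using elim subalg by (auto simp: not_less subalgebra_def)
      then show ?thesis by (subst mult.commute) (rule mult_right_mono, auto)
    qed (use supp elim in simp)
  qed
  have "(\<integral>\<^sup>+\<omega>. f \<omega> * Z \<omega> \<partial>M) = (\<integral>\<^sup>+\<omega>. f \<omega> * nn_cond_exp M F Z \<omega> \<partial>M)"
    by (rule nn_cond_exp_intg[symmetric]) measurable
  also have "\<dots> \<le> (\<integral>\<^sup>+\<omega>. q * f \<omega> \<partial>M)" using ae by (rule nn_integral_mono_AE)
  also have "\<dots> = q * (\<integral>\<^sup>+\<omega>. f \<omega> \<partial>M)" by (rule nn_integral_cmult) measurable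
  finally show ?thesis .
qed

end

text \<open>On \<open>G\<close> the random constants are replaced by the single number
  \<open>q\<close>. The lower bound stops before time 1 because the hypothesis speaks of t only
  together with a later time t + h <= 1.\<close>

locale ito_local = filtered_brownian M F B
  for M :: "'a measure" and F B +
  fixes a b X :: "real \<Rightarrow> 'a \<Rightarrow> real" and G :: "'a set" and q h0 :: real
  assumes ito: "ito_process M F B a b X"
    and G[measurable]: "G \<in> events" and q: "q > 0" and h0: "h0 > 0"
    and a_lower: "\<And>t. 0 \<le> t \<Longrightarrow> t < 1 \<Longrightarrow> AE \<omega> in M. \<omega> \<in> G \<longrightarrow> 1 / q \<le> \<bar>a t \<omega>\<bar>"
    and b_upper: "\<And>t s. 0 \<le> t \<Longrightarrow> t < s \<Longrightarrow> s \<le> 1 \<Longrightarrow> s < t + h0 \<Longrightarrow>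
      AE \<omega> in M. \<omega> \<in> G \<longrightarrow> cond_exp_at M F t (\<lambda>\<omega>. (b s \<omega>)\<^sup>2) \<omega> \<le> ennreal q"
    and a_upper: "\<And>t s. 0 \<le> t \<Longrightarrow> t < s \<Longrightarrow> s \<le> 1 \<Longrightarrow> s < t + h0 \<Longrightarrow>
      AE \<omega> in M. \<omega> \<in> G \<longrightarrow> cond_exp_at M F t (\<lambda>\<omega>. (a s \<omega> - a t \<omega>)\<^sup>2) \<omega> \<le> ennreal (q * (s - t))"
begin

abbreviation "G_hull t \<equiv> essential_hull M (F t) G"

lemma a_measurable_F: "0 \<le> t \<Longrightarrow> t \<le> 1 \<Longrightarrow> a t \<in> borel_measurable (F t)"
  using ito by (auto simp: ito_process_def ito_integrand_def adapted_def)

lemma b_measurable_F: "0 \<le> t \<Longrightarrow> t \<le> 1 \<Longrightarrow> b t \<in> borel_measurable (F t)"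
  using ito by (auto simp: ito_process_def adapted_def)

lemma a_process: "measurable_process M a" and b_process: "measurable_process M b"
  using ito by (auto simp: ito_process_def ito_integrand_def)

lemma sigma_finite_F: "0 \<le> t \<Longrightarrow> t \<le> 1 \<Longrightarrow> sigma_finite_subalgebra M (F t)"
  by (intro finite_measure_subalgebra_is_sigma_finite finite_measure_subalgebra.intro)
    (auto simp: finite_measure_subalgebra_axioms_def subalgebra_F finite_measure_axioms)

lemma hull_sets: "0 \<le> t \<Longrightarrow> t \<le> 1 \<Longrightarrow> G_hull t \<in> sets (F t)"
  using sigma_finite_subalgebra.essential_hull_sets sigma_finite_F by blast

lemma hull_superset: "0 \<le> t \<Longrightarrow> t \<le> 1 \<Longrightarrow> AE \<omega> in M. \<omega> \<in> G \<longrightarrow> \<omega> \<in> G_hull t"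
  using sigma_finite_subalgebra.essential_hull_superset[OF sigma_finite_F G] by blast

text \<open>Adaptedness of \<open>a\<close> makes the failure of the bound an event of
  \<open>F t\<close>, so minimality of the hull applies.\<close>

lemma a_lower_hull:
  assumes t: "0 \<le> t" "t < 1"
  shows "AE \<omega> in M. \<omega> \<in> G_hull t \<longrightarrow> 1 / q \<le> \<bar>a t \<omega>\<bar>"
proof -
  interpret S: sigma_finite_subalgebra M "F t" using t by (intro sigma_finite_F) auto
  have [measurable]: "a t \<in> borel_measurable (F t)" using t by (intro a_measurable_F) auto
  have sp: "space (F t) = space M" using subalgebra_F[of t] t by (auto simp: subalgebra_def)
  have U: "{\<omega> \<in> space (F t). \<bar>a t \<omega>\<bar> < 1 / q} \<in> sets (F t)" by measurable
  have "AE \<omega> in M. \<omega> \<in> G \<longrightarrow> \<omega> \<notin> {\<omega> \<in> space (F t). \<bar>a t \<omega>\<bar> < 1 / q}"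
    using a_lower[OF t] by eventually_elim auto
  from S.essential_hull_AE[OF G U this] AE_space show ?thesis
    by eventually_elim (auto simp: sp not_less)
qed

text \<open>The squared weight is known at time t and carried by the hull, so a conditional bound
  known only on \<open>G\<close> can be integrated against it.\<close>

lemma weighted_bound:
  assumes t: "0 \<le> t" "t \<le> 1" and w: "w \<in> borel_measurable (F t)"
    and supp: "\<And>\<omega>. \<omega> \<in> space M \<Longrightarrow> \<omega> \<notin> G_hull t \<Longrightarrow> w \<omega> = 0"
    and Z[measurable]: "Z \<in> borel_measurable M"
    and le: "AE \<omega> in M. \<omega> \<in> G \<longrightarrow> cond_exp_at M F t (\<lambda>\<omega>. (Z \<omega>)\<^sup>2) \<omega> \<le> ennreal c"
  shows "(\<integral>\<^sup>+\<omega>. ennreal ((w \<omega> * Z \<omega>)\<^sup>2) \<partial>M) \<le> ennreal c * (\<integral>\<^sup>+\<omega>. ennreal ((w \<omega>)\<^sup>2) \<partial>M)"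
proof -
  interpret S: sigma_finite_subalgebra M "F t" using t by (intro sigma_finite_F) auto
  have "(\<integral>\<^sup>+\<omega>. ennreal ((w \<omega> * Z \<omega>)\<^sup>2) \<partial>M) = (\<integral>\<^sup>+\<omega>. ennreal ((w \<omega>)\<^sup>2) * ennreal ((Z \<omega>)\<^sup>2) \<partial>M)"
    by (simp add: power_mult_distrib ennreal_mult)
  also have "\<dots> \<le> ennreal c * (\<integral>\<^sup>+\<omega>. ennreal ((w \<omega>)\<^sup>2) \<partial>M)"
    using w supp le by (intro S.nn_integral_le_on_hull[OF G]) (auto simp: cond_exp_at_def)
  finally show ?thesis .
qed

lemma time_integral_bound:
  assumes tu: "0 \<le> t" "t < u" "u \<le> 1" and Y: "(\<lambda>p. Y (fst p) (snd p)) \<in> borel_measurable (borel \<Otimes>\<^sub>M M)"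
    and le: "\<And>s. t < s \<Longrightarrow> s \<le> u \<Longrightarrow> (\<integral>\<^sup>+\<omega>. ennreal ((Y s \<omega>)\<^sup>2) \<partial>M) \<le> C"
  shows "(\<integral>\<^sup>+\<omega>. \<integral>\<^sup>+s. ennreal ((Y s \<omega>)\<^sup>2) * indicator {t..u} s \<partial>lborel \<partial>M) \<le> ennreal (u - t) * C"
proof -
  interpret P: pair_sigma_finite lborel M ..
  have [measurable]: "(\<lambda>(s, \<omega>). Y s \<omega>) \<in> borel_measurable (lborel \<Otimes>\<^sub>M M)"
    using Y by (simp add: case_prod_beta)
  have "(\<integral>\<^sup>+\<omega>. \<integral>\<^sup>+s. ennreal ((Y s \<omega>)\<^sup>2) * indicator {t..u} s \<partial>lborel \<partial>M)
      = (\<integral>\<^sup>+s. \<integral>\<^sup>+\<omega>. ennreal ((Y s \<omega>)\<^sup>2) * indicator {t..u} s \<partial>M \<partial>lborel)"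
    by (rule P.Fubini') measurable
  also have "\<dots> \<le> (\<integral>\<^sup>+s. C * indicator {t..u} s \<partial>lborel)"
  proof (rule nn_integral_mono_AE)
    \<comment> \<open>The bound is available for s > t only; the single point s = t is
      negligible.\<close>
    have "AE s in lborel. s \<noteq> t" by (rule AE_lborel_singleton)
    then show "AE s in lborel. (\<integral>\<^sup>+\<omega>. ennreal ((Y s \<omega>)\<^sup>2) * indicator {t..u} s \<partial>M) \<le> C * indicator {t..u} s"
      by eventually_elim (auto simp: indicator_def intro!: le)
  qed
  also have "\<dots> = ennreal (u - t) * C" using tu by (simp add: nn_integral_cmult mult.commute)
  finally show ?thesis .
qed

lemma process_increment:
  assumes tu: "0 \<le> t" "t \<le> u" "u \<le> 1" and I: "AE \<omega> in M. \<forall>t\<in>{0..1}. X t \<omega> = X 0 \<omega> + I t \<omega> + (LBINT s:{0..t}. b s \<omega>)"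
  shows "AE \<omega> in M. X u \<omega> - X t \<omega> = (I u \<omega> - I t \<omega>) + (LBINT s:{t..u}. b (unit_clip s) \<omega>) \<and>
    set_integrable lborel {t..u} (\<lambda>s. b (unit_clip s) \<omega>)"
proof -
  have bi: "AE \<omega> in M. set_integrable lborel {0..1} (\<lambda>s. b s \<omega>)" using ito by (auto simp: ito_process_def)
  show ?thesis
    using bi I
  proof eventually_elim
    case (elim \<omega>)
    have i1: "set_integrable lborel {0..t} (\<lambda>s. b s \<omega>)" "set_integrable lborel {t..u} (\<lambda>s. b s \<omega>)"
      using tu by (auto intro: set_integrable_subset[OF elim(1)])
    have "{0..u} = {0..t} \<union> {t..u}" using tu by auto
    then have "(LBINT s:{0..u}. b s \<omega>) = (LBINT s:{0..t}\<union>{t..u}. b s \<omega>)" by simp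
    also have "\<dots> = (LBINT s:{0..t}. b s \<omega>) + (LBINT s:{t..u}. b s \<omega>)"
    proof (rule set_integral_Un_AE)
      have "AE s in lborel. s \<noteq> t" by (rule AE_lborel_singleton)
      then show "AE s in lborel. \<not> (s \<in> {0..t} \<and> s \<in> {t..u})" by eventually_elim auto
    qed (use i1 in auto)
    also have "(LBINT s:{t..u}. b s \<omega>) = (LBINT s:{t..u}. b (unit_clip s) \<omega>)"
      using tu by (intro set_lebesgue_integral_cong) (auto simp: unit_clip_id)
    finally have "(LBINT s:{0..u}. b s \<omega>) = (LBINT s:{0..t}. b s \<omega>) + (LBINT s:{t..u}. b (unit_clip s) \<omega>)" .
    moreover have "X u \<omega> = X 0 \<omega> + I u \<omega> + (LBINT s:{0..u}. b s \<omega>)" "X t \<omega> = X 0 \<omega> + I t \<omega> + (LBINT s:{0..t}. b s \<omega>)"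
      by (rule bspec[OF elim(2)], use tu in simp)+
    moreover have "set_integrable lborel {t..u} (\<lambda>s. b (unit_clip s) \<omega>)"
    proof -
      have eq: "indicator {t..u} s *\<^sub>R b (unit_clip s) \<omega> = indicator {t..u} s *\<^sub>R b s \<omega>" for s
        using tu by (auto simp: indicator_def unit_clip_id)
      show ?thesis using i1(2) unfolding set_integrable_def eq .
    qed
    ultimately show ?case by (intro conjI) linarith+
  qed
qed

text \<open>Both errors have weighted second moment of order (u - t)^2: for the Ito part, the
  squared increments of \<open>a\<close> are of order u - t and are integrated over time; for the
  drift, Cauchy-Schwarz supplies a second interval length. The constant 18 is 2 * 8 + 2 * 1, with
  the 8 of \<open>ito_increment_bound\<close> and a 2 from splitting the sum.\<close>

lemma increment_error_bound:
  assumes tu: "0 \<le> t" "t < u" "u \<le> 1" "u < t + h0" and w: "w \<in> borel_measurable (F t)"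
    and supp: "\<And>\<omega>. \<omega> \<in> space M \<Longrightarrow> \<omega> \<notin> G_hull t \<Longrightarrow> w \<omega> = 0" and wb: "\<And>\<omega>. \<bar>w \<omega>\<bar> \<le> W"
  shows "(\<integral>\<^sup>+\<omega>. ennreal ((w \<omega> * (X u \<omega> - X t \<omega> - a t \<omega> * (B u \<omega> - B t \<omega>)))\<^sup>2) \<partial>M)
    \<le> ennreal (18 * q * (u - t)\<^sup>2) * (\<integral>\<^sup>+\<omega>. ennreal ((w \<omega>)\<^sup>2) \<partial>M)"
proof -
  obtain I where I: "has_ito_integral M F B a I"
    and X: "AE \<omega> in M. \<forall>t\<in>{0..1}. X t \<omega> = X 0 \<omega> + I t \<omega> + (LBINT s:{0..t}. b s \<omega>)"
    using ito by (auto simp: ito_process_def)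
  define A where "A = (\<integral>\<^sup>+\<omega>. ennreal ((w \<omega>)\<^sup>2) \<partial>M)"
  have [measurable]: "w \<in> borel_measurable M" using tu by (intro measurable_F[OF w]) auto
  have at: "a t \<in> borel_measurable (F t)" using tu by (intro a_measurable_F) auto
  have [measurable]: "a t \<in> borel_measurable M" using tu by (intro measurable_F[OF at]) auto
  have [measurable]: "B u \<in> borel_measurable M" "B t \<in> borel_measurable M" using tu by (auto intro: B_measurable)
  have [measurable]: "I s \<in> borel_measurable M" if "0 \<le> s" "s \<le> 1" for s
    using I that by (auto simp: has_ito_integral_def tendsto_in_prob_def)
  then have [measurable]: "I u \<in> borel_measurable M" "I t \<in> borel_measurable M" using tu by auto
  have [measurable]: "(\<lambda>p. a (unit_clip (fst p)) (snd p)) \<in> borel_measurable (borel \<Otimes>\<^sub>M M)"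
    "(\<lambda>p. b (unit_clip (fst p)) (snd p)) \<in> borel_measurable (borel \<Otimes>\<^sub>M M)"
    by (auto intro: measurable_process_clip a_process b_process)
  have [measurable]: "(\<lambda>p. b (unit_clip (snd p)) (fst p)) \<in> borel_measurable (M \<Otimes>\<^sub>M borel)"
    using measurable_compose[OF measurable_pair_swap' measurable_process_clip[OF b_process]]
    by (simp add: case_prod_beta)
  have sM: "a s \<in> borel_measurable M" "b s \<in> borel_measurable M" if "0 \<le> s" "s \<le> 1" for s
    using that measurable_F[OF a_measurable_F] measurable_F[OF b_measurable_F] by auto
  have "ennreal (u - t) * ennreal q = ennreal (q * (u - t))"
    using tu q by (subst ennreal_mult[symmetric]) (auto simp: mult.commute)
  then have h1: "ennreal (u - t) * (ennreal q * A) = ennreal (q * (u - t)) * A"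
    by (simp only: mult.assoc[symmetric])
  have "ennreal (u - t) * ennreal (q * (u - t)) = ennreal (q * (u - t)\<^sup>2)"
    using tu q by (subst ennreal_mult[symmetric]) (auto simp: power2_eq_square mult_ac)
  then have h2: "ennreal (u - t) * (ennreal (q * (u - t)) * A) = ennreal (q * (u - t)\<^sup>2) * A"
    by (simp only: mult.assoc[symmetric])
  let ?J = "\<lambda>\<omega>. w \<omega> * (I u \<omega> - I t \<omega> - a t \<omega> * (B u \<omega> - B t \<omega>))"
  let ?R = "\<lambda>\<omega>. \<integral>\<^sup>+s. ennreal ((w \<omega> * b (unit_clip s) \<omega>)\<^sup>2) * indicator {t..u} s \<partial>lborel"
  have "(\<integral>\<^sup>+\<omega>. \<integral>\<^sup>+s. ennreal ((w \<omega> * (a (unit_clip s) \<omega> - a t \<omega>))\<^sup>2) * indicator {t..u} s \<partial>lborel \<partial>M)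
      \<le> ennreal (u - t) * (ennreal (q * (u - t)) * A)"
  proof (rule time_integral_bound)
    fix s assume s: "t < s" "s \<le> u"
    then have c: "unit_clip s = s" using tu by (intro unit_clip_id) auto
    have [measurable]: "a s \<in> borel_measurable M" using s tu by (intro sM) auto
    have "(\<integral>\<^sup>+\<omega>. ennreal ((w \<omega> * (a (unit_clip s) \<omega> - a t \<omega>))\<^sup>2) \<partial>M) \<le> ennreal (q * (s - t)) * A"
      unfolding A_def c by (rule weighted_bound[of t]) (use tu s w supp a_upper[of t s] in auto)
    also have "\<dots> \<le> ennreal (q * (u - t)) * A"
      using s q by (intro mult_right_mono ennreal_leI mult_left_mono) auto
    finally show "(\<integral>\<^sup>+\<omega>. ennreal ((w \<omega> * (a (unit_clip s) \<omega> - a t \<omega>))\<^sup>2) \<partial>M) \<le> \<dots>" .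
  qed (use tu in auto)
  also have "\<dots> = ennreal (q * (u - t)\<^sup>2) * A"
    by (rule h2)
  finally have a_part: "(\<integral>\<^sup>+\<omega>. ennreal ((?J \<omega>)\<^sup>2) \<partial>M) \<le> 8 * (ennreal (q * (u - t)\<^sup>2) * A)"
    using ito_increment_bound[OF I _ _ _ w wb at, of u] tu by (meson less_imp_le mult_left_mono order_trans zero_le)
  have "(\<integral>\<^sup>+\<omega>. ?R \<omega> \<partial>M) \<le> ennreal (u - t) * (ennreal q * A)"
  proof (rule time_integral_bound)
    fix s assume s: "t < s" "s \<le> u"
    then have c: "unit_clip s = s" using tu by (intro unit_clip_id) auto
    have [measurable]: "b s \<in> borel_measurable M" using s tu by (intro sM) auto
    show "(\<integral>\<^sup>+\<omega>. ennreal ((w \<omega> * b (unit_clip s) \<omega>)\<^sup>2) \<partial>M) \<le> ennreal q * A"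
      unfolding A_def c by (rule weighted_bound[of t]) (use tu s w supp b_upper[of t s] in auto)
  qed (use tu in auto)
  then have "ennreal (u - t) * (\<integral>\<^sup>+\<omega>. ?R \<omega> \<partial>M) \<le> ennreal (u - t) * (ennreal (u - t) * (ennreal q * A))"
    by (rule mult_left_mono) simp
  also have "\<dots> = ennreal (q * (u - t)\<^sup>2) * A"
    unfolding h1 by (rule h2)
  finally have b_part: "ennreal (u - t) * (\<integral>\<^sup>+\<omega>. ?R \<omega> \<partial>M) \<le> ennreal (q * (u - t)\<^sup>2) * A" .
  have "(\<integral>\<^sup>+\<omega>. ennreal ((w \<omega> * (X u \<omega> - X t \<omega> - a t \<omega> * (B u \<omega> - B t \<omega>)))\<^sup>2) \<partial>M)
    \<le> (\<integral>\<^sup>+\<omega>. 2 * ennreal ((?J \<omega>)\<^sup>2) + 2 * (ennreal (u - t) * ?R \<omega>) \<partial>M)"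
  proof (rule nn_integral_mono_AE)
    show "AE \<omega> in M. ennreal ((w \<omega> * (X u \<omega> - X t \<omega> - a t \<omega> * (B u \<omega> - B t \<omega>)))\<^sup>2)
        \<le> 2 * ennreal ((?J \<omega>)\<^sup>2) + 2 * (ennreal (u - t) * ?R \<omega>)"
      using process_increment[OF tu(1) less_imp_le[OF tu(2)] tu(3) X] AE_space
    proof eventually_elim
      case (elim \<omega>)
      have [measurable]: "(\<lambda>s. b (unit_clip s) \<omega>) \<in> borel_measurable borel"
        using measurable_compose[OF measurable_Pair2'[OF elim(2)] measurable_process_clip[OF b_process]] by simp
      define y where "y = w \<omega> * (LBINT s:{t..u}. b (unit_clip s) \<omega>)"
      have e: "w \<omega> * (X u \<omega> - X t \<omega> - a t \<omega> * (B u \<omega> - B t \<omega>)) = ?J \<omega> + y"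
        unfolding y_def conjunct1[OF elim(1)] by (simp add: algebra_simps)
      have "(?J \<omega> + y)\<^sup>2 + (?J \<omega> - y)\<^sup>2 = 2 * (?J \<omega>)\<^sup>2 + 2 * y\<^sup>2" by (simp add: power2_sum power2_diff)
      then have "(?J \<omega> + y)\<^sup>2 \<le> 2 * (?J \<omega>)\<^sup>2 + 2 * y\<^sup>2" using zero_le_power2[of "?J \<omega> - y"] by linarith
      then have "ennreal ((?J \<omega> + y)\<^sup>2) \<le> ennreal (2 * (?J \<omega>)\<^sup>2 + 2 * y\<^sup>2)" by (rule ennreal_leI)
      also have "\<dots> = 2 * ennreal ((?J \<omega>)\<^sup>2) + 2 * ennreal (y\<^sup>2)" by (simp add: ennreal_mult)
      also have "ennreal (y\<^sup>2) \<le> ennreal (u - t) * ?R \<omega>"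
      proof -
        have "ennreal (y\<^sup>2) = ennreal ((w \<omega>)\<^sup>2) * ennreal ((LBINT s:{t..u}. b (unit_clip s) \<omega>)\<^sup>2)"
          by (simp add: y_def power_mult_distrib ennreal_mult)
        also have "\<dots> \<le> ennreal ((w \<omega>)\<^sup>2) * (ennreal (u - t) * (\<integral>\<^sup>+s. ennreal ((b (unit_clip s) \<omega>)\<^sup>2) * indicator {t..u} s \<partial>lborel))"
          using elim tu by (intro mult_left_mono set_integral_power2_le) auto
        also have "\<dots> = ennreal (u - t) * (ennreal ((w \<omega>)\<^sup>2) * (\<integral>\<^sup>+s. ennreal ((b (unit_clip s) \<omega>)\<^sup>2) * indicator {t..u} s \<partial>lborel))"
          by (simp add: mult_ac)
        also have "ennreal ((w \<omega>)\<^sup>2) * (\<integral>\<^sup>+s. ennreal ((b (unit_clip s) \<omega>)\<^sup>2) * indicator {t..u} s \<partial>lborel) = ?R \<omega>"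
          by (subst nn_integral_cmult[symmetric]) (auto simp: power_mult_distrib ennreal_mult mult.assoc)
        finally show ?thesis .
      qed
      finally show ?case unfolding e by (simp add: add_left_mono mult_left_mono)
    qed
  qed
  also have "\<dots> = 2 * (\<integral>\<^sup>+\<omega>. ennreal ((?J \<omega>)\<^sup>2) \<partial>M) + 2 * (ennreal (u - t) * (\<integral>\<^sup>+\<omega>. ?R \<omega> \<partial>M))"
    by (simp add: nn_integral_add nn_integral_cmult)
  also have "\<dots> \<le> 2 * (8 * (ennreal (q * (u - t)\<^sup>2) * A)) + 2 * (ennreal (q * (u - t)\<^sup>2) * A)"
    using a_part b_part by (intro add_mono mult_left_mono) auto
  also have "\<dots> = 18 * (ennreal (q * (u - t)\<^sup>2) * A)"
    by (simp add: mult.assoc[symmetric] distrib_right[symmetric])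
  also have "\<dots> = ennreal (18 * q * (u - t)\<^sup>2) * A"
    using q by (simp add: mult.assoc ennreal_mult)
  finally show ?thesis unfolding A_def .
qed

end

section \<open>Adapted versions\<close>

text \<open>Without completeness the limit itself need not be measurable for \<open>F\<close>.
  Convergence of min 1 |Y n - Z| in mean gives an almost surely convergent subsequence, whose
  pointwise limit is the required version.\<close>

lemma tendsto_in_prob_subalgebra:
  assumes "prob_space M" and sub: "subalgebra M F" and Y: "tendsto_in_prob M Y Z"
    and YF: "\<And>n. Y n \<in> borel_measurable F"
  shows "\<exists>Z'\<in>borel_measurable F. AE \<omega> in M. Z \<omega> = Z' \<omega>"
proof -
  interpret prob_space M by fact
  have [measurable]: "Y n \<in> borel_measurable M" "Z \<in> borel_measurable M" for n
    using Y by (auto simp: tendsto_in_prob_def)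
  define u where "u = (\<lambda>n \<omega>. min 1 \<bar>Y n \<omega> - Z \<omega>\<bar>)"
  have iu: "integrable M (u n)" for n
    by (rule integrable_bdd[of _ 1]) (auto simp: u_def)
  have cont: "isCont (\<lambda>y::real. min 1 \<bar>y\<bar>) 0"
    unfolding isCont_def by (intro tendsto_min tendsto_intros)
  have "(\<lambda>n. \<integral>\<^sup>+\<omega>. ennreal (u n \<omega>) \<partial>M) \<longlonglongrightarrow> 0"
    unfolding u_def using in_prob_nn_integral_tendsto[OF prob_space_axioms Y, of "\<lambda>y. min 1 \<bar>y\<bar>" 1] cont by simp
  moreover have "(\<integral>\<^sup>+\<omega>. ennreal (u n \<omega>) \<partial>M) = ennreal (\<integral>\<omega>. norm (u n \<omega>) \<partial>M)" for n
    using iu[of n] by (subst nn_integral_eq_integral) (auto simp: u_def)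
  ultimately have "(\<lambda>n. ennreal (\<integral>\<omega>. norm (u n \<omega>) \<partial>M)) \<longlonglongrightarrow> ennreal 0" by simp
  then have "(\<lambda>n. \<integral>\<omega>. norm (u n \<omega>) \<partial>M) \<longlonglongrightarrow> 0"
    by (subst (asm) tendsto_ennreal_iff) auto
  from tendsto_L1_AE_subseq[OF iu this]
  obtain r where r: "AE \<omega> in M. (\<lambda>n. u (r n) \<omega>) \<longlonglongrightarrow> 0" by auto
  show ?thesis
  proof (intro bexI)
    show "(\<lambda>\<omega>. lim (\<lambda>n. Y (r n) \<omega>)) \<in> borel_measurable F"
      using YF by (rule borel_measurable_lim_metric)
    show "AE \<omega> in M. Z \<omega> = lim (\<lambda>n. Y (r n) \<omega>)"
      using r
    proof eventually_elim
      case (elim \<omega>)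
      have "eventually (\<lambda>n. u (r n) \<omega> < 1) sequentially" using elim by (rule order_tendstoD) simp
      then have "eventually (\<lambda>n. u (r n) \<omega> = \<bar>Y (r n) \<omega> - Z \<omega>\<bar>) sequentially"
        by eventually_elim (auto simp: u_def min_def split: if_splits)
      then have "(\<lambda>n. \<bar>Y (r n) \<omega> - Z \<omega>\<bar>) \<longlonglongrightarrow> 0"
        using elim by (rule Lim_transform_eventually[rotated])
      then have "(\<lambda>n. Y (r n) \<omega> - Z \<omega>) \<longlonglongrightarrow> 0" by (rule tendsto_rabs_zero_cancel)
      then have "(\<lambda>n. Y (r n) \<omega>) \<longlonglongrightarrow> Z \<omega>" by (simp add: LIM_zero_iff)
      then show ?case by (simp add: limI)
    qed
  qed
qed

text \<open>With \<open>J = \<integral>\<^sub>0\<^sup>t Y\<^sub>s ds\<close> and \<open>K = E[J | F]\<close>, both \<open>E[(J - K) K]\<close> and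
  \<open>E[(J - K) J] = \<integral>\<^sub>0\<^sup>t E[(J - K) Y\<^sub>s] ds\<close> vanish, so \<open>J = K\<close>. This avoids progressive measurability.\<close>

lemma bounded_time_integral_subalgebra:
  fixes Y :: "real \<Rightarrow> 'a \<Rightarrow> real"
  assumes "prob_space M" and sub: "subalgebra M F" and t: "0 \<le> t" "t \<le> 1"
    and Y: "(\<lambda>p. Y (fst p) (snd p)) \<in> borel_measurable (borel \<Otimes>\<^sub>M M)"
    and YF: "\<And>s. 0 \<le> s \<Longrightarrow> s \<le> t \<Longrightarrow> Y s \<in> borel_measurable F" and bd: "\<And>s \<omega>. \<bar>Y s \<omega>\<bar> \<le> N"
  shows "\<exists>Z\<in>borel_measurable F. AE \<omega> in M. (LBINT s:{0..t}. Y s \<omega>) = Z \<omega>"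
proof -
  interpret prob_space M by fact
  interpret finite_measure_subalgebra M F by standard (rule sub)
  interpret P: pair_sigma_finite lborel M ..
  have N: "N \<ge> 0" using bd[of 0 undefined] by linarith
  have Ym[measurable]: "(\<lambda>(s, \<omega>). Y s \<omega>) \<in> borel_measurable (lborel \<Otimes>\<^sub>M M)"
    using Y by (simp add: case_prod_beta)
  have [measurable]: "(\<lambda>p. Y (snd p) (fst p)) \<in> borel_measurable (M \<Otimes>\<^sub>M borel)"
    using measurable_compose[OF measurable_pair_swap' Y] by (simp add: case_prod_beta)
  define J where "J = (\<lambda>\<omega>. LBINT s:{0..t}. Y s \<omega>)"
  have J': "J \<omega> = (\<integral>s. indicator {0..t} s * Y s \<omega> \<partial>lborel)" for \<omega> by (simp add: J_def set_lebesgue_integral_def)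
  have Jm[measurable]: "J \<in> borel_measurable M" unfolding J' by measurable
  have Jb: "\<bar>J \<omega>\<bar> \<le> N" for \<omega>
  proof -
    have "\<bar>J \<omega>\<bar> \<le> (\<integral>s. norm (indicator {0..t} s * Y s \<omega>) \<partial>lborel)"
      unfolding J' using integral_norm_bound[of lborel "\<lambda>s. indicator {0..t} s * Y s \<omega>"] by simp
    also have "\<dots> \<le> (\<integral>s. N * indicator {0..t} s \<partial>lborel)"
    proof (rule integral_mono')
      show "integrable lborel (\<lambda>s. N * indicator {0..t} s)"
        using t by (intro integrable_mult_right integrable_real_indicator) auto
    qed (use bd N in \<open>auto simp: indicator_def\<close>)
    also have "\<dots> = N * t" using t by simp
    also have "\<dots> \<le> N" using N t by (simp add: mult_left_le)
    finally show ?thesis .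
  qed
  have Ji: "integrable M J" by (rule integrable_bdd[OF Jm Jb])
  \<comment> \<open>Clamping changes nothing almost surely, but makes \<open>K\<close> bounded
    everywhere and hence an admissible test function in \<open>orth\<close>.\<close>
  define K where "K = (\<lambda>\<omega>. max (- N) (min N (real_cond_exp M F J \<omega>)))"
  have KF: "K \<in> borel_measurable F" unfolding K_def by measurable
  then have Km[measurable]: "K \<in> borel_measurable M" by (rule measurable_from_subalg[OF sub])
  have "AE \<omega> in M. real_cond_exp M F J \<omega> \<le> N" "AE \<omega> in M. real_cond_exp M F J \<omega> \<ge> - N"
    using Jb by (intro real_cond_exp_le_c Ji real_cond_exp_ge_c AE_I2; simp add: abs_le_iff minus_le_iff)+
  then have KE: "AE \<omega> in M. K \<omega> = real_cond_exp M F J \<omega>"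
    by eventually_elim (auto simp: K_def)
  have Kb: "\<bar>K \<omega>\<bar> \<le> N" for \<omega> using N by (auto simp: K_def)
  have orth: "(\<integral>\<omega>. f \<omega> * (J \<omega> - K \<omega>) \<partial>M) = 0"
    if fF: "f \<in> borel_measurable F" and fb: "\<And>\<omega>. \<bar>f \<omega>\<bar> \<le> N" for f
  proof -
    have [measurable]: "f \<in> borel_measurable M" using fF by (rule measurable_from_subalg[OF sub])
    have i1: "integrable M (\<lambda>\<omega>. f \<omega> * J \<omega>)" and i2: "integrable M (\<lambda>\<omega>. f \<omega> * K \<omega>)"
      using mult_mono[OF fb Jb] mult_mono[OF fb Kb] N
      by (intro integrable_bdd[of _ "N * N"]; simp add: abs_mult)+
    have "(\<integral>\<omega>. f \<omega> * J \<omega> \<partial>M) = (\<integral>\<omega>. f \<omega> * real_cond_exp M F J \<omega> \<partial>M)"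
      by (rule real_cond_exp_intg(2)[OF i1 fF Jm, symmetric])
    also have "\<dots> = (\<integral>\<omega>. f \<omega> * K \<omega> \<partial>M)"
      using KE by (intro integral_cong_AE) auto
    finally show ?thesis using i1 i2 by (simp add: right_diff_distrib)
  qed
  define R where "R = (\<lambda>\<omega>. J \<omega> - K \<omega>)"
  have Rm[measurable]: "R \<in> borel_measurable M" unfolding R_def by measurable
  have Rb: "\<bar>R \<omega>\<bar> \<le> 2 * N" for \<omega> using Jb[of \<omega>] Kb[of \<omega>] by (simp add: R_def)
  \<comment> \<open>Boundedness on a set of finite product measure is what permits the exchange of
    integrals.\<close>
  have pint: "integrable (lborel \<Otimes>\<^sub>M M) (\<lambda>(s, \<omega>). indicator {0..t} s * (Y s \<omega> * R \<omega>))"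
  proof (rule Bochner_Integration.integrable_bound)
    show "integrable (lborel \<Otimes>\<^sub>M M) (\<lambda>p. (N * (2 * N)) * indicator ({0..t} \<times> space M) p)"
      using t by (intro integrable_mult_right integrable_real_indicator)
        (auto simp: emeasure_pair_measure_Times emeasure_space_1)
    show "AE p in lborel \<Otimes>\<^sub>M M. norm (case p of (s, \<omega>) \<Rightarrow> indicator {0..t} s * (Y s \<omega> * R \<omega>))
        \<le> norm ((N * (2 * N)) * indicator ({0..t} \<times> space M) p)"
      using mult_mono[OF bd Rb] N by (intro AE_I2) (auto simp: indicator_def abs_mult space_pair_measure)
  qed measurable
  have "(\<integral>\<omega>. R \<omega> * J \<omega> \<partial>M) = (\<integral>\<omega>. \<integral>s. indicator {0..t} s * (Y s \<omega> * R \<omega>) \<partial>lborel \<partial>M)"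
  proof (intro Bochner_Integration.integral_cong refl)
    fix \<omega>
    have "(\<integral>s. indicator {0..t} s * (Y s \<omega> * R \<omega>) \<partial>lborel) = (\<integral>s. R \<omega> * (indicator {0..t} s * Y s \<omega>) \<partial>lborel)"
      by (intro Bochner_Integration.integral_cong refl) simp
    then show "R \<omega> * J \<omega> = (\<integral>s. indicator {0..t} s * (Y s \<omega> * R \<omega>) \<partial>lborel)" unfolding J' by simp
  qed
  also have "\<dots> = (\<integral>s. \<integral>\<omega>. indicator {0..t} s * (Y s \<omega> * R \<omega>) \<partial>M \<partial>lborel)"
    by (rule P.Fubini_integral[OF pint])
  also have "\<dots> = (\<integral>(s::real). 0 \<partial>lborel)"
  proof (rule Bochner_Integration.integral_cong[OF refl])
    fix s :: real
    show "(\<integral>\<omega>. indicator {0..t} s * (Y s \<omega> * R \<omega>) \<partial>M) = 0"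
      using orth[OF YF bd, of s] by (auto simp: indicator_def R_def)
  qed
  finally have RJ: "(\<integral>\<omega>. R \<omega> * J \<omega> \<partial>M) = 0" by simp
  have RK: "(\<integral>\<omega>. K \<omega> * R \<omega> \<partial>M) = 0" unfolding R_def by (rule orth[OF KF Kb])
  have iR: "integrable M (\<lambda>\<omega>. R \<omega> * J \<omega>)"
    using mult_mono[OF Rb Jb] N by (intro integrable_bdd[of _ "(2 * N) * N"]) (auto simp: abs_mult)
  have iK: "integrable M (\<lambda>\<omega>. K \<omega> * R \<omega>)"
    using mult_mono[OF Kb Rb] N by (intro integrable_bdd[of _ "N * (2 * N)"]) (auto simp: abs_mult)
  have sq: "(R \<omega>)\<^sup>2 = R \<omega> * J \<omega> - K \<omega> * R \<omega>" for \<omega>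
    by (simp add: R_def power2_eq_square algebra_simps)
  have "integrable M (\<lambda>\<omega>. (R \<omega>)\<^sup>2)" "(\<integral>\<omega>. (R \<omega>)\<^sup>2 \<partial>M) = 0"
    unfolding sq using iR iK RJ RK by auto
  then have "AE \<omega> in M. (R \<omega>)\<^sup>2 = 0"
    by (subst (asm) integral_nonneg_eq_0_iff_AE) auto
  then have "AE \<omega> in M. (LBINT s:{0..t}. Y s \<omega>) = K \<omega>"
    by eventually_elim (simp add: R_def J_def)
  then show ?thesis using KF by blast
qed

text \<open>Reduction to bounded integrands: truncate at level n and use dominated convergence, with
  the absolute value of the integrable path as majorant.\<close>

lemma time_integral_subalgebra:
  fixes Y :: "real \<Rightarrow> 'a \<Rightarrow> real"
  assumes M: "prob_space M" and sub: "subalgebra M F" and t: "0 \<le> t" "t \<le> 1"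
    and Y: "(\<lambda>p. Y (fst p) (snd p)) \<in> borel_measurable (borel \<Otimes>\<^sub>M M)"
    and YF: "\<And>s. 0 \<le> s \<Longrightarrow> s \<le> t \<Longrightarrow> Y s \<in> borel_measurable F"
    and int: "AE \<omega> in M. set_integrable lborel {0..t} (\<lambda>s. Y s \<omega>)"
  shows "\<exists>Z\<in>borel_measurable F. AE \<omega> in M. (LBINT s:{0..t}. Y s \<omega>) = Z \<omega>"
proof -
  define T where "T = (\<lambda>(n::nat) s \<omega>. max (- real n) (min (real n) (Y s \<omega>)))"
  have "\<exists>Z\<in>borel_measurable F. AE \<omega> in M. (LBINT s:{0..t}. T n s \<omega>) = Z \<omega>" for n
  proof (rule bounded_time_integral_subalgebra[OF M sub t])
    show "(\<lambda>p. T n (fst p) (snd p)) \<in> borel_measurable (borel \<Otimes>\<^sub>M M)" unfolding T_def using Y by measurable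
    show "T n s \<in> borel_measurable F" if "0 \<le> s" "s \<le> t" for s unfolding T_def using YF[OF that] by measurable
    show "\<bar>T n s \<omega>\<bar> \<le> real n" for s \<omega> by (auto simp: T_def)
  qed
  then obtain Z where ZF: "\<And>n. Z n \<in> borel_measurable F"
    and Z: "\<And>n. AE \<omega> in M. (LBINT s:{0..t}. T n s \<omega>) = Z n \<omega>" by metis
  have allZ: "AE \<omega> in M. \<forall>n. (LBINT s:{0..t}. T n s \<omega>) = Z n \<omega>" using Z by (simp add: AE_all_countable)
  show ?thesis
  proof (intro bexI)
    show "(\<lambda>\<omega>. lim (\<lambda>n. Z n \<omega>)) \<in> borel_measurable F"
      using ZF by (rule borel_measurable_lim_metric)
    show "AE \<omega> in M. (LBINT s:{0..t}. Y s \<omega>) = lim (\<lambda>n. Z n \<omega>)"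
      using allZ int AE_space
    proof eventually_elim
      case (elim \<omega>)
      have [measurable]: "(\<lambda>s. Y s \<omega>) \<in> borel_measurable borel"
        using measurable_compose[OF measurable_Pair2'[OF elim(3)] Y] by simp
      have "(\<lambda>n. \<integral>s. indicator {0..t} s * T n s \<omega> \<partial>lborel) \<longlonglongrightarrow> (\<integral>s. indicator {0..t} s * Y s \<omega> \<partial>lborel)"
      proof (rule integral_dominated_convergence)
        show "integrable lborel (\<lambda>s. norm (indicator {0..t} s * Y s \<omega>))"
          using elim(2) by (intro integrable_norm) (simp add: set_integrable_def)
        show "AE s in lborel. (\<lambda>n. indicator {0..t} s * T n s \<omega>) \<longlonglongrightarrow> indicator {0..t} s * Y s \<omega>"
        proof (rule AE_I2)
          fix s
          have "eventually (\<lambda>n. \<bar>Y s \<omega>\<bar> \<le> real n) sequentially"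
            using filterlim_real_sequentially by (simp add: filterlim_at_top)
          then have "eventually (\<lambda>n. indicator {0..t} s * T n s \<omega> = indicator {0..t} s * Y s \<omega>) sequentially"
            by eventually_elim (auto simp: T_def)
          then show "(\<lambda>n. indicator {0..t} s * T n s \<omega>) \<longlonglongrightarrow> indicator {0..t} s * Y s \<omega>"
            by (rule tendsto_eventually)
        qed
        show "AE s in lborel. norm (indicator {0..t} s * T n s \<omega>) \<le> norm (indicator {0..t} s * Y s \<omega>)" for n
          by (intro AE_I2) (auto simp: T_def indicator_def)
      qed (simp_all add: T_def)
      then have "(\<lambda>n. Z n \<omega>) \<longlonglongrightarrow> (LBINT s:{0..t}. Y s \<omega>)"
        using elim(1) by (simp add: set_lebesgue_integral_def)
      then show ?case by (simp add: limI)
    qed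
  qed
qed

context filtered_brownian
begin

lemma simple_integral_measurable_F:
  assumes "simple_repr M F m \<tau> \<xi>" and t: "0 \<le> t" "t \<le> 1"
  shows "simple_integral B m \<tau> \<xi> t \<in> borel_measurable (F t)"
proof -
  have \<tau>: "0 \<le> \<tau> 0" "\<tau> m \<le> 1" "\<And>i. i < m \<Longrightarrow> \<tau> i \<le> \<tau> (Suc i)" and \<xi>: "\<And>i. i < m \<Longrightarrow> \<xi> i \<in> borel_measurable (F (\<tau> i))"
    using assms(1) by (auto simp: simple_repr_def)
  have pos: "0 \<le> \<tau> k" if "k \<le> m" for k
    using that by (induction k) (use \<tau> in \<open>auto intro: order_trans simp: Suc_le_eq\<close>)
  have "(\<lambda>\<omega>. \<xi> i \<omega> * (B (min (\<tau> (Suc i)) t) \<omega> - B (min (\<tau> i) t) \<omega>)) \<in> borel_measurable (F t)" if i: "i < m" for i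
  proof (cases "\<tau> i \<le> t")
    case True
    have "\<xi> i \<in> borel_measurable (F t)" using True pos[of i] i t by (intro measurable_F_mono[OF \<xi>]) auto
    moreover have "B (min (\<tau> (Suc i)) t) \<in> borel_measurable (F t)" "B (min (\<tau> i) t) \<in> borel_measurable (F t)"
      using pos[of i] pos[of "Suc i"] i t by (auto intro!: B_measurable_F)
    ultimately show ?thesis by measurable
  next
    case False
    \<comment> \<open>The interval begins after t: its coefficient may be unknown at time t, but
      both stopped times equal t and the term is 0.\<close>
    then show ?thesis using \<tau>(3)[OF i] by (simp add: min_def)
  qed
  then show ?thesis unfolding simple_integral_def[abs_def] by (intro borel_measurable_sum) auto
qed

text \<open>By definition only \<open>X 0\<close> is adapted, and the equation for X holds almost
  surely; so X at time t is measurable for \<open>F t\<close> only up to a null set. The stochastic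
  integral and the drift integral receive measurable versions separately.\<close>

lemma ito_process_F_version:
  assumes ito: "ito_process M F B a b X" and t: "0 \<le> t" "t \<le> 1"
  shows "\<exists>X'\<in>borel_measurable (F t). AE \<omega> in M. X t \<omega> = X' \<omega>"
proof -
  have bp: "measurable_process M b" and bF: "adapted F b" and X0: "X 0 \<in> borel_measurable (F 0)"
    and bi: "AE \<omega> in M. set_integrable lborel {0..1} (\<lambda>s. b s \<omega>)"
    using ito by (auto simp: ito_process_def)
  obtain I where I: "has_ito_integral M F B a I"
    and X: "AE \<omega> in M. \<forall>t\<in>{0..1}. X t \<omega> = X 0 \<omega> + I t \<omega> + (LBINT s:{0..t}. b s \<omega>)"
    using ito by (auto simp: ito_process_def)
  obtain m \<tau> \<xi> where repr: "\<And>n. simple_repr M F (m n) (\<tau> n) (\<xi> n)"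
    and "\<forall>t\<in>{0..1}. tendsto_in_prob M (\<lambda>n. simple_integral B (m n) (\<tau> n) (\<xi> n) t) (I t)"
    using I unfolding has_ito_integral_def by blast
  then have lim: "tendsto_in_prob M (\<lambda>n. simple_integral B (m n) (\<tau> n) (\<xi> n) t) (I t)"
    using t by simp
  obtain I' where I': "I' \<in> borel_measurable (F t)" "AE \<omega> in M. I t \<omega> = I' \<omega>"
    using tendsto_in_prob_subalgebra[OF prob_space_axioms subalgebra_F[OF t] lim simple_integral_measurable_F[OF repr t]] by blast
  have "\<exists>J\<in>borel_measurable (F t). AE \<omega> in M. (LBINT s:{0..t}. b (unit_clip s) \<omega>) = J \<omega>"
  proof (rule time_integral_subalgebra[OF prob_space_axioms subalgebra_F[OF t] t measurable_process_clip[OF bp]])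
    show "b (unit_clip s) \<in> borel_measurable (F t)" if "0 \<le> s" "s \<le> t" for s
    proof -
      have "b s \<in> borel_measurable (F s)" using bF that t by (auto simp: adapted_def)
      then have "b s \<in> borel_measurable (F t)" by (rule measurable_F_mono) (use that t in auto)
      then show ?thesis using that t by (simp add: unit_clip_id)
    qed
    show "AE \<omega> in M. set_integrable lborel {0..t} (\<lambda>s. b (unit_clip s) \<omega>)"
      using bi
    proof eventually_elim
      case (elim \<omega>)
      have "set_integrable lborel {0..t} (\<lambda>s. b s \<omega>)" using t by (intro set_integrable_subset[OF elim]) auto
      moreover have eq: "indicator {0..t} s *\<^sub>R b (unit_clip s) \<omega> = indicator {0..t} s *\<^sub>R b s \<omega>" for s
        using t by (auto simp: indicator_def unit_clip_id)
      ultimately show ?case unfolding set_integrable_def eq by blast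
    qed
  qed
  then obtain J where J: "J \<in> borel_measurable (F t)" "AE \<omega> in M. (LBINT s:{0..t}. b (unit_clip s) \<omega>) = J \<omega>" by blast
  have "X 0 \<in> borel_measurable (F t)" using X0 t by (intro measurable_F_mono[OF X0]) auto
  then have "(\<lambda>\<omega>. X 0 \<omega> + I' \<omega> + J \<omega>) \<in> borel_measurable (F t)" using I'(1) J(1) by measurable
  moreover have "AE \<omega> in M. X t \<omega> = X 0 \<omega> + I' \<omega> + J \<omega>"
    using X I'(2) J(2)
  proof eventually_elim
    case (elim \<omega>)
    have "(LBINT s:{0..t}. b s \<omega>) = (LBINT s:{0..t}. b (unit_clip s) \<omega>)"
      using t by (intro set_lebesgue_integral_cong) (auto simp: unit_clip_id)
    moreover have "X t \<omega> = X 0 \<omega> + I t \<omega> + (LBINT s:{0..t}. b s \<omega>)" by (rule bspec[OF elim(1)]) (use t in simp)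
    ultimately show ?case using elim(2,3) by linarith
  qed
  ultimately show ?thesis by (intro bexI[where x = "\<lambda>\<omega>. X 0 \<omega> + I' \<omega> + J \<omega>"])
qed

end

section \<open>The conditional mean of one summand\<close>

text \<open>The grid is described by its start \<open>t\<close> and mesh \<open>h\<close>, so that
  conditional estimates at time t can be stated without n.\<close>

definition incr :: "nat \<Rightarrow> (real \<Rightarrow> real) \<Rightarrow> real \<Rightarrow> real \<Rightarrow> nat \<Rightarrow> real" where
  "incr p x t h j =
     (if p = 1 then x (t + real (j + 1) * h) - x (t + real j * h)
      else x (t + real (j + 2) * h) - 2 * x (t + real (j + 1) * h) + x (t + real j * h))"

definition incr_ratio :: "nat \<Rightarrow> (real \<Rightarrow> real) \<Rightarrow> real \<Rightarrow> real \<Rightarrow> real" where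
  "incr_ratio p x t h = abs_ratio (incr p x t h 0) (incr p x t h 1)"

lemma incr_ratio_bounds: "0 \<le> incr_ratio p x t h" "incr_ratio p x t h \<le> 1"
  by (simp_all add: incr_ratio_def abs_ratio_nonneg abs_ratio_le_1)

lemma gen_incr_eq_incr:
  assumes "p \<in> {1, 2}"
  shows "gen_incr p n x (k + j) = incr p x (real k / real n) (1 / real n) j"
proof -
  have e: "real k / real n + real i * (1 / real n) = real (k + i) / real n" for i
    by (simp add: add_divide_distrib)
  show ?thesis
    using assms
  proof (elim insertE emptyE)
    assume p: "p = 1"
    have "{0..1::nat} = {0, 1}" by auto
    then have "gen_incr p n x (k + j) = x (real (k + (j + 1)) / real n) - x (real (k + j) / real n)"
      unfolding gen_incr_def p by (simp add: add_ac)
    then show ?thesis unfolding incr_def e using p by simp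
  next
    assume p: "p = 2"
    have "{0..2::nat} = {0, 1, 2}" by auto
    then have "gen_incr p n x (k + j) = x (real (k + (j + 2)) / real n) - 2 * x (real (k + (j + 1)) / real n) + x (real (k + j) / real n)"
      unfolding gen_incr_def p by (simp add: add_ac)
    then show ?thesis unfolding incr_def e using p by simp
  qed
qed

lemma IR_lambda_nonneg:
  assumes "-1 < r" "r < 1" shows "0 \<le> IR_lambda r"
proof -
  have "1 \<le> 2 / (1 + r)" using assms by (simp add: field_simps)
  then have "0 \<le> ln (2 / (1 + r))" by simp
  moreover have "0 \<le> arccos (- r)" using assms by (intro arccos_lbound) auto
  moreover have "0 \<le> sqrt ((1 + r) / (1 - r))" using assms by simp
  ultimately show ?thesis unfolding IR_lambda_def by (intro add_nonneg_nonneg mult_nonneg_nonneg) auto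
qed

lemma IR_Lambda_half: "IR_Lambda 1 (1/2) = IR_lambda 0" "IR_Lambda 2 (1/2) = IR_lambda (- 1/2)"
  unfolding IR_Lambda_def IR_rho_half by simp_all

text \<open>The upper bound comes from the Gaussian representation: the constant is a mean of
  ratios, which are at most 1.\<close>

lemma IR_Lambda_half_bounds:
  assumes "p \<in> {1, 2}" shows "0 \<le> IR_Lambda p (1/2)" "IR_Lambda p (1/2) \<le> 1"
proof -
  interpret G: prob_space std_gauss by (rule prob_space_std_gauss)
  have nn: "0 \<le> IR_lambda 0" "0 \<le> IR_lambda (- 1/2)" by (auto intro: IR_lambda_nonneg)
  have 1: "(\<integral>\<^sup>+y. f y \<partial>std_gauss) \<le> 1" if "\<And>y. f y \<le> 1" for f
    using nn_integral_mono[of std_gauss f "\<lambda>_. 1"] that G.emeasure_space_1 by simp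
  have "ennreal (IR_lambda 0) \<le> 1" "ennreal (IR_lambda (- 1/2)) \<le> 1"
    unfolding std_gauss_abs_ratio_indep[symmetric] std_gauss_abs_ratio_second_diff[symmetric]
    by (auto intro!: 1 simp: abs_ratio_le_1)
  then have "IR_lambda 0 \<le> 1" "IR_lambda (- 1/2) \<le> 1" using nn by auto
  then show "0 \<le> IR_Lambda p (1/2)" "IR_Lambda p (1/2) \<le> 1"
    using assms nn IR_Lambda_half by auto
qed

context filtered_brownian
begin

lemma incr_ratio_mean:
  assumes p: "p \<in> {1, 2}" and t: "0 \<le> t" "0 < h" "t + real (p + 1) * h \<le> 1" and Z: "Z \<in> borel_measurable (F t)"
  shows "(\<integral>\<^sup>+\<omega>. ennreal (Z \<omega>) * ennreal (incr_ratio p (\<lambda>t. B t \<omega>) t h) \<partial>M)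
    = ennreal (IR_Lambda p (1/2)) * (\<integral>\<^sup>+\<omega>. ennreal (Z \<omega>) \<partial>M)"
  using p
proof (elim insertE emptyE)
  assume "p = 1"
  then show ?thesis using abs_ratio_increments_mean[of t h Z] t Z by (simp add: incr_def incr_ratio_def IR_Lambda_half(1)[unfolded One_nat_def])
next
  assume p: "p = 2"
  have "B (t + 2 * h) \<omega> - B (t + h) \<omega> - (B (t + h) \<omega> - B t \<omega>) = incr p (\<lambda>t. B t \<omega>) t h 0"
    "B (t + 3 * h) \<omega> - B (t + 2 * h) \<omega> - (B (t + 2 * h) \<omega> - B (t + h) \<omega>) = incr p (\<lambda>t. B t \<omega>) t h 1" for \<omega>
    using p by (simp_all add: incr_def)
  then show ?thesis using abs_ratio_second_increments_mean[of t h Z] t Z p IR_Lambda_half(2) by (simp add: incr_ratio_def)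
qed

text \<open>For p = 2 the conditioning time is t + h: the first second difference is a fresh
  increment minus one already known, which serves as the shift.\<close>

lemma small_incr_bound:
  assumes p: "p \<in> {1, 2}" and t: "0 \<le> t" "0 < h" "t + real (p + 1) * h \<le> 1" and Z: "Z \<in> borel_measurable (F t)"
    and \<eta>: "\<eta> > 0"
  shows "(\<integral>\<^sup>+\<omega>. ennreal (Z \<omega>) * ennreal (2 * \<eta>\<^sup>2 / (\<eta>\<^sup>2 + (incr p (\<lambda>t. B t \<omega>) t h 0)\<^sup>2)) \<partial>M)
    \<le> ennreal (7 * \<eta> / sqrt h) * (\<integral>\<^sup>+\<omega>. ennreal (Z \<omega>) \<partial>M)"
  using p
proof (elim insertE emptyE)
  assume "p = 1"
  then show ?thesis using small_increment_bound[of t "t + h" \<eta> Z "\<lambda>_. 0"] t Z \<eta> by (simp add: incr_def)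
next
  assume p: "p = 2"
  have th: "0 \<le> t + h" "t + h \<le> 1" "t + h < t + 2 * h" "t + 2 * h \<le> 1" using t p by auto
  have "B t \<in> borel_measurable (F (t + h))" "B (t + h) \<in> borel_measurable (F (t + h))"
    using t p by (auto intro!: B_measurable_F)
  then have "(\<lambda>\<omega>. B (t + h) \<omega> - B t \<omega>) \<in> borel_measurable (F (t + h))" by measurable
  moreover have "Z \<in> borel_measurable (F (t + h))" by (rule measurable_F_mono[OF Z]) (use t p in auto)
  moreover have "B (t + 2 * h) \<omega> - B (t + h) \<omega> - (B (t + h) \<omega> - B t \<omega>) = incr p (\<lambda>t. B t \<omega>) t h 0" for \<omega>
    using p by (simp add: incr_def)
  ultimately show ?thesis
    using small_increment_bound[of "t + h" "t + 2 * h" \<eta> Z "\<lambda>\<omega>. B (t + h) \<omega> - B t \<omega>"] th \<eta> by simp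
qed

end

text \<open>The version \<open>X'\<close> is chosen for each time separately, and the exceptional
  null set may depend on the time; only countably many grid times matter in the end.\<close>

locale ito_local_version = ito_local M F B a b X G q h0
  for M :: "'a measure" and F B a b X G q h0 +
  fixes X' :: "real \<Rightarrow> 'a \<Rightarrow> real"
  assumes X'_F: "\<And>t. 0 \<le> t \<Longrightarrow> t \<le> 1 \<Longrightarrow> X' t \<in> borel_measurable (F t)"
    and X'_AE: "\<And>t. 0 \<le> t \<Longrightarrow> t \<le> 1 \<Longrightarrow> AE \<omega> in M. X t \<omega> = X' t \<omega>"
begin

lemma X'_measurable_F: "0 \<le> s \<Longrightarrow> s \<le> t \<Longrightarrow> t \<le> 1 \<Longrightarrow> X' s \<in> borel_measurable (F t)"
  by (rule measurable_F_mono[OF X'_F]) auto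

lemma X'_measurable: "0 \<le> s \<Longrightarrow> s \<le> 1 \<Longrightarrow> X' s \<in> borel_measurable M"
  using measurable_F[OF X'_F] by blast

lemma incr_X'_measurable:
  assumes "p \<in> {1, 2}" "0 \<le> t" "0 \<le> h" "t + real (j + p) * h \<le> u" "u \<le> 1"
  shows "(\<lambda>\<omega>. incr p (\<lambda>t. X' t \<omega>) t h j) \<in> borel_measurable (F u)"
    "(\<lambda>\<omega>. incr p (\<lambda>t. B t \<omega>) t h j) \<in> borel_measurable (F u)"
proof -
  have i: "0 \<le> t + real i * h \<and> t + real i * h \<le> u" if "i \<le> j + p" for i
  proof -
    have "real i * h \<le> real (j + p) * h" using that assms by (intro mult_right_mono) auto
    then show ?thesis using assms by auto
  qed
  have X: "X' (t + real i * h) \<in> borel_measurable (F u)" "B (t + real i * h) \<in> borel_measurable (F u)" if "i \<le> j + p" for i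
    using i[OF that] assms by (auto intro: X'_measurable_F B_measurable_F)
  show "(\<lambda>\<omega>. incr p (\<lambda>t. X' t \<omega>) t h j) \<in> borel_measurable (F u)"
    using assms(1) X(1)[of j] X(1)[of "j + 1"] X(1)[of "j + 2"] unfolding incr_def by auto
  show "(\<lambda>\<omega>. incr p (\<lambda>t. B t \<omega>) t h j) \<in> borel_measurable (F u)"
    using assms(1) X(2)[of j] X(2)[of "j + 1"] X(2)[of "j + 2"] unfolding incr_def by auto
qed

text \<open>All errors are referred to the common base time t: \<open>E j\<close> is the error of
  the increment over [t, t + j h]. Here 162 = 18 * 9, as these intervals have length at most 3 h; 27
  = 9 * 3, from the coefficient 3 and Cauchy-Schwarz for three terms; and 13122 = 27 * 3 *
  162.\<close>

lemma incr_error_bound: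
  assumes p: "p \<in> {1, 2}" and t: "0 \<le> t" "0 < h" "t + real (p + 1) * h \<le> 1" "3 * h < h0"
    and w: "w \<in> borel_measurable (F t)"
    and supp: "\<And>\<omega>. \<omega> \<in> space M \<Longrightarrow> \<omega> \<notin> G_hull t \<Longrightarrow> w \<omega> = 0" and wb: "\<And>\<omega>. \<bar>w \<omega>\<bar> \<le> W"
  defines "e \<equiv> \<lambda>j \<omega>. incr p (\<lambda>t. X' t \<omega>) t h j - a t \<omega> * incr p (\<lambda>t. B t \<omega>) t h j"
  shows "(\<integral>\<^sup>+\<omega>. ennreal ((w \<omega> * (\<bar>e 0 \<omega>\<bar> + \<bar>e 1 \<omega>\<bar>))\<^sup>2) \<partial>M)
    \<le> ennreal (13122 * q * h\<^sup>2) * (\<integral>\<^sup>+\<omega>. ennreal ((w \<omega>)\<^sup>2) \<partial>M)"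
proof -
  define A where "A = (\<integral>\<^sup>+\<omega>. ennreal ((w \<omega>)\<^sup>2) \<partial>M)"
  define E where "E = (\<lambda>j \<omega>. X' (t + real j * h) \<omega> - X' t \<omega> - a t \<omega> * (B (t + real j * h) \<omega> - B t \<omega>))"
  have E0: "E 0 \<omega> = 0" for \<omega> by (simp add: E_def)
  have jh: "t < t + real j * h" "t + real j * h \<le> 1" "t + real j * h < t + h0" "real j * h \<le> 3 * h" if "0 < j" "j \<le> p + 1" for j
  proof -
    have "real j * h \<le> real (p + 1) * h" using that t by (intro mult_right_mono) auto
    moreover have "real (p + 1) * h \<le> 3 * h" using p t by (intro mult_right_mono) auto
    moreover have "0 < real j * h" using that t by simp
    ultimately show "t < t + real j * h" "t + real j * h \<le> 1" "t + real j * h < t + h0" "real j * h \<le> 3 * h"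
      using t by linarith+
  qed
  have tle: "t \<le> 1" using jh(1,2)[of 1] by simp
  have [measurable]: "w \<in> borel_measurable M" "a t \<in> borel_measurable M"
    using measurable_F[OF w] measurable_F[OF a_measurable_F] t tle by auto
  have Em[measurable]: "E j \<in> borel_measurable M" if "0 < j" "j \<le> p + 1" for j
  proof -
    have "X' (t + real j * h) \<in> borel_measurable M" "B (t + real j * h) \<in> borel_measurable M"
      "X' t \<in> borel_measurable M" "B t \<in> borel_measurable M"
      using jh[OF that] t tle by (auto intro!: X'_measurable B_measurable)
    then show ?thesis unfolding E_def by measurable
  qed
  have EB: "(\<integral>\<^sup>+\<omega>. ennreal ((w \<omega> * E j \<omega>)\<^sup>2) \<partial>M) \<le> ennreal (162 * q * h\<^sup>2) * A" if "0 < j" "j \<le> p + 1" for j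
  proof -
    have "AE \<omega> in M. X (t + real j * h) \<omega> = X' (t + real j * h) \<omega>" "AE \<omega> in M. X t \<omega> = X' t \<omega>"
      using jh[OF that] t tle by (auto intro: X'_AE)
    then have "(\<integral>\<^sup>+\<omega>. ennreal ((w \<omega> * E j \<omega>)\<^sup>2) \<partial>M)
      = (\<integral>\<^sup>+\<omega>. ennreal ((w \<omega> * (X (t + real j * h) \<omega> - X t \<omega> - a t \<omega> * (B (t + real j * h) \<omega> - B t \<omega>)))\<^sup>2) \<partial>M)"
      by (intro nn_integral_cong_AE, eventually_elim) (simp add: E_def)
    also have "\<dots> \<le> ennreal (18 * q * (t + real j * h - t)\<^sup>2) * A"
      unfolding A_def by (rule increment_error_bound[OF t(1) jh(1,2,3)[OF that] w supp wb])
    also have "\<dots> \<le> ennreal (162 * q * h\<^sup>2) * A"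
    proof (intro mult_right_mono ennreal_leI)
      have "(real j * h)\<^sup>2 \<le> (3 * h)\<^sup>2" using jh[OF that] t by (intro power_mono) auto
      then show "18 * q * (t + real j * h - t)\<^sup>2 \<le> 162 * q * h\<^sup>2" using q by (simp add: power_mult_distrib mult.commute)
    qed simp
    finally show ?thesis .
  qed
  \<comment> \<open>For p = 1 the indices p + 1 and 2 coincide; repeating the term lets one formula
    serve both orders.\<close>
  have S: "(\<bar>e 0 \<omega>\<bar> + \<bar>e 1 \<omega>\<bar>)\<^sup>2 \<le> 27 * ((E 1 \<omega>)\<^sup>2 + (E 2 \<omega>)\<^sup>2 + (E (p + 1) \<omega>)\<^sup>2)" for \<omega>
  proof -
    have "\<bar>e 0 \<omega>\<bar> + \<bar>e 1 \<omega>\<bar> \<le> 3 * (\<bar>E 1 \<omega>\<bar> + \<bar>E 2 \<omega>\<bar> + \<bar>E (p + 1) \<omega>\<bar>)"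
      using p
    proof (elim insertE emptyE)
      assume p1: "p = 1"
      have "e 0 \<omega> = E 1 \<omega>" "e 1 \<omega> = E 2 \<omega> - E 1 \<omega>" by (simp_all add: e_def incr_def E_def p1 algebra_simps)
      then show ?thesis by (simp add: p1)
    next
      assume p2: "p = 2"
      have "e 0 \<omega> = E 2 \<omega> - 2 * E 1 \<omega>" "e 1 \<omega> = E (p + 1) \<omega> - 2 * E 2 \<omega> + E 1 \<omega>"
        by (simp_all add: e_def incr_def E_def p2 algebra_simps)
      then have "\<bar>e 0 \<omega>\<bar> \<le> \<bar>E 2 \<omega>\<bar> + 2 * \<bar>E 1 \<omega>\<bar>" "\<bar>e 1 \<omega>\<bar> \<le> \<bar>E (p + 1) \<omega>\<bar> + 2 * \<bar>E 2 \<omega>\<bar> + \<bar>E 1 \<omega>\<bar>"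
        by linarith+
      moreover have "0 \<le> \<bar>E (p + 1) \<omega>\<bar>" by simp
      ultimately show ?thesis by (simp only: distrib_left)
    qed
    then have "(\<bar>e 0 \<omega>\<bar> + \<bar>e 1 \<omega>\<bar>)\<^sup>2 \<le> (3 * (\<bar>E 1 \<omega>\<bar> + \<bar>E 2 \<omega>\<bar> + \<bar>E (p + 1) \<omega>\<bar>))\<^sup>2"
      by (intro power_mono) auto
    also have "\<dots> \<le> 27 * ((E 1 \<omega>)\<^sup>2 + (E 2 \<omega>)\<^sup>2 + (E (p + 1) \<omega>)\<^sup>2)"
    proof -
      define x y z where "x = \<bar>E 1 \<omega>\<bar>" and "y = \<bar>E 2 \<omega>\<bar>" and "z = \<bar>E (p + 1) \<omega>\<bar>"
      have eq: "(3 * (x + y + z))\<^sup>2 + 9 * ((x - y)\<^sup>2 + (y - z)\<^sup>2 + (x - z)\<^sup>2) = 27 * (x\<^sup>2 + y\<^sup>2 + z\<^sup>2)"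
        by (simp add: power2_eq_square algebra_simps)
      have "0 \<le> 9 * ((x - y)\<^sup>2 + (y - z)\<^sup>2 + (x - z)\<^sup>2)" by simp
      then have "(3 * (x + y + z))\<^sup>2 \<le> 27 * (x\<^sup>2 + y\<^sup>2 + z\<^sup>2)"
        unfolding eq[symmetric] by (simp only: le_add_same_cancel1)
      then show ?thesis by (simp add: x_def y_def z_def)
    qed
    finally show ?thesis .
  qed
  have "(\<integral>\<^sup>+\<omega>. ennreal ((w \<omega> * (\<bar>e 0 \<omega>\<bar> + \<bar>e 1 \<omega>\<bar>))\<^sup>2) \<partial>M)
    \<le> (\<integral>\<^sup>+\<omega>. 27 * (ennreal ((w \<omega> * E 1 \<omega>)\<^sup>2) + ennreal ((w \<omega> * E 2 \<omega>)\<^sup>2) + ennreal ((w \<omega> * E (p + 1) \<omega>)\<^sup>2)) \<partial>M)"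
  proof (intro nn_integral_mono)
    fix \<omega>
    have "(w \<omega> * (\<bar>e 0 \<omega>\<bar> + \<bar>e 1 \<omega>\<bar>))\<^sup>2 \<le> (w \<omega>)\<^sup>2 * (27 * ((E 1 \<omega>)\<^sup>2 + (E 2 \<omega>)\<^sup>2 + (E (p + 1) \<omega>)\<^sup>2))"
      unfolding power_mult_distrib using S by (intro mult_left_mono) auto
    also have "\<dots> = 27 * ((w \<omega> * E 1 \<omega>)\<^sup>2 + (w \<omega> * E 2 \<omega>)\<^sup>2 + (w \<omega> * E (p + 1) \<omega>)\<^sup>2)"
      by (simp add: power_mult_distrib algebra_simps)
    finally have "ennreal ((w \<omega> * (\<bar>e 0 \<omega>\<bar> + \<bar>e 1 \<omega>\<bar>))\<^sup>2)
        \<le> ennreal (27 * ((w \<omega> * E 1 \<omega>)\<^sup>2 + (w \<omega> * E 2 \<omega>)\<^sup>2 + (w \<omega> * E (p + 1) \<omega>)\<^sup>2))"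
      by (rule ennreal_leI)
    also have "\<dots> = 27 * (ennreal ((w \<omega> * E 1 \<omega>)\<^sup>2) + ennreal ((w \<omega> * E 2 \<omega>)\<^sup>2) + ennreal ((w \<omega> * E (p + 1) \<omega>)\<^sup>2))"
      by (subst ennreal_mult) simp_all
    finally show "ennreal ((w \<omega> * (\<bar>e 0 \<omega>\<bar> + \<bar>e 1 \<omega>\<bar>))\<^sup>2) \<le> \<dots>" .
  qed
  also have "\<dots> = 27 * ((\<integral>\<^sup>+\<omega>. ennreal ((w \<omega> * E 1 \<omega>)\<^sup>2) \<partial>M) + (\<integral>\<^sup>+\<omega>. ennreal ((w \<omega> * E 2 \<omega>)\<^sup>2) \<partial>M)
      + (\<integral>\<^sup>+\<omega>. ennreal ((w \<omega> * E (p + 1) \<omega>)\<^sup>2) \<partial>M))"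
  proof -
    have [measurable]: "E 1 \<in> borel_measurable M" "E 2 \<in> borel_measurable M" "E (p + 1) \<in> borel_measurable M"
      using p by (auto intro!: Em)
    show ?thesis by (subst nn_integral_cmult, measurable, subst nn_integral_add, measurable, subst nn_integral_add, measurable)
  qed
  also have "\<dots> \<le> 27 * (ennreal (162 * q * h\<^sup>2) * A + ennreal (162 * q * h\<^sup>2) * A + ennreal (162 * q * h\<^sup>2) * A)"
    using p by (intro mult_left_mono add_mono EB) auto
  also have "\<dots> = ennreal (13122 * q * h\<^sup>2) * A"
  proof -
    have "ennreal (13122 * q * h\<^sup>2) = 81 * ennreal (162 * q * h\<^sup>2)"
      using ennreal_mult'[of 81 "162 * q * h\<^sup>2"] by (simp add: mult.assoc)
    moreover have "27 * (y + y + y) = 81 * y" for y :: ennreal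
    proof -
      have "(1 + 1 + 1) * y = y + y + y" by (simp only: distrib_right mult_1_left)
      then have "y + y + y = 3 * y" by simp
      then show ?thesis by (simp add: mult.assoc[symmetric])
    qed
    ultimately show ?thesis by (simp only: mult.assoc)
  qed
  finally show ?thesis unfolding A_def .
qed

text \<open>\<open>abs_ratio_perturb\<close> is applied with \<kappa> = 1 / q. The squared error
  contributes q^2 / \<eta>^2 times 13122 q h^2 and the kernel 7 \<eta> / sqrt h; the choice \<eta> =
  h^(5/6) turns both into multiples of h^(1/3).\<close>

lemma ratio_error_bound:
  assumes p: "p \<in> {1, 2}" and t: "0 \<le> t" "0 < h" "t + real (p + 1) * h \<le> 1" "3 * h < h0"
    and Z: "Z \<in> borel_measurable (F t)" and Z0: "\<And>\<omega>. 0 \<le> Z \<omega>" and Zb: "\<And>\<omega>. Z \<omega> \<le> C"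
    and supp: "\<And>\<omega>. \<omega> \<in> space M \<Longrightarrow> \<omega> \<notin> G_hull t \<Longrightarrow> Z \<omega> = 0"
  defines "r \<equiv> \<lambda>Y \<omega>. incr_ratio p (\<lambda>t. Y t \<omega>) t h"
  shows "(\<integral>\<^sup>+\<omega>. ennreal (Z \<omega> * \<bar>r X' \<omega> - r B \<omega>\<bar>) \<partial>M)
    \<le> ennreal ((13122 * q ^ 3 + 7) * h powr (1/3)) * (\<integral>\<^sup>+\<omega>. ennreal (Z \<omega>) \<partial>M)"
proof -
  define \<eta> where "\<eta> = h powr (5/6)"
  have \<eta>: "\<eta> > 0" using t by (simp add: \<eta>_def)
  \<comment> \<open>The square root moves the weight inside the square, the form in which
    \<open>incr_error_bound\<close> takes it.\<close>
  define w where "w = (\<lambda>\<omega>. sqrt (Z \<omega>))"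
  have w2: "(w \<omega>)\<^sup>2 = Z \<omega>" for \<omega> using Z0 by (simp add: w_def)
  define A where "A = (\<integral>\<^sup>+\<omega>. ennreal (Z \<omega>) \<partial>M)"
  define e where "e = (\<lambda>j \<omega>. incr p (\<lambda>t. X' t \<omega>) t h j - a t \<omega> * incr p (\<lambda>t. B t \<omega>) t h j)"
  have "0 < real (p + 1) * h" using t by simp
  then have tlt: "t < 1" using t by linarith
  have ZM[measurable]: "Z \<in> borel_measurable M" using measurable_F[OF Z] t tlt by auto
  have [measurable]: "w \<in> borel_measurable M" unfolding w_def by measurable
  have [measurable]: "a t \<in> borel_measurable M" using measurable_F[OF a_measurable_F] t tlt by auto
  have pj: "t + real (0 + p) * h \<le> 1" using t by (simp add: algebra_simps)
  have "(\<lambda>\<omega>. incr p (\<lambda>t. X' t \<omega>) t h 0) \<in> borel_measurable (F 1)" "(\<lambda>\<omega>. incr p (\<lambda>t. B t \<omega>) t h 0) \<in> borel_measurable (F 1)"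
    "(\<lambda>\<omega>. incr p (\<lambda>t. X' t \<omega>) t h 1) \<in> borel_measurable (F 1)" "(\<lambda>\<omega>. incr p (\<lambda>t. B t \<omega>) t h 1) \<in> borel_measurable (F 1)"
    using p t pj by (auto intro!: incr_X'_measurable simp: add.commute)
  then have im[measurable]: "(\<lambda>\<omega>. incr p (\<lambda>t. X' t \<omega>) t h 0) \<in> borel_measurable M" "(\<lambda>\<omega>. incr p (\<lambda>t. B t \<omega>) t h 0) \<in> borel_measurable M"
    "(\<lambda>\<omega>. incr p (\<lambda>t. X' t \<omega>) t h 1) \<in> borel_measurable M" "(\<lambda>\<omega>. incr p (\<lambda>t. B t \<omega>) t h 1) \<in> borel_measurable M"
    by (auto intro: measurable_F)
  have [measurable]: "e 0 \<in> borel_measurable M" "e 1 \<in> borel_measurable M" unfolding e_def by measurable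
  have wF: "w \<in> borel_measurable (F t)" unfolding w_def using Z by measurable
  have wb: "\<bar>w \<omega>\<bar> \<le> sqrt C" for \<omega> using Z0[of \<omega>] Zb[of \<omega>] by (simp add: w_def)
  have ws: "w \<omega> = 0" if "\<omega> \<in> space M" "\<omega> \<notin> G_hull t" for \<omega> using supp[OF that] by (simp add: w_def)
  let ?k = "\<lambda>\<omega>. 2 * \<eta>\<^sup>2 / (\<eta>\<^sup>2 + (incr p (\<lambda>t. B t \<omega>) t h 0)\<^sup>2)" and ?s = "\<lambda>\<omega>. \<bar>e 0 \<omega>\<bar> + \<bar>e 1 \<omega>\<bar>"
  have "(\<integral>\<^sup>+\<omega>. ennreal (Z \<omega> * \<bar>r X' \<omega> - r B \<omega>\<bar>) \<partial>M)
    \<le> (\<integral>\<^sup>+\<omega>. ennreal ((q / \<eta>)\<^sup>2) * ennreal ((w \<omega> * (?s \<omega>))\<^sup>2)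
        + ennreal (Z \<omega>) * ennreal (?k \<omega>) \<partial>M)"
  proof (rule nn_integral_mono_AE)
    show "AE \<omega> in M. ennreal (Z \<omega> * \<bar>r X' \<omega> - r B \<omega>\<bar>)
      \<le> ennreal ((q / \<eta>)\<^sup>2) * ennreal ((w \<omega> * (?s \<omega>))\<^sup>2)
        + ennreal (Z \<omega>) * ennreal (?k \<omega>)"
      using a_lower_hull[OF t(1) tlt] AE_space
    proof eventually_elim
      case (elim \<omega>)
      show ?case
      proof (cases "\<omega> \<in> G_hull t")
        case False
        then show ?thesis using supp elim by simp
      next
        case True
        then have "1 / q \<le> \<bar>a t \<omega>\<bar>" using elim by simp
        from abs_ratio_perturb[OF \<eta> _ this]
        have "\<bar>r X' \<omega> - r B \<omega>\<bar> \<le> ((?s \<omega>) / (1 / q * \<eta>))\<^sup>2 + ?k \<omega>"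
          using q unfolding r_def incr_ratio_def e_def by simp
        then have "Z \<omega> * \<bar>r X' \<omega> - r B \<omega>\<bar>
          \<le> Z \<omega> * (((?s \<omega>) / (1 / q * \<eta>))\<^sup>2 + ?k \<omega>)"
          using Z0 by (rule mult_left_mono)
        also have "\<dots> = (q / \<eta>)\<^sup>2 * (w \<omega> * (?s \<omega>))\<^sup>2 + Z \<omega> * (?k \<omega>)"
        proof -
          have "z * ((s / (1 / q * \<eta>))\<^sup>2 + k) = (q / \<eta>)\<^sup>2 * (z * s\<^sup>2) + z * k" for z s k :: real
            by (simp add: distrib_left power_divide power_mult_distrib)
          then show ?thesis unfolding power_mult_distrib[of "w \<omega>"] w2 .
        qed
        finally have "ennreal (Z \<omega> * \<bar>r X' \<omega> - r B \<omega>\<bar>)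
          \<le> ennreal ((q / \<eta>)\<^sup>2 * (w \<omega> * (?s \<omega>))\<^sup>2 + Z \<omega> * (?k \<omega>))"
          by (rule ennreal_leI)
        also have "\<dots> = ennreal ((q / \<eta>)\<^sup>2) * ennreal ((w \<omega> * (?s \<omega>))\<^sup>2)
          + ennreal (Z \<omega>) * ennreal (?k \<omega>)"
        proof -
          have gen: "ennreal (c * x + Z \<omega> * k) = ennreal c * ennreal x + ennreal (Z \<omega>) * ennreal k"
            if "0 \<le> c" "0 \<le> x" "0 \<le> k" for c x k :: real
            using that Z0 by (simp add: ennreal_plus ennreal_mult)
          show ?thesis by (rule gen) simp_all
        qed
        finally show ?thesis .
      qed
    qed
  qed
  also have "\<dots> = ennreal ((q / \<eta>)\<^sup>2) * (\<integral>\<^sup>+\<omega>. ennreal ((w \<omega> * (?s \<omega>))\<^sup>2) \<partial>M)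
      + (\<integral>\<^sup>+\<omega>. ennreal (Z \<omega>) * ennreal (?k \<omega>) \<partial>M)"
    by (subst nn_integral_add, measurable, subst nn_integral_cmult, measurable)
  also have "\<dots> \<le> ennreal ((q / \<eta>)\<^sup>2) * (ennreal (13122 * q * h\<^sup>2) * A) + ennreal (7 * \<eta> / sqrt h) * A"
  proof (intro add_mono mult_left_mono)
    show "(\<integral>\<^sup>+\<omega>. ennreal ((w \<omega> * (?s \<omega>))\<^sup>2) \<partial>M) \<le> ennreal (13122 * q * h\<^sup>2) * A"
      using incr_error_bound[OF p t wF ws wb] unfolding w2 A_def e_def by simp
    show "(\<integral>\<^sup>+\<omega>. ennreal (Z \<omega>) * ennreal (?k \<omega>) \<partial>M) \<le> ennreal (7 * \<eta> / sqrt h) * A"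
      unfolding A_def by (rule small_incr_bound[OF p t(1,2,3) Z \<eta>])
  qed simp
  also have "\<dots> = ennreal ((13122 * q ^ 3 + 7) * h powr (1/3)) * A"
  proof -
    have h1: "h\<^sup>2 / \<eta>\<^sup>2 = h powr (1/3)"
    proof -
      have "\<eta>\<^sup>2 = h powr (5/3)" using t by (simp add: \<eta>_def powr_power)
      moreover have "h\<^sup>2 = h powr 2" using t by (simp add: powr_numeral)
      ultimately show ?thesis by (simp add: powr_diff[symmetric])
    qed
    have h2: "\<eta> / sqrt h = h powr (1/3)"
      using t by (simp add: \<eta>_def powr_half_sqrt[symmetric] powr_diff[symmetric])
    have "(q / \<eta>)\<^sup>2 * (13122 * q * h\<^sup>2) = 13122 * q ^ 3 * (h\<^sup>2 / \<eta>\<^sup>2)"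
      by (simp add: power_divide power2_eq_square power3_eq_cube)
    then have e1: "ennreal ((q / \<eta>)\<^sup>2) * ennreal (13122 * q * h\<^sup>2) = ennreal (13122 * q ^ 3 * h powr (1/3))"
      using q by (subst ennreal_mult[symmetric]) (auto simp: h1)
    have e2: "ennreal (7 * \<eta> / sqrt h) = ennreal (7 * h powr (1/3))"
      unfolding h2[symmetric] by simp
    have "ennreal ((13122 * q ^ 3 + 7) * h powr (1/3)) = ennreal (13122 * q ^ 3 * h powr (1/3)) + ennreal (7 * h powr (1/3))"
      using q by (subst ennreal_plus[symmetric]) (auto simp: distrib_right)
    then show ?thesis unfolding mult.assoc[symmetric] e1 e2 by (simp only: distrib_right)
  qed
  finally show ?thesis unfolding A_def .
qed

end

section \<open>The almost sure rate\<close>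

context ito_local_version
begin

text \<open>The hull indicator is absorbed into the test weight, giving \<open>Y\<close>, still
  known at time t. Under this weight the ratio of \<open>X'\<close> may be replaced by that of
  \<open>B\<close> at cost \<epsilon>, and the latter has conditional mean exactly \<Lambda>. The
  sign \<open>s\<close> yields upper and lower bounds alike.\<close>

lemma cond_mean_ratio_error:
  assumes p: "p \<in> {1, 2}" and t: "0 \<le> t" "0 < h" "t + real (p + 1) * h \<le> 1" "3 * h < h0" and s: "s \<in> {1, -1}"
  shows "cond_mean_le M (F t) (\<lambda>\<omega>. s * (indicator (G_hull t) \<omega> *
      (incr_ratio p (\<lambda>t. X' t \<omega>) t h - IR_Lambda p (1/2))))
    ((13122 * q ^ 3 + 7) * h powr (1/3))"
  unfolding cond_mean_le_def
proof (intro ballI impI)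
  fix Z :: "'a \<Rightarrow> real"
  assume Z: "Z \<in> borel_measurable (F t)" and Z0: "\<forall>\<omega>. 0 \<le> Z \<omega>" and "\<exists>C. \<forall>\<omega>. Z \<omega> \<le> C"
  then obtain C where C: "\<And>\<omega>. Z \<omega> \<le> C" by blast
  define \<Lambda> where "\<Lambda> = IR_Lambda p (1/2)"
  define \<epsilon> where "\<epsilon> = (13122 * q ^ 3 + 7) * h powr (1/3)"
  have \<epsilon>: "\<epsilon> \<ge> 0" using q by (simp add: \<epsilon>_def)
  define r where "r = (\<lambda>(Y :: real \<Rightarrow> 'a \<Rightarrow> real) \<omega>. incr_ratio p (\<lambda>t. Y t \<omega>) t h)"
  define Y where "Y = (\<lambda>\<omega>. Z \<omega> * indicator (G_hull t) \<omega>)"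
  have "0 < real (p + 1) * h" using t by simp
  then have tle: "t \<le> 1" using t by linarith
  have YF: "Y \<in> borel_measurable (F t)"
    unfolding Y_def using Z hull_sets[OF t(1) tle] by measurable
  have ZM[measurable]: "Z \<in> borel_measurable M" and YM[measurable]: "Y \<in> borel_measurable M"
    using measurable_F[OF Z] measurable_F[OF YF] t tle by auto
  have pj: "t + real (0 + p) * h \<le> 1" using t by (simp add: algebra_simps)
  have "(\<lambda>\<omega>. incr p (\<lambda>t. X' t \<omega>) t h 0) \<in> borel_measurable (F 1)" "(\<lambda>\<omega>. incr p (\<lambda>t. B t \<omega>) t h 0) \<in> borel_measurable (F 1)"
    "(\<lambda>\<omega>. incr p (\<lambda>t. X' t \<omega>) t h 1) \<in> borel_measurable (F 1)" "(\<lambda>\<omega>. incr p (\<lambda>t. B t \<omega>) t h 1) \<in> borel_measurable (F 1)"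
    using p t pj by (auto intro!: incr_X'_measurable simp: add.commute)
  then have [measurable]: "(\<lambda>\<omega>. incr p (\<lambda>t. X' t \<omega>) t h 0) \<in> borel_measurable M" "(\<lambda>\<omega>. incr p (\<lambda>t. B t \<omega>) t h 0) \<in> borel_measurable M"
    "(\<lambda>\<omega>. incr p (\<lambda>t. X' t \<omega>) t h 1) \<in> borel_measurable M" "(\<lambda>\<omega>. incr p (\<lambda>t. B t \<omega>) t h 1) \<in> borel_measurable M"
    by (auto intro: measurable_F)
  have [measurable]: "r X' \<in> borel_measurable M" "r B \<in> borel_measurable M" unfolding r_def incr_ratio_def by measurable
  have Y0: "0 \<le> Y \<omega>" and YZ: "Y \<omega> \<le> Z \<omega>" for \<omega> using Z0 by (auto simp: Y_def indicator_def)
  then have YC: "Y \<omega> \<le> C" for \<omega> using C order_trans by blast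
  have iY: "integrable M Y" "integrable M Z"
    using Y0 YC Z0 C by (auto intro!: integrable_bdd[of _ C])
  have r01: "0 \<le> r V \<omega>" "r V \<omega> \<le> 1" for V \<omega> by (simp_all add: r_def incr_ratio_bounds)
  have iYr: "integrable M (\<lambda>\<omega>. Y \<omega> * g \<omega>)" if [measurable]: "g \<in> borel_measurable M" and "\<And>\<omega>. \<bar>g \<omega>\<bar> \<le> 1" for g
  proof (rule integrable_bdd)
    show "\<bar>Y \<omega> * g \<omega>\<bar> \<le> C * 1" for \<omega>
      unfolding abs_mult using Y0[of \<omega>] YC[of \<omega>] that(2)[of \<omega>] by (intro mult_mono) auto
  qed measurable
  have d1: "\<bar>r X' \<omega> - r B \<omega>\<bar> \<le> 1" for \<omega> using r01[of X' \<omega>] r01[of B \<omega>] by linarith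
  have iX: "integrable M (\<lambda>\<omega>. Y \<omega> * r X' \<omega>)" and iB: "integrable M (\<lambda>\<omega>. Y \<omega> * r B \<omega>)"
    and iD: "integrable M (\<lambda>\<omega>. Y \<omega> * \<bar>r X' \<omega> - r B \<omega>\<bar>)"
    using r01 d1 by (auto intro!: iYr)
  have "ennreal (\<integral>\<omega>. Y \<omega> * \<bar>r X' \<omega> - r B \<omega>\<bar> \<partial>M) = (\<integral>\<^sup>+\<omega>. ennreal (Y \<omega> * \<bar>r X' \<omega> - r B \<omega>\<bar>) \<partial>M)"
    using Y0 by (intro nn_integral_eq_integral[symmetric] iD) auto
  also have "\<dots> \<le> ennreal \<epsilon> * (\<integral>\<^sup>+\<omega>. ennreal (Y \<omega>) \<partial>M)"
    unfolding \<epsilon>_def r_def by (rule ratio_error_bound[OF p t YF Y0 YC]) (simp add: Y_def)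
  also have "\<dots> = ennreal (\<epsilon> * (\<integral>\<omega>. Y \<omega> \<partial>M))"
    using Y0 \<epsilon> iY by (simp add: nn_integral_eq_integral ennreal_mult)
  finally have D: "(\<integral>\<omega>. Y \<omega> * \<bar>r X' \<omega> - r B \<omega>\<bar> \<partial>M) \<le> \<epsilon> * (\<integral>\<omega>. Y \<omega> \<partial>M)"
    using \<epsilon> Y0 by (subst (asm) ennreal_le_iff) (auto intro!: mult_nonneg_nonneg integral_nonneg_AE)
  have "ennreal (\<integral>\<omega>. Y \<omega> * r B \<omega> \<partial>M) = (\<integral>\<^sup>+\<omega>. ennreal (Y \<omega> * r B \<omega>) \<partial>M)"
    using Y0 r01 by (intro nn_integral_eq_integral[symmetric] iB) auto
  also have "\<dots> = (\<integral>\<^sup>+\<omega>. ennreal (Y \<omega>) * ennreal (r B \<omega>) \<partial>M)"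
    using Y0 r01 by (intro nn_integral_cong) (simp add: ennreal_mult)
  also have "\<dots> = ennreal \<Lambda> * (\<integral>\<^sup>+\<omega>. ennreal (Y \<omega>) \<partial>M)"
    unfolding \<Lambda>_def r_def by (rule incr_ratio_mean[OF p t(1,2,3) YF])
  also have "\<dots> = ennreal (\<Lambda> * (\<integral>\<omega>. Y \<omega> \<partial>M))"
    using Y0 iY IR_Lambda_half_bounds[OF p] by (simp add: nn_integral_eq_integral ennreal_mult \<Lambda>_def)
  finally have mean: "(\<integral>\<omega>. Y \<omega> * r B \<omega> \<partial>M) = \<Lambda> * (\<integral>\<omega>. Y \<omega> \<partial>M)"
    using Y0 r01 IR_Lambda_half_bounds[OF p]
    by (subst (asm) ennreal_inj) (auto intro!: mult_nonneg_nonneg integral_nonneg_AE simp: \<Lambda>_def)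
  have "(\<integral>\<omega>. Z \<omega> * (s * (indicator (G_hull t) \<omega> * (r X' \<omega> - \<Lambda>))) \<partial>M)
      = (\<integral>\<omega>. s * (Y \<omega> * r X' \<omega> - \<Lambda> * Y \<omega>) \<partial>M)"
    by (intro Bochner_Integration.integral_cong refl) (simp add: Y_def algebra_simps)
  also have "\<dots> = s * ((\<integral>\<omega>. Y \<omega> * r X' \<omega> \<partial>M) - \<Lambda> * (\<integral>\<omega>. Y \<omega> \<partial>M))"
    using iX iY by simp
  also have "\<dots> = (\<integral>\<omega>. s * (Y \<omega> * r X' \<omega> - Y \<omega> * r B \<omega>) \<partial>M)"
    unfolding mean[symmetric] using iX iB by simp
  also have "\<dots> \<le> (\<integral>\<omega>. Y \<omega> * \<bar>r X' \<omega> - r B \<omega>\<bar> \<partial>M)"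
  proof (rule integral_mono)
    show "integrable M (\<lambda>\<omega>. s * (Y \<omega> * r X' \<omega> - Y \<omega> * r B \<omega>))" using iX iB by auto
    show "s * (Y \<omega> * r X' \<omega> - Y \<omega> * r B \<omega>) \<le> Y \<omega> * \<bar>r X' \<omega> - r B \<omega>\<bar>" for \<omega>
    proof -
      have "s * (r X' \<omega> - r B \<omega>) \<le> \<bar>r X' \<omega> - r B \<omega>\<bar>" using s by auto
      from mult_left_mono[OF this Y0[of \<omega>]] show ?thesis by (simp add: algebra_simps)
    qed
  qed (rule iD)
  also have "\<dots> \<le> \<epsilon> * (\<integral>\<omega>. Y \<omega> \<partial>M)" by (rule D)
  also have "\<dots> \<le> \<epsilon> * (\<integral>\<omega>. Z \<omega> \<partial>M)"
    using iY YZ \<epsilon> by (intro mult_left_mono integral_mono) auto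
  finally show "(\<integral>\<omega>. Z \<omega> * (s * (indicator (G_hull t) \<omega> * (incr_ratio p (\<lambda>t. X' t \<omega>) t h - IR_Lambda p (1/2)))) \<partial>M)
    \<le> (13122 * q ^ 3 + 7) * h powr (1/3) * (\<integral>\<omega>. Z \<omega> \<partial>M)"
    unfolding r_def \<Lambda>_def \<epsilon>_def .
qed

text \<open>The n - p genuine terms of row n are padded with zeros to \<open>n * 3\<close>, the
  length in \<open>AE_sum_bound\<close>. Summand k involves the grid points k to k + p + 1, at most
  k + 3, hence the lag.\<close>

lemma AE_signed_sum_bound:
  assumes p: "p \<in> {1, 2}" and s: "s \<in> {1, -1}"
  defines "\<xi> \<equiv> \<lambda>n k \<omega>. if k + p < n then s * (indicator (G_hull (real k / real n)) \<omega> *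
      (incr_ratio p (\<lambda>t. X' t \<omega>) (real k / real n) (1 / real n)
        - IR_Lambda p (1/2))) else 0"
  shows "AE \<omega> in M. eventually (\<lambda>n. (\<Sum>k<n * 3. \<xi> n k \<omega>) < 3 * (13122 * q ^ 3 + 7) * real 3 * real n powr (2/3)) sequentially"
proof -
  \<comment> \<open>Times are capped at 1 so that the sampled filtration makes sense for every
    index, including the padded ones.\<close>
  define G' where "G' = (\<lambda>(n::nat) j. F (min (real j / real n) 1))"
  have tb: "0 \<le> min (real j / real n) 1" "min (real j / real n) 1 \<le> 1" for n j :: nat by auto
  \<comment> \<open>From \<open>n0\<close> on, 3 / n is below \<open>h0\<close>, so the hypotheses
    reach every increment of a summand.\<close>
  obtain n0 :: nat where n0: "3 / h0 < real n0" using reals_Archimedean2 by blast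
  show ?thesis
  proof (rule AE_sum_bound[where G = G' and ?n0.0 = n0])
    show "1 \<le> 13122 * q ^ 3 + 7" using q by simp
    show "subalgebra M (G' n j)" for n j unfolding G'_def by (intro subalgebra_F tb)
    show "subalgebra (G' n j) (G' n i)" if "i \<le> j" for n i j
      unfolding G'_def using that by (intro subalgebra_F_mono tb min.mono divide_right_mono) auto
    show "\<bar>\<xi> n j \<omega>\<bar> \<le> 1" for n j \<omega>
    proof -
      have "\<bar>incr_ratio p x t h - IR_Lambda p (1/2)\<bar> \<le> 1" for x t h
        using incr_ratio_bounds[of p x t h] IR_Lambda_half_bounds[OF p] by linarith
      then show ?thesis using s by (auto simp: \<xi>_def indicator_def abs_mult)
    qed
    show "\<xi> n j \<in> borel_measurable (G' n (j + 3))" for n j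
    proof (cases "j + p < n")
      case True
      then have n: "n > 0" by simp
      let ?t = "real j / real n" and ?h = "1 / real n" and ?u = "min (real (j + 3) / real n) 1"
      have t: "0 \<le> ?t" "?t \<le> 1" "?t \<le> ?u" using True n by (auto simp: divide_right_mono)
      have h: "?t + real (i + p) * ?h \<le> ?u" if "i \<le> 1" for i
      proof -
        have "real (j + (i + p)) / real n \<le> real (j + 3) / real n" "real (j + (i + p)) / real n \<le> 1"
          using that p True n by (auto intro!: divide_right_mono)
        then show ?thesis by (simp add: add_divide_distrib)
      qed
      have "G_hull ?t \<in> sets (F ?u)"
        using hull_sets[OF t(1,2)] subalgebra_F_mono[OF t(1,3)] by (auto simp: subalgebra_def)
      moreover have "(\<lambda>\<omega>. incr p (\<lambda>t. X' t \<omega>) ?t ?h 0) \<in> borel_measurable (F ?u)" "(\<lambda>\<omega>. incr p (\<lambda>t. X' t \<omega>) ?t ?h 1) \<in> borel_measurable (F ?u)"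
        using p t h[of 0] h[of 1] by (auto intro!: incr_X'_measurable)
      ultimately show ?thesis using True unfolding \<xi>_def G'_def incr_ratio_def by simp
    qed (simp add: \<xi>_def)
    show "cond_mean_le M (G' n j) (\<xi> n j) ((13122 * q ^ 3 + 7) * real n powr (- 1/3))" if n: "n0 \<le> n" for n j
    proof (cases "j + p < n")
      case True
      have "3 / h0 < real n" using n0 n by linarith
      then have h: "3 * (1 / real n) < h0" using h0 True by (simp add: field_simps)
      let ?t = "real j / real n" and ?h = "1 / real n"
      have "real (j + (p + 1)) / real n \<le> 1" using True by simp
      then have tp: "?t + real (p + 1) * ?h \<le> 1" by (simp add: add_divide_distrib)
      have "?t \<le> 1" using True by simp
      then have G': "G' n j = F ?t" by (simp add: G'_def min_absorb1)
      have pw: "?h powr (1/3) = real n powr (- 1/3)" using True by (simp add: powr_divide powr_minus_divide)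
      have "\<xi> n j = (\<lambda>\<omega>. s * (indicator (G_hull ?t) \<omega> *
          (incr_ratio p (\<lambda>t. X' t \<omega>) ?t ?h - IR_Lambda p (1/2))))"
        using True by (simp add: \<xi>_def)
      then show ?thesis
        using cond_mean_ratio_error[OF p _ _ tp h s] True unfolding G' pw by simp
    next
      case False
      then show ?thesis using q by (auto simp: \<xi>_def cond_mean_le_def intro!: mult_nonneg_nonneg integral_nonneg_AE)
    qed
  qed simp
qed

lemma AE_IR_stat_bigo:
  assumes p: "p \<in> {1, 2}"
  shows "AE \<omega> in M. \<omega> \<in> G \<longrightarrow>
    (\<lambda>n. IR_stat p n (\<lambda>t. X t \<omega>) - IR_Lambda p (1/2)) \<in> O(\<lambda>n. real n powr (- 1/3))"
proof -
  define C where "C = 13122 * q ^ 3 + 7"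
  define \<Lambda> where "\<Lambda> = IR_Lambda p (1/2)"
  have C: "C > 0" using q by (simp add: C_def add_pos_pos)
  \<comment> \<open>Almost sure identities at single times hold simultaneously on the countable set
    of grid points.\<close>
  have XX: "AE \<omega> in M. \<forall>n k. k \<le> n \<longrightarrow> 0 < n \<longrightarrow> X (real k / real n) \<omega> = X' (real k / real n) \<omega>"
    unfolding AE_all_countable
  proof (intro allI)
    fix n k :: nat
    show "AE \<omega> in M. k \<le> n \<longrightarrow> 0 < n \<longrightarrow> X (real k / real n) \<omega> = X' (real k / real n) \<omega>"
      using X'_AE[of "real k / real n"] by (cases "k \<le> n \<and> 0 < n") auto
  qed
  have HH: "AE \<omega> in M. \<forall>n k. k \<le> n \<longrightarrow> 0 < n \<longrightarrow> \<omega> \<in> G \<longrightarrow> \<omega> \<in> G_hull (real k / real n)"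
    unfolding AE_all_countable
  proof (intro allI)
    fix n k :: nat
    show "AE \<omega> in M. k \<le> n \<longrightarrow> 0 < n \<longrightarrow> \<omega> \<in> G \<longrightarrow> \<omega> \<in> G_hull (real k / real n)"
      using hull_superset[of "real k / real n"] by (cases "k \<le> n \<and> 0 < n") auto
  qed
  show ?thesis
    using AE_signed_sum_bound[OF p, of 1, simplified] AE_signed_sum_bound[OF p, of "-1", simplified] XX HH
  proof eventually_elim
    case (elim \<omega>)
    show ?case
    proof
      assume G: "\<omega> \<in> G"
      define S where "S = (\<lambda>n. \<Sum>k<n - p. abs_ratio (gen_incr p n (\<lambda>t. X t \<omega>) k) (gen_incr p n (\<lambda>t. X t \<omega>) (k + 1)) - \<Lambda>)"
      let ?\<xi> = "\<lambda>s n k. if k + p < n then s * (indicator (G_hull (real k / real n)) \<omega> *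
        (incr_ratio p (\<lambda>t. X' t \<omega>) (real k / real n) (1 / real n) - IR_Lambda p (1/2))) else 0"
      \<comment> \<open>On \<open>G\<close> every hull indicator is 1 and the padding vanishes, so
        the two signed sums are \<open>S n\<close> and its negative.\<close>
      have eqS: "(\<Sum>k<n * 3. ?\<xi> s n k) = s * S n" for n and s :: real
      proof -
        have "(\<Sum>k<n * 3. ?\<xi> s n k)
        = (\<Sum>k<n - p. s * (abs_ratio (gen_incr p n (\<lambda>t. X t \<omega>) k) (gen_incr p n (\<lambda>t. X t \<omega>) (k + 1)) - \<Lambda>))"
        proof (rule sum.mono_neutral_cong_right)
          fix k assume k: "k \<in> {..<n - p}"
          then have kn: "k + p < n" by auto
          have hk: "\<omega> \<in> G_hull (real k / real n)" using elim(4) kn G by auto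
          have g: "gen_incr p n (\<lambda>t. X t \<omega>) (k + j) = incr p (\<lambda>t. X' t \<omega>) (real k / real n) (1 / real n) j" if "j \<le> 1" for j
          proof -
            have "gen_incr p n (\<lambda>t. X t \<omega>) (k + j) = gen_incr p n (\<lambda>t. X' t \<omega>) (k + j)"
              unfolding gen_incr_def
            proof (rule sum.cong[OF refl])
              fix i assume "i \<in> {0..p}"
              then have "k + j + i \<le> n" "0 < n" using kn that by auto
              from elim(3)[rule_format, OF this]
              show "(- 1) ^ (p - i) * real (p choose i) * X (real (k + j + i) / real n) \<omega>
                = (- 1) ^ (p - i) * real (p choose i) * X' (real (k + j + i) / real n) \<omega>" by simp
            qed
            then show ?thesis using gen_incr_eq_incr[OF p] by simp
          qed
          show "?\<xi> s n k = s * (abs_ratio (gen_incr p n (\<lambda>t. X t \<omega>) k) (gen_incr p n (\<lambda>t. X t \<omega>) (k + 1)) - \<Lambda>)"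
            using kn hk g[of 0] g[of 1] by (simp add: \<Lambda>_def incr_ratio_def)
        qed auto
        then show ?thesis by (simp add: S_def sum_distrib_left)
      qed
      have e1: "eventually (\<lambda>n. S n < 9 * C * real n powr (2/3)) sequentially"
        using elim(1) eqS[of _ 1] by (simp add: C_def mult_ac)
      have e2: "eventually (\<lambda>n. - S n < 9 * C * real n powr (2/3)) sequentially"
        using elim(2) eqS[of _ "-1"] by (simp add: C_def mult_ac)
      show "(\<lambda>n. IR_stat p n (\<lambda>t. X t \<omega>) - IR_Lambda p (1/2)) \<in> O(\<lambda>n. real n powr (- 1/3))"
      proof (rule bigoI[of _ "27 * C"])
        show "eventually (\<lambda>n. norm (IR_stat p n (\<lambda>t. X t \<omega>) - IR_Lambda p (1/2)) \<le> 27 * C * norm (real n powr (- 1/3))) sequentially"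
          using e1 e2 eventually_ge_at_top[of 3]
        proof eventually_elim
          case (elim n)
          have np: "n > p" "p \<le> 2" using elim p by auto
          have "IR_stat p n (\<lambda>t. X t \<omega>) - \<Lambda> = S n / real (n - p)"
            using np unfolding IR_stat_def S_def by (simp add: sum_subtractf diff_divide_distrib)
          \<comment> \<open>For n >= 3 and p <= 2 the number n - p of terms is at least n / 3, which
            turns 9 C into 27 C.\<close>
          moreover have "\<bar>S n / real (n - p)\<bar> \<le> (9 * C * real n powr (2/3)) / (real n / 3)"
            unfolding abs_divide using elim np C by (intro frac_le) auto
          moreover have "(9 * C * real n powr (2/3)) / (real n / 3) = 27 * C * real n powr (- 1/3)"
          proof -
            have "real n powr (2/3) / real n = real n powr (- 1/3)"
              using elim powr_diff[of "real n" "2/3" 1] by simp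
            moreover have "(9 * C * real n powr (2/3)) / (real n / 3) = 27 * C * (real n powr (2/3) / real n)" by simp
            ultimately show ?thesis by simp
          qed
          ultimately show ?case by (simp add: \<Lambda>_def)
        qed
      qed
    qed
  qed
qed

end

theorem theorem3p1:
  fixes M :: "'a measure" and F :: "real \<Rightarrow> 'a measure"
    and B a b X :: "real \<Rightarrow> 'a \<Rightarrow> real" and K1 K2 :: "'a \<Rightarrow> real" and p :: nat
  assumes "prob_space M"
    and "right_cont_filtration M F"
    and "brownian_motion M F B"
    and "ito_process M F B a b X"
    and "K1 \<in> borel_measurable M" and "AE \<omega> in M. 0 < K1 \<omega>"
    and "K2 \<in> borel_measurable M" and "AE \<omega> in M. 0 < K2 \<omega>"
    and "\<exists>h0>0. \<forall>h t. 0 < h \<and> h < h0 \<and> 0 \<le> t \<and> t + h \<le> 1 \<longrightarrow>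
           (AE \<omega> in M. \<bar>a t \<omega>\<bar> \<ge> K1 \<omega>) \<and>
           (AE \<omega> in M. cond_exp_at M F t (\<lambda>\<omega>'. (b (t + h) \<omega>')\<^sup>2) \<omega> \<le> ennreal (K2 \<omega>)) \<and>
           (AE \<omega> in M. cond_exp_at M F t (\<lambda>\<omega>'. (a (t + h) \<omega>' - a t \<omega>')\<^sup>2) \<omega> \<le> ennreal (K2 \<omega> * h))"
    and "p \<in> {1, 2}"
  shows "AE \<omega> in M. (\<lambda>n. IR_stat p n (\<lambda>t. X t \<omega>) - IR_Lambda p (1/2)) \<in> O(\<lambda>n. real n powr (- 1/3))"
proof -
  interpret filtered_brownian M F B
    using assms(1,2,3) by (simp add: filtered_brownian_def filtered_brownian_axioms_def)
  note [measurable] = assms(5,7)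
  obtain h0 where h0: "h0 > 0" and hyp: "\<And>h t. 0 < h \<Longrightarrow> h < h0 \<Longrightarrow> 0 \<le> t \<Longrightarrow> t + h \<le> 1 \<Longrightarrow>
           (AE \<omega> in M. \<bar>a t \<omega>\<bar> \<ge> K1 \<omega>) \<and>
           (AE \<omega> in M. cond_exp_at M F t (\<lambda>\<omega>'. (b (t + h) \<omega>')\<^sup>2) \<omega> \<le> ennreal (K2 \<omega>)) \<and>
           (AE \<omega> in M. cond_exp_at M F t (\<lambda>\<omega>'. (a (t + h) \<omega>' - a t \<omega>')\<^sup>2) \<omega> \<le> ennreal (K2 \<omega> * h))"
    using assms(9) by blast
  have "\<forall>t\<in>{0..1}. \<exists>X'. X' \<in> borel_measurable (F t) \<and> (AE \<omega> in M. X t \<omega> = X' \<omega>)"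
    using ito_process_F_version[OF assms(4)] by (auto simp: Bex_def)
  from bchoice[OF this] obtain X' where X': "\<forall>t\<in>{0..1}. X' t \<in> borel_measurable (F t) \<and> (AE \<omega> in M. X t \<omega> = X' t \<omega>)"
    by blast
  \<comment> \<open>These events exhaust the space up to a null set, since \<open>K1\<close> is
    positive almost surely and \<open>K2\<close> is real valued.\<close>
  define G where "G = (\<lambda>m::nat. {\<omega> \<in> space M. 1 / real (Suc m) < K1 \<omega> \<and> K2 \<omega> < real (Suc m)})"
  have "AE \<omega> in M. \<omega> \<in> G m \<longrightarrow> (\<lambda>n. IR_stat p n (\<lambda>t. X t \<omega>) - IR_Lambda p (1/2)) \<in> O(\<lambda>n. real n powr (- 1/3))" for m
  proof -
    have G_ev: "G m \<in> events" unfolding G_def by measurable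
    interpret ito_local_version M F B a b X "G m" "real (Suc m)" h0 X'
    proof (unfold_locales)
      show "ito_process M F B a b X" "G m \<in> events" "h0 > 0" by fact+
      show "0 < real (Suc m)" by simp
      fix t :: real assume t: "0 \<le> t"
      show "AE \<omega> in M. \<omega> \<in> G m \<longrightarrow> 1 / real (Suc m) \<le> \<bar>a t \<omega>\<bar>" if "t < 1"
      proof -
        \<comment> \<open>The lower bound does not involve the step, so any admissible one will do;
          it exists because t < 1.\<close>
        have "AE \<omega> in M. \<bar>a t \<omega>\<bar> \<ge> K1 \<omega>"
          using hyp[of "min (h0 / 2) (1 - t)" t] h0 t that by auto
        then show ?thesis by eventually_elim (auto simp: G_def)
      qed
      show "X' t \<in> borel_measurable (F t)" "AE \<omega> in M. X t \<omega> = X' t \<omega>" if "t \<le> 1"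
        using X' t that by auto
      fix s assume s: "t < s" "s \<le> 1" "s < t + h0"
      note hyp_s = hyp[of "s - t" t]
      have "AE \<omega> in M. cond_exp_at M F t (\<lambda>\<omega>. (b s \<omega>)\<^sup>2) \<omega> \<le> ennreal (K2 \<omega>)"
        using hyp_s t s by simp
      then show "AE \<omega> in M. \<omega> \<in> G m \<longrightarrow> cond_exp_at M F t (\<lambda>\<omega>. (b s \<omega>)\<^sup>2) \<omega> \<le> ennreal (real (Suc m))"
      proof eventually_elim
        case (elim \<omega>)
        show ?case
        proof
          assume "\<omega> \<in> G m"
          then have "ennreal (K2 \<omega>) \<le> ennreal (real (Suc m))" by (intro ennreal_leI) (simp add: G_def)
          with elim show "cond_exp_at M F t (\<lambda>\<omega>. (b s \<omega>)\<^sup>2) \<omega> \<le> ennreal (real (Suc m))" by (rule order_trans)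
        qed
      qed
      have "AE \<omega> in M. cond_exp_at M F t (\<lambda>\<omega>. (a s \<omega> - a t \<omega>)\<^sup>2) \<omega> \<le> ennreal (K2 \<omega> * (s - t))"
        using hyp_s t s by simp
      then show "AE \<omega> in M. \<omega> \<in> G m \<longrightarrow> cond_exp_at M F t (\<lambda>\<omega>. (a s \<omega> - a t \<omega>)\<^sup>2) \<omega> \<le> ennreal (real (Suc m) * (s - t))"
      proof eventually_elim
        case (elim \<omega>)
        show ?case
        proof
          assume "\<omega> \<in> G m"
          then have "ennreal (K2 \<omega> * (s - t)) \<le> ennreal (real (Suc m) * (s - t))"
            using s by (intro ennreal_leI mult_right_mono) (simp_all add: G_def)
          with elim show "cond_exp_at M F t (\<lambda>\<omega>. (a s \<omega> - a t \<omega>)\<^sup>2) \<omega> \<le> ennreal (real (Suc m) * (s - t))" by (rule order_trans)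
        qed
      qed
    qed
    show ?thesis by (rule AE_IR_stat_bigo[OF assms(10)])
  qed
  then have "AE \<omega> in M. \<forall>m. \<omega> \<in> G m \<longrightarrow> (\<lambda>n. IR_stat p n (\<lambda>t. X t \<omega>) - IR_Lambda p (1/2)) \<in> O(\<lambda>n. real n powr (- 1/3))"
    unfolding AE_all_countable by blast
  with assms(6) AE_space show ?thesis
  proof eventually_elim
    case (elim \<omega>)
    obtain m :: nat where m: "max (1 / K1 \<omega>) (K2 \<omega>) < real m" using reals_Archimedean2 by blast
    then have "1 / K1 \<omega> < real (Suc m)" "K2 \<omega> < real (Suc m)" by auto
    then have "\<omega> \<in> G m" using elim(1,2) by (simp add: G_def field_simps)
    then show ?case using elim(3) by blast
  qed
qed

end
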